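(* Let $\mathcal A_0$ be the space of $N$-tuples $\{(G_j,L_j)\}_{j=1}^N$ with $G_j\in SL(n)$, $L_j\in\mathfrak h_{ss}^{nr}$, with the Poisson structure $$\{\overset{1}{G_j},\overset{2}{G_k}\}=-\overset{1}{G_j}\overset{2}{G_k}\,r(L_k)\,\delta_{jk},\qquad \{\overset{1}{G_j},\overset{2}{L_k}\}=-\overset{1}{G_k}\,\Omega\,\delta_{jk}$$ (and all brackets between entries of the $L_j$'s equal to zero). The moment map corresponding to the action $G_j\mapsto SG_j$ ($j=1,\dots,N$, $S\in SL(n)$) on $\mathcal A_0$ is $\sum_{j=1}^N G_jL_jG_j^{-1}$. The Poisson structure induced on $$\mathcal A=\Big\{\{(G_j,L_j)\}_{j=1}^N\in\mathcal A_0:\ \sum_{j=1}^N G_jL_jG_j^{-1}=0\Big\}\Big/\big(G_j\sim SG_j,\ S\in SL(n)\big)$$ by symplectic (Hamiltonian) reduction on the zero level set of this moment map is non-degenerate, and the corresponding symplectic form is $\omega_{\mathcal A}=\mathrm d\theta_{\mathcal A}$, where the symplectic potential is $$\theta_{\mathcal A}=\sum_{k=1}^N\mathrm{tr}\,(L_kG_k^{-1}\,\mathrm dG_k).$$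
   Context: $SL(n)=SL(n,\mathbb C)$. $\mathfrak h_{ss}^{nr}$ is the set of traceless diagonal complex $n\times n$ matrices $L=\mathrm{diag}(\lambda_1,\dots,\lambda_n)$ with pairwise distinct entries no two of which differ by an integer. $\overset1M=M\otimes\mathbf 1$, $\overset2M=\mathbf 1\otimes M$, and $\{\overset1X,\overset2Y\}$ is the $n^2\times n^2$ matrix of all brackets, i.e. $\{\overset1X,\overset2Y\}=\sum\{X_{ab},Y_{cd}\}E_{ab}\otimes E_{cd}$, where $E_{ab}$ are the elementary matrices. Further, $$r(L)=\sum_{i<j}\frac{E_{ij}\otimes E_{ji}-E_{ji}\otimes E_{ij}}{\lambda_i-\lambda_j},\qquad \Omega=\sum_{i=1}^nE_{ii}\otimes E_{ii}-\frac1n\mathbf 1\otimes\mathbf 1 .$$ Convention relating Poisson brackets and symplectic forms: $\omega=\mathrm dp\wedge \mathrm dq$ corresponds to $\{p,q\}=1$. Differential forms on the quotient $\mathcal A$ are identified with the forms on the level set $\sum_jG_jL_jG_j^{-1}=0$ which descend to the quotient. *)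

theory Defs
  imports "HOL-Analysis.Analysis"
begin

type_synonym 'n cmat = "complex^'n^'n"

text \<open>
  A point of the ambient space of \<open>N\<close>-tuples of pairs of matrices is given by its coordinates:
  \<open>Inl (j, a, b)\<close> indexes the entry \<open>(a, b)\<close> of \<open>G\<^sub>j\<close>, and \<open>Inr (j, a, b)\<close> the
  entry \<open>(a, b)\<close> of \<open>L\<^sub>j\<close>.  Here \<open>'N\<close> is the index set of the tuples and \<open>'n\<close> the index
  set of the rows and columns.
\<close>
type_synonym ('N, 'n) point = "complex^(('N \<times> 'n \<times> 'n) + ('N \<times> 'n \<times> 'n))"

definition Gmat :: "'N \<Rightarrow> ('N::finite, 'n::finite) point \<Rightarrow> 'n cmat" where
  "Gmat j x = (\<chi> a b. x $ Inl (j, a, b))"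

definition Lmat :: "'N \<Rightarrow> ('N::finite, 'n::finite) point \<Rightarrow> 'n cmat" where
  "Lmat j x = (\<chi> a b. x $ Inr (j, a, b))"

definition mk_point :: "('N \<Rightarrow> 'n cmat) \<Rightarrow> ('N \<Rightarrow> 'n cmat) \<Rightarrow> ('N::finite, 'n::finite) point" where
  "mk_point G L = (\<chi> c. case c of Inl (j, a, b) \<Rightarrow> G j $ a $ b | Inr (j, a, b) \<Rightarrow> L j $ a $ b)"

definition SL :: "'n::finite cmat set" where
  "SL = {S. det S = 1}"

definition h_ss_nr :: "'n::finite cmat set" where
  "h_ss_nr = {L. (\<forall>i j. i \<noteq> j \<longrightarrow> L $ i $ j = 0) \<and> trace L = 0 \<and>
     (\<forall>i j. i \<noteq> j \<longrightarrow> L $ i $ i \<noteq> L $ j $ j \<and> L $ i $ i - L $ j $ j \<notin> \<int>)}"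

definition A0 :: "('N::finite, 'n::finite) point set" where
  "A0 = {x. \<forall>j. Gmat j x \<in> SL \<and> Lmat j x \<in> h_ss_nr}"

definition act :: "'n cmat \<Rightarrow> ('N::finite, 'n::finite) point \<Rightarrow> ('N, 'n) point" where
  "act S x = mk_point (\<lambda>j. S ** Gmat j x) (\<lambda>j. Lmat j x)"


subsection \<open>Holomorphic functions and tangent vectors on subsets of the ambient space\<close>

text \<open>
  Local holomorphic functions on an embedded complex submanifold \<open>X\<close> are the local restrictions
  of holomorphic functions of the ambient space.
\<close>
definition hol_at :: "(complex^'c) set \<Rightarrow> (complex^'c \<Rightarrow> complex) \<Rightarrow> complex^'c::finite \<Rightarrow> bool" where
  "hol_at X f x \<longleftrightarrow>
     (\<exists>U F. open U \<and> x \<in> U \<and>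
        (\<forall>y\<in>U. \<exists>D. (F has_derivative D) (at y) \<and> (\<forall>c v. D (c *s v) = c * D v)) \<and>
        (\<forall>y\<in>U \<inter> X. F y = f y))"

definition curve_at ::
    "'a::real_normed_vector set \<Rightarrow> 'a \<Rightarrow> 'a \<Rightarrow> (real \<Rightarrow> 'a) \<Rightarrow> bool" where
  "curve_at X x v \<gamma> \<longleftrightarrow> (\<forall>t. \<gamma> t \<in> X) \<and> \<gamma> 0 = x \<and> (\<gamma> has_vector_derivative v) (at 0)"

definition tangent :: "'a::real_normed_vector set \<Rightarrow> 'a \<Rightarrow> 'a set" where
  "tangent X x = {v. \<exists>\<gamma>. curve_at X x v \<gamma>}"

text \<open>The value at a tangent vector \<open>v\<close> of the differential at \<open>x\<close> of a function on \<open>X\<close>.\<close>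
definition differential ::
    "'a::real_normed_vector set \<Rightarrow> ('a \<Rightarrow> complex) \<Rightarrow> 'a \<Rightarrow> 'a \<Rightarrow> complex" where
  "differential X f x v =
     (THE d. \<forall>\<gamma>. curve_at X x v \<gamma> \<longrightarrow> ((\<lambda>t. f (\<gamma> t)) has_vector_derivative d) (at 0))"


subsection \<open>Poisson brackets\<close>

text \<open>
  \<open>hol f p\<close> says that \<open>f\<close> is holomorphic near the point \<open>p\<close> of the space \<open>X\<close>.  The Leibniz
  rule for functions that are only locally holomorphic forces the value of \<open>B f g\<close> at \<open>p\<close> to
  depend only on the germs of \<open>f\<close> and \<open>g\<close> at \<open>p\<close>.
\<close>
definition poisson_bracket ::
    "'p set \<Rightarrow> (('p \<Rightarrow> complex) \<Rightarrow> 'p \<Rightarrow> bool) \<Rightarrow>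
     (('p \<Rightarrow> complex) \<Rightarrow> ('p \<Rightarrow> complex) \<Rightarrow> 'p \<Rightarrow> complex) \<Rightarrow> bool" where
  "poisson_bracket X hol B \<longleftrightarrow>
     (\<forall>p\<in>X. \<forall>f g h c. hol f p \<and> hol g p \<and> hol h p \<longrightarrow>
        hol (B f g) p \<and>
        B f g p = - B g f p \<and>
        B (\<lambda>q. c * f q) g p = c * B f g p \<and>
        B (\<lambda>q. f q + g q) h p = B f h p + B g h p \<and>
        B (\<lambda>q. f q * g q) h p = f p * B g h p + g p * B f h p \<and>
        B f (B g h) p + B g (B h f) p + B h (B f g) p = 0)"

definition elem_mat :: "'n \<Rightarrow> 'n \<Rightarrow> 'n::finite cmat" where
  "elem_mat i j = (\<chi> a b. if a = i \<and> b = j then 1 else 0)"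

definition kron :: "'n cmat \<Rightarrow> 'n cmat \<Rightarrow> ('n::finite \<times> 'n) cmat" (infixl \<open>\<otimes>\<^sub>K\<close> 72) where
  "A \<otimes>\<^sub>K B = (\<chi> p q. A $ fst p $ fst q * B $ snd p $ snd q)"

text \<open>Scalar factors of \<open>n\<^sup>2 \<times> n\<^sup>2\<close> matrices are written as multiples of the identity.\<close>
definition r_mat :: "'n::{finite, linorder} cmat \<Rightarrow> ('n \<times> 'n) cmat" where
  "r_mat L = (\<Sum>(i, j)\<in>{(i, j). i < j}.
     mat (1 / (L $ i $ i - L $ j $ j)) **
       (elem_mat i j \<otimes>\<^sub>K elem_mat j i - elem_mat j i \<otimes>\<^sub>K elem_mat i j))"

definition Omega :: "('n::finite \<times> 'n) cmat" where
  "Omega = (\<Sum>i\<in>UNIV. elem_mat i i \<otimes>\<^sub>K elem_mat i i)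
     - mat (1 / of_nat CARD('n)) ** (mat 1 \<otimes>\<^sub>K mat 1)"

type_synonym ('N, 'n) bracket =
  "(('N, 'n) point \<Rightarrow> complex) \<Rightarrow> (('N, 'n) point \<Rightarrow> complex) \<Rightarrow> ('N, 'n) point \<Rightarrow> complex"

text \<open>
  The coefficient of \<open>E\<^sub>a\<^sub>b \<otimes> E\<^sub>c\<^sub>d\<close> sits in row \<open>(a, c)\<close> and column \<open>(b, d)\<close>.
\<close>
definition bracket_matrix ::
    "('N, 'n) bracket \<Rightarrow> (('N::finite, 'n::finite) point \<Rightarrow> 'n cmat) \<Rightarrow>
     (('N, 'n) point \<Rightarrow> 'n cmat) \<Rightarrow> ('N, 'n) point \<Rightarrow> ('n \<times> 'n) cmat" where
  "bracket_matrix B X Y x =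
     (\<chi> p q. B (\<lambda>y. X y $ fst p $ fst q) (\<lambda>y. Y y $ snd p $ snd q) x)"

definition A0_poisson_structure :: "('N::finite, 'n::{finite, linorder}) bracket \<Rightarrow> bool" where
  "A0_poisson_structure B \<longleftrightarrow>
     poisson_bracket A0 (hol_at A0) B \<and>
     (\<forall>x\<in>A0. \<forall>j k.
        bracket_matrix B (Gmat j) (Gmat k) x =
          (if j = k then - ((Gmat j x \<otimes>\<^sub>K mat 1) ** (mat 1 \<otimes>\<^sub>K Gmat k x) ** r_mat (Lmat k x))
           else 0) \<and>
        bracket_matrix B (Gmat j) (Lmat k) x =
          (if j = k then - ((Gmat k x \<otimes>\<^sub>K mat 1) ** Omega) else 0) \<and>
        bracket_matrix B (Lmat j) (Lmat k) x = 0)"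


subsection \<open>The moment map and the reduced space\<close>

definition moment_map :: "('N::finite, 'n::finite) point \<Rightarrow> 'n cmat" where
  "moment_map x = (\<Sum>j\<in>UNIV. Gmat j x ** Lmat j x ** matrix_inv (Gmat j x))"

text \<open>
  The Lie algebra \<open>sl(n)\<close> of traceless matrices is identified with its dual by the trace form, so
  that the Hamiltonian of \<open>X\<close> is \<open>tr (X \<mu>)\<close>.  In accordance with \<open>{p, q} = 1\<close>, where
  \<open>{p, _}\<close> is translation in the direction of \<open>q\<close>, the derivation \<open>{tr (X \<mu>), _}\<close> is the
  infinitesimal action of \<open>X\<close>.
\<close>
definition is_moment_map ::
    "('N, 'n) bracket \<Rightarrow> (('N::finite, 'n::finite) point \<Rightarrow> 'n cmat) \<Rightarrow> bool" where
  "is_moment_map B \<mu> \<longleftrightarrow>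
     (\<forall>x\<in>A0. trace (\<mu> x) = 0 \<and>
        (\<forall>S\<in>SL. \<mu> (act S x) = S ** \<mu> x ** matrix_inv S) \<and>
        (\<forall>X. hol_at A0 (\<lambda>y. trace (X ** \<mu> y)) x) \<and>
        (\<forall>X S f. curve_at SL (mat 1) X S \<and> hol_at A0 f x \<longrightarrow>
           ((\<lambda>t. f (act (S t) x)) has_vector_derivative B (\<lambda>y. trace (X ** \<mu> y)) f x) (at 0)))"

definition level_set :: "('N::finite, 'n::finite) point set" where
  "level_set = {x \<in> A0. moment_map x = 0}"

definition orbit_rel :: "('N::finite, 'n::finite) point rel" where
  "orbit_rel = {(x, y). x \<in> level_set \<and> y \<in> level_set \<and> (\<exists>S\<in>SL. y = act S x)}"

definition proj :: "('N::finite, 'n::finite) point \<Rightarrow> ('N, 'n) point set" where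
  "proj x = orbit_rel `` {x}"

definition A_space :: "('N::finite, 'n::finite) point set set" where
  "A_space = level_set // orbit_rel"

definition hol_A :: "(('N::finite, 'n::finite) point set \<Rightarrow> complex) \<Rightarrow> ('N, 'n) point set \<Rightarrow> bool"
  where "hol_A \<phi> a \<longleftrightarrow> (\<forall>x\<in>a. hol_at level_set (\<lambda>y. \<phi> (proj y)) x)"

text \<open>\<open>F\<close> is an invariant holomorphic extension to \<open>A0\<close>, near the orbit of \<open>x\<close>, of the
  pull-back to the level set of the function \<open>\<phi>\<close> on the quotient.\<close>
definition invariant_lift ::
    "(('N::finite, 'n::finite) point set \<Rightarrow> complex) \<Rightarrow> ('N, 'n) point \<Rightarrow>
     (('N, 'n) point \<Rightarrow> complex) \<Rightarrow> bool" where
  "invariant_lift \<phi> x F \<longleftrightarrow>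
     (\<exists>W. openin (top_of_set A0) W \<and> x \<in> W \<and>
        (\<forall>y\<in>W. hol_at A0 F y) \<and>
        (\<forall>S\<in>SL. \<forall>y\<in>W. act S y \<in> W \<and> F (act S y) = F y) \<and>
        (\<forall>y\<in>W \<inter> level_set. F y = \<phi> (proj y)))"

type_synonym ('N, 'n) red_bracket =
  "(('N, 'n) point set \<Rightarrow> complex) \<Rightarrow> (('N, 'n) point set \<Rightarrow> complex) \<Rightarrow>
   ('N, 'n) point set \<Rightarrow> complex"

text \<open>
  The bracket on the quotient obtained by Hamiltonian reduction: the bracket of two functions is
  the value on the level set of the bracket of any invariant lifts of them.  Since lifts are
  required to exist, the brackets of locally holomorphic functions are determined uniquely.
\<close>
definition is_reduced_bracket ::
    "('N, 'n) bracket \<Rightarrow> ('N::finite, 'n::finite) red_bracket \<Rightarrow> bool" where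
  "is_reduced_bracket B0 B \<longleftrightarrow>
     (\<forall>a\<in>A_space. \<forall>\<phi> \<psi>. hol_A \<phi> a \<and> hol_A \<psi> a \<longrightarrow>
        (\<forall>x\<in>a. (\<exists>F. invariant_lift \<phi> x F) \<and> (\<exists>H. invariant_lift \<psi> x H) \<and>
           (\<forall>F H. invariant_lift \<phi> x F \<and> invariant_lift \<psi> x H \<longrightarrow> B \<phi> \<psi> a = B0 F H x)))"

definition diff_A ::
    "(('N::finite, 'n::finite) point set \<Rightarrow> complex) \<Rightarrow> ('N, 'n) point \<Rightarrow> ('N, 'n) point \<Rightarrow> complex"
  where "diff_A \<phi> x v = differential level_set (\<lambda>y. \<phi> (proj y)) x v"

text \<open>The Poisson tensor, as a map from covectors to vectors, has trivial kernel at every point.\<close>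
definition nondegenerate_bracket :: "('N::finite, 'n::finite) red_bracket \<Rightarrow> bool" where
  "nondegenerate_bracket B \<longleftrightarrow>
     (\<forall>a\<in>A_space. \<forall>\<phi>. hol_A \<phi> a \<and> (\<forall>\<psi>. hol_A \<psi> a \<longrightarrow> B \<phi> \<psi> a = 0) \<longrightarrow>
        (\<forall>x\<in>a. \<forall>v\<in>tangent level_set x. diff_A \<phi> x v = 0))"


subsection \<open>Differential forms\<close>

text \<open>
  Forms are given on the ambient space and considered on tangent vectors of the level set.
  In the following two definitions the vectors \<open>u\<close>, \<open>v\<close>, \<open>w\<close> are extended to constant vector
  fields, which commute.
\<close>
definition ext_d1 :: "(complex^'c \<Rightarrow> complex^'c \<Rightarrow> complex) \<Rightarrow>
    complex^'c \<Rightarrow> complex^'c \<Rightarrow> complex^'c::finite \<Rightarrow> complex" where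
  "ext_d1 \<theta> x u v =
     frechet_derivative (\<lambda>y. \<theta> y v) (at x) u - frechet_derivative (\<lambda>y. \<theta> y u) (at x) v"

definition ext_d2 :: "(complex^'c \<Rightarrow> complex^'c \<Rightarrow> complex^'c \<Rightarrow> complex) \<Rightarrow>
    complex^'c \<Rightarrow> complex^'c \<Rightarrow> complex^'c \<Rightarrow> complex^'c::finite \<Rightarrow> complex" where
  "ext_d2 \<omega> x u v w =
     frechet_derivative (\<lambda>y. \<omega> y v w) (at x) u
     + frechet_derivative (\<lambda>y. \<omega> y w u) (at x) v
     + frechet_derivative (\<lambda>y. \<omega> y u v) (at x) w"

definition theta_A :: "('N::finite, 'n::finite) point \<Rightarrow> ('N, 'n) point \<Rightarrow> complex" where
  "theta_A x v = (\<Sum>k\<in>UNIV. trace (Lmat k x ** matrix_inv (Gmat k x) ** Gmat k v))"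

text \<open>
  A form on the level set descends to the quotient if it is invariant and annihilates the vectors
  tangent to the orbits.  The orbit of \<open>x \<in> a\<close> is \<open>a\<close> itself, and \<open>act S\<close> is a linear map
  of the ambient space, hence equal to its own differential.
\<close>
definition descends1 ::
    "(('N::finite, 'n::finite) point \<Rightarrow> ('N, 'n) point \<Rightarrow> complex) \<Rightarrow> bool" where
  "descends1 \<theta> \<longleftrightarrow>
     (\<forall>a\<in>A_space. \<forall>x\<in>a.
        (\<forall>v\<in>tangent a x. \<theta> x v = 0) \<and>
        (\<forall>S\<in>SL. \<forall>v\<in>tangent level_set x. \<theta> (act S x) (act S v) = \<theta> x v))"

definition descends2 ::
    "(('N::finite, 'n::finite) point \<Rightarrow> ('N, 'n) point \<Rightarrow> ('N, 'n) point \<Rightarrow> complex) \<Rightarrow> bool" where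
  "descends2 \<omega> \<longleftrightarrow>
     (\<forall>a\<in>A_space. \<forall>x\<in>a.
        (\<forall>u\<in>tangent a x. \<forall>v\<in>tangent level_set x. \<omega> x u v = 0) \<and>
        (\<forall>S\<in>SL. \<forall>u\<in>tangent level_set x. \<forall>v\<in>tangent level_set x.
           \<omega> (act S x) (act S u) (act S v) = \<omega> x u v))"

text \<open>A closed form on the level set that descends to a non-degenerate 2-form on the quotient.\<close>
definition symplectic_form_A ::
    "(('N::finite, 'n::finite) point \<Rightarrow> ('N, 'n) point \<Rightarrow> ('N, 'n) point \<Rightarrow> complex) \<Rightarrow> bool" where
  "symplectic_form_A \<omega> \<longleftrightarrow>
     descends2 \<omega> \<and>
     (\<forall>a\<in>A_space. \<forall>x\<in>a. \<forall>u\<in>tangent level_set x.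
        (\<forall>v\<in>tangent level_set x. \<omega> x u v = - \<omega> x v u) \<and>
        (\<forall>v\<in>tangent level_set x. \<forall>w\<in>tangent level_set x. \<forall>c.
           \<omega> x (c *s u + v) w = c * \<omega> x u w + \<omega> x v w \<and>
           ext_d2 \<omega> x u v w = 0) \<and>
        ((\<forall>v\<in>tangent level_set x. \<omega> x u v = 0) \<longrightarrow> u \<in> tangent a x))"

text \<open>
  The Hamiltonian vector \<open>u\<close> of \<open>\<phi>\<close> is determined by \<open>\<omega>(u, _) = - d\<phi>\<close>, and
  \<open>{\<phi>, \<psi>} = d\<psi>(u)\<close>.  For \<open>\<omega> = dp \<and> dq\<close> and \<open>\<phi> = p\<close> this gives \<open>u = \<partial>\<^sub>q\<close>, hence
  \<open>{p, q} = 1\<close>.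
\<close>
definition corresponds ::
    "('N::finite, 'n::finite) red_bracket \<Rightarrow>
     (('N, 'n) point \<Rightarrow> ('N, 'n) point \<Rightarrow> ('N, 'n) point \<Rightarrow> complex) \<Rightarrow> bool" where
  "corresponds B \<omega> \<longleftrightarrow>
     (\<forall>a\<in>A_space. \<forall>x\<in>a. \<forall>\<phi>. hol_A \<phi> a \<longrightarrow>
        (\<exists>u\<in>tangent level_set x.
           (\<forall>w\<in>tangent level_set x. \<omega> x u w = - diff_A \<phi> x w) \<and>
           (\<forall>\<psi>. hol_A \<psi> a \<longrightarrow> B \<phi> \<psi> a = diff_A \<psi> x u)))"

end

theory Submission
  imports Defs "HOL-Complex_Analysis.Cauchy_Integral_Formula"
begin

text \<open>
  Write a tangent vector of \<open>A0\<close> as \<open>(G\<^sub>j \<xi>\<^sub>j, \<ell>\<^sub>j)\<close> with \<open>\<xi>\<^sub>j = G\<^sub>j\<^sup>-\<^sup>1 dG\<^sub>j\<close> traceless and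
  \<open>\<ell>\<^sub>j = dL\<^sub>j\<close> diagonal and traceless.  In these terms
    \<open>d\<theta>((\<xi>, \<ell>), (\<eta>, m)) = \<Sum>\<^sub>j tr (\<ell>\<^sub>j \<eta>\<^sub>j) - tr (m\<^sub>j \<xi>\<^sub>j) - tr (L\<^sub>j [\<xi>\<^sub>j, \<eta>\<^sub>j])\<close>,
  which is non-degenerate on \<open>A0\<close> because the eigenvalues of each \<open>L\<^sub>j\<close> are distinct.  The brackets
  prescribed by \<open>r\<close> and \<open>\<Omega>\<close> are exactly the brackets of this form: the Hamiltonian vectors of the
  matrix entries can be written down, and their entries are the prescribed ones
  (\<open>omega_coord_ham\<close>, \<open>GG_entry\<close>, \<open>GL_entry\<close>).

  A bracket with the Leibniz rule is determined by its values on the coordinates.  This rests on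
  Hadamard's lemma for holomorphic functions of several variables (\<open>hadamard\<close>), which follows from
  Cauchy's formula in one variable; it makes every derivation at a point a combination of partial
  derivatives (\<open>derivation_coordinates\<close>).  Hence every bracket on \<open>A0\<close> with the prescribed values is
  \<open>{f, g} = dg(X\<^sub>f)\<close> with the Hamiltonian vector \<open>X\<^sub>f\<close> (\<open>bracket_ham_vector\<close>).  Conversely this
  formula defines a bracket; its Jacobiator is a derivation in each argument and so vanishes as soon
  as it does on coordinates (\<open>jacobiator_vanishes\<close>), where it is an identity of rational functions
  (\<open>jacobi_coordinates\<close>).

  The vector field \<open>(X G\<^sub>j, 0)\<close> of the action satisfies \<open>d\<theta>((X G, 0), w) = - tr (X d\<mu>(w))\<close>
  (\<open>omega_inf_action\<close>), so \<open>\<mu> = \<Sum>\<^sub>j G\<^sub>j L\<^sub>j G\<^sub>j\<^sup>-\<^sup>1\<close> is the moment map.  The action is free, and \<open>\<mu>\<close> is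
  a submersion onto the traceless matrices, with an explicit right inverse of \<open>d\<mu>\<close> supported on a
  single factor (\<open>moment_deriv_moment_section\<close>).  By a fixed point argument (\<open>implicit_curve\<close>) the
  tangent vectors of the level set are therefore the kernel of \<open>d\<mu>\<close> (\<open>tangent_level_set\<close>), and the
  radical of \<open>d\<theta>\<close> on this kernel consists of the orbit directions (\<open>omega_trace_factor\<close>).

  The set where one chosen \<open>G\<^sub>j\<close> is constant is a global slice of the action, so that functions
  on the quotient have invariant lifts (\<open>invariant_lift_exists\<close>).  The Hamiltonian vector of a lift is
  tangent to the level set, which makes the bracket of two lifts independent of the lifts
  (\<open>lift_bracket\<close>), and the axioms of a Poisson bracket pass to the quotient because the bracket of two
  lifts is again a lift (\<open>lift_reduced_bracket\<close>).  The invariant functions \<open>G\<^sub>i\<^sup>-\<^sup>1 G\<^sub>j\<close> and \<open>L\<^sub>j\<close> separate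
  the directions transverse to the orbits; this gives non-degeneracy.
\<close>

section \<open>Holomorphic functions of several variables\<close>

definition cdiff :: "(complex^'c::finite \<Rightarrow> complex) \<Rightarrow> complex^'c \<Rightarrow> bool" where
  "cdiff F y \<longleftrightarrow> (\<exists>D. (F has_derivative D) (at y) \<and> (\<forall>c v. D (c *s v) = c * D v))"

definition holo :: "(complex^'c::finite \<Rightarrow> complex) \<Rightarrow> complex^'c \<Rightarrow> bool" where
  "holo F p \<longleftrightarrow> (\<forall>\<^sub>F y in nhds p. cdiff F y)"

definition partial :: "(complex^'c::finite \<Rightarrow> complex) \<Rightarrow> 'c \<Rightarrow> complex^'c \<Rightarrow> complex" where
  "partial F i y = frechet_derivative F (at y) (axis i 1)"

lemma cdiffI:
  "(F has_derivative D) (at y) \<Longrightarrow> (\<And>c v. D (c *s v) = c * D v) \<Longrightarrow> cdiff F y"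
  unfolding cdiff_def by blast

lemma holo_imp_cdiff: "holo F p \<Longrightarrow> cdiff F p"
  unfolding holo_def by (rule eventually_nhds_x_imp_x)

text \<open>
  A complex linear derivative is determined by its values on the standard basis vectors, that is, by
  the partial derivatives.
\<close>

lemma cdiff_has_derivative:
  assumes "cdiff F y"
  shows "(F has_derivative (\<lambda>v. \<Sum>i\<in>UNIV. v $ i * partial F i y)) (at y)"
proof -
  obtain D where D: "(F has_derivative D) (at y)" "\<And>c v. D (c *s v) = c * D v"
    using assms unfolding cdiff_def by blast
  have "D v = (\<Sum>i\<in>UNIV. v $ i * partial F i y)" for v
  proof -
    have "D v = D (\<Sum>i\<in>UNIV. v $ i *s axis i 1)"
      by (simp add: basis_expansion)
    also have "\<dots> = (\<Sum>i\<in>UNIV. D (v $ i *s axis i 1))"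
      by (rule linear_sum[OF has_derivative_linear[OF D(1)]])
    also have "\<dots> = (\<Sum>i\<in>UNIV. v $ i * partial F i y)"
      by (simp add: D(2) partial_def frechet_derivative_at[OF D(1), symmetric])
    finally show ?thesis .
  qed
  then show ?thesis using D(1) by presburger
qed

lemma bounded_linear_scaled_vec: "bounded_linear (\<lambda>v. v $ i * c)" for c :: complex
  by (rule bounded_linear_compose[OF bounded_linear_mult_left bounded_linear_vec_nth])

lemma cdiff_const [intro]: "cdiff (\<lambda>y. c) p"
  by (rule cdiffI[of _ "\<lambda>v. 0"]) auto

lemma cdiff_nth [intro]: "cdiff (\<lambda>y. y $ i) p"
  by (rule cdiffI[of _ "\<lambda>v. v $ i"])
     (auto intro: bounded_linear_imp_has_derivative bounded_linear_vec_nth)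

lemma cdiff_add [intro]: "cdiff F p \<Longrightarrow> cdiff G p \<Longrightarrow> cdiff (\<lambda>y. F y + G y) p"
  unfolding cdiff_def
  by (elim exE conjE, rule exI, rule conjI, rule has_derivative_add) (auto simp: algebra_simps)

lemma cdiff_mult [intro]: "cdiff F p \<Longrightarrow> cdiff G p \<Longrightarrow> cdiff (\<lambda>y. F y * G y) p"
  unfolding cdiff_def
  by (elim exE conjE, rule exI, rule conjI, rule has_derivative_mult) (auto simp: algebra_simps)

lemma cdiff_divide [intro]:
  "cdiff F p \<Longrightarrow> cdiff G p \<Longrightarrow> G p \<noteq> 0 \<Longrightarrow> cdiff (\<lambda>y. F y / G y) p"
  unfolding cdiff_def
  by (elim exE conjE, rule exI, rule conjI, rule has_derivative_divide')
     (auto simp: algebra_simps divide_simps)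

lemma cdiff_uminus [intro]: "cdiff F p \<Longrightarrow> cdiff (\<lambda>y. - F y) p"
  using cdiff_mult[OF cdiff_const[of "-1"], of F p] by simp

lemma cdiff_diff [intro]: "cdiff F p \<Longrightarrow> cdiff G p \<Longrightarrow> cdiff (\<lambda>y. F y - G y) p"
  using cdiff_add[OF _ cdiff_uminus, of F p G] by simp

text \<open>
  The derivative may be checked entry by entry for vectors over any normed space, in particular
  for matrices, whose entries are rows.
\<close>

lemma has_derivative_vec_of_components:
  fixes \<Phi> :: "'a::real_normed_vector \<Rightarrow> 'b::real_normed_vector^'d::finite"
  assumes "\<And>i. ((\<lambda>y. \<Phi> y $ i) has_derivative (\<lambda>v. D v $ i)) (at p)"
  shows "(\<Phi> has_derivative D) (at p)"
proof -
  have bl: "bounded_linear (\<lambda>v. D v $ i)" for i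
    using assms has_derivative_bounded_linear by blast
  have "bounded_linear D"
  proof (rule bounded_linear_intro)
    show "D (x + y) = D x + D y" "D (r *\<^sub>R x) = r *\<^sub>R D x" for x y r
      by (simp_all add: vec_eq_iff linear_add[OF bounded_linear.linear[OF bl]]
          linear_cmul[OF bounded_linear.linear[OF bl]])
    show "norm (D x) \<le> norm x * (\<Sum>i\<in>UNIV. onorm (\<lambda>v. D v $ i))" for x
    proof -
      have "norm (D x) \<le> (\<Sum>i\<in>UNIV. norm (D x $ i))"
        unfolding norm_vec_def by (rule L2_set_le_sum) simp
      also have "\<dots> \<le> (\<Sum>i\<in>UNIV. onorm (\<lambda>v. D v $ i) * norm x)"
        by (intro sum_mono onorm bl)
      finally show ?thesis by (simp add: sum_distrib_left mult.commute)
    qed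
  qed
  moreover have "((\<lambda>y. (1 / norm (y - p)) *\<^sub>R (\<Phi> y - (\<Phi> p + D (y - p)))) \<longlongrightarrow> 0) (at p)"
    by (rule vec_tendstoI) (use assms in \<open>auto simp: has_derivative_within\<close>)
  ultimately show ?thesis by (simp add: has_derivative_within)
qed

lemma cdiff_compose:
  fixes \<Phi> :: "complex^'c::finite \<Rightarrow> complex^'d::finite"
  assumes \<Phi>: "\<And>i. cdiff (\<lambda>y. \<Phi> y $ i) p" and F: "cdiff F (\<Phi> p)"
  shows "cdiff (\<lambda>y. F (\<Phi> y)) p"
proof -
  define D where "D v = (\<chi> j. \<Sum>i\<in>UNIV. v $ i * partial (\<lambda>y. \<Phi> y $ j) i p)" for v
  have "(\<Phi> has_derivative D) (at p)"
    using cdiff_has_derivative[OF \<Phi>] by (intro has_derivative_vec_of_components) (simp add: D_def)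
  from has_derivative_compose[OF this cdiff_has_derivative[OF F]]
  show ?thesis
    by (rule cdiffI) (simp add: D_def sum_distrib_left mult_ac)
qed

lemma has_derivative_transform_nhds:
  assumes "(f has_derivative D) (at y)" "\<forall>\<^sub>F z in nhds y. f z = g z"
  shows "(g has_derivative D) (at y)"
  using assms(1)
  by (rule has_derivative_transform_eventually)
    (use assms(2) eventually_nhds_x_imp_x[OF assms(2)] in \<open>auto simp: eventually_at_filter elim: eventually_mono\<close>)

lemma cdiff_transform: "cdiff F y \<Longrightarrow> \<forall>\<^sub>F z in nhds y. F z = G z \<Longrightarrow> cdiff G y"
  unfolding cdiff_def using has_derivative_transform_nhds by blast

lemma cdiff_isCont: "cdiff F p \<Longrightarrow> isCont F p"
  using cdiff_has_derivative has_derivative_continuous by blast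

lemma continuous_on_cdiff: "(\<And>z. z \<in> V \<Longrightarrow> cdiff F z) \<Longrightarrow> continuous_on V F"
  by (intro continuous_at_imp_continuous_on ballI cdiff_isCont)

lemma norm_smult_axis: "norm (\<zeta> *s axis i 1 :: complex^'c::finite) = norm \<zeta>"
proof -
  have "\<zeta> *s axis i 1 = (axis i \<zeta> :: complex^'c)" by (vector axis_def)
  then show ?thesis by (simp add: norm_vec_def L2_set_def axis_def if_distrib[of norm]
      if_distrib[of "\<lambda>x. x^2"] sum.delta cong: if_cong)
qed

lemma holo_const [intro]: "holo (\<lambda>y. c) p" and holo_nth [intro]: "holo (\<lambda>y. y $ i) p"
  unfolding holo_def by (auto intro!: always_eventually)

lemma holo_add [intro]: "holo F p \<Longrightarrow> holo G p \<Longrightarrow> holo (\<lambda>y. F y + G y) p"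
  and holo_mult [intro]: "holo F p \<Longrightarrow> holo G p \<Longrightarrow> holo (\<lambda>y. F y * G y) p"
  and holo_diff [intro]: "holo F p \<Longrightarrow> holo G p \<Longrightarrow> holo (\<lambda>y. F y - G y) p"
  unfolding holo_def by (auto elim: eventually_elim2)

lemma holo_uminus [intro]: "holo F p \<Longrightarrow> holo (\<lambda>y. - F y) p"
  unfolding holo_def by (auto elim: eventually_mono)

lemma holo_divide [intro]:
  assumes "holo F p" "holo G p" "G p \<noteq> 0"
  shows "holo (\<lambda>y. F y / G y) p"
proof -
  have "filterlim G (nhds (G p)) (nhds p)"
    using cdiff_isCont[OF holo_imp_cdiff[OF assms(2)]]
    by (simp add: isCont_def tendsto_at_iff_tendsto_nhds)
  then have "\<forall>\<^sub>F y in nhds p. G y \<noteq> 0"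
    using assms(3) by (rule tendsto_imp_eventually_ne)
  then show ?thesis
    using assms(1,2) unfolding holo_def by eventually_elim auto
qed

lemma holo_sum [intro]:
  "(\<And>i. i \<in> I \<Longrightarrow> holo (F i) p) \<Longrightarrow> holo (\<lambda>y. \<Sum>i\<in>I. F i y) p"
  by (induction I rule: infinite_finite_induct) auto

lemma holo_eventually: "holo F p \<Longrightarrow> \<forall>\<^sub>F y in nhds p. holo F y"
  unfolding holo_def by (simp add: eventually_eventually)

lemma holo_compose:
  fixes \<Phi> :: "complex^'c::finite \<Rightarrow> complex^'d::finite"
  assumes \<Phi>: "\<And>i. holo (\<lambda>y. \<Phi> y $ i) p" and F: "holo F (\<Phi> p)"
  shows "holo (\<lambda>y. F (\<Phi> y)) p"
proof -
  have "isCont \<Phi> p"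
    unfolding continuous_at
    by (rule vec_tendstoI)
      (use cdiff_isCont[OF holo_imp_cdiff[OF \<Phi>]] in \<open>simp add: isCont_def\<close>)
  then have "filterlim \<Phi> (nhds (\<Phi> p)) (nhds p)"
    by (simp add: isCont_def tendsto_at_iff_tendsto_nhds)
  then have 1: "\<forall>\<^sub>F y in nhds p. cdiff F (\<Phi> y)"
    using F unfolding holo_def by (rule eventually_compose_filterlim[rotated])
  have 2: "\<forall>\<^sub>F y in nhds p. \<forall>i. cdiff (\<lambda>y. \<Phi> y $ i) y"
    using \<Phi> unfolding holo_def by (intro eventually_all_finite) 
  from 1 2 show ?thesis unfolding holo_def
    by eventually_elim (auto intro: cdiff_compose)
qed

text \<open>
  Differentiation under the integral sign.  The integrands are affine reparametrizations of one function
  \<open>F\<close>: with \<open>\<alpha> = 1\<close> they cover Cauchy integrals over circles, and with \<open>\<alpha> t = t\<close> the averages over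
  segments in Hadamard's lemma.
\<close>

lemma cdiff_integral:
  fixes F :: "complex^'c::finite \<Rightarrow> complex" and k :: "real \<Rightarrow> complex"
  assumes V: "\<And>z. z \<in> V \<Longrightarrow> cdiff F z" and cpd: "\<And>i. continuous_on V (partial F i)"
    and U: "open U" "convex U" "y \<in> U"
    and cont: "continuous_on {0..1} \<alpha>" "continuous_on {0..1} b" "continuous_on {0..1} k"
    and UV: "\<And>z t. z \<in> U \<Longrightarrow> t \<in> {0..1} \<Longrightarrow> \<alpha> t *\<^sub>R z + b t \<in> V"
  shows "cdiff (\<lambda>z. integral {0..1} (\<lambda>t. k t * F (\<alpha> t *\<^sub>R z + b t))) y"
proof -
  define f where "f z t = k t * F (\<alpha> t *\<^sub>R z + b t)" for z t
  define D where "D z t v = (\<Sum>i\<in>UNIV. v $ i * (\<alpha> t * k t * partial F i (\<alpha> t *\<^sub>R z + b t)))" for z t v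
  have blD: "bounded_linear (D z t)" for z t
    unfolding D_def by (intro bounded_linear_sum bounded_linear_scaled_vec)
  define fx where "fx z t = Blinfun (D z t)" for z t
  have fx: "blinfun_apply (fx z t) = D z t" for z t
    unfolding fx_def by (rule bounded_linear_Blinfun_apply[OF blD])
  have cF: "continuous_on V F"
    by (rule continuous_on_cdiff[OF V])
  have aff: "continuous_on (U \<times> {0..1}) (\<lambda>p. \<alpha> (snd p) *\<^sub>R fst p + b (snd p))"
    by (intro continuous_intros continuous_on_compose2[OF cont(1)] continuous_on_compose2[OF cont(2)]) auto
  have cpd': "continuous_on (U \<times> {0..1}) (\<lambda>p. partial F i (\<alpha> (snd p) *\<^sub>R fst p + b (snd p)))" for i
    by (rule continuous_on_compose2[OF cpd aff]) (use UV in auto)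
  have 1: "((\<lambda>z. f z t) has_derivative fx z t) (at z within U)" if "z \<in> U" "t \<in> cbox 0 1" for z t
  proof -
    have "(F has_derivative (\<lambda>v. \<Sum>i\<in>UNIV. v $ i * partial F i (\<alpha> t *\<^sub>R z + b t))) (at (\<alpha> t *\<^sub>R z + b t))"
      using that UV V by (intro cdiff_has_derivative) auto
    moreover have "((\<lambda>z. \<alpha> t *\<^sub>R z + b t) has_derivative (\<lambda>v. \<alpha> t *\<^sub>R v)) (at z within U)"
      by (auto intro!: derivative_eq_intros)
    ultimately have "((\<lambda>z. F (\<alpha> t *\<^sub>R z + b t)) has_derivative
        (\<lambda>v. \<Sum>i\<in>UNIV. (\<alpha> t *\<^sub>R v) $ i * partial F i (\<alpha> t *\<^sub>R z + b t))) (at z within U)"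
      by (rule has_derivative_compose[rotated])
    from has_derivative_mult_right[OF this, of "k t"]
    have "((\<lambda>z. f z t) has_derivative
        (\<lambda>v. k t * (\<Sum>i\<in>UNIV. (\<alpha> t *\<^sub>R v) $ i * partial F i (\<alpha> t *\<^sub>R z + b t)))) (at z within U)"
      unfolding f_def .
    moreover have "(\<lambda>v. k t * (\<Sum>i\<in>UNIV. (\<alpha> t *\<^sub>R v) $ i * partial F i (\<alpha> t *\<^sub>R z + b t))) = D z t"
      unfolding D_def by (simp only: sum_distrib_left vector_scaleR_component)
        (simp add: scaleR_conv_of_real mult_ac)
    ultimately show ?thesis unfolding fx by simp
  qed
  have cf: "continuous_on {0..1} (f z)" if "z \<in> U" for z
    unfolding f_def
    by (intro continuous_intros cont continuous_on_compose2[OF cF]) (use that UV in auto)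
  have 2: "f z integrable_on cbox 0 1" if "z \<in> U" for z
    using integrable_continuous_real[OF cf[OF that]] by simp
  have 3: "continuous_on (U \<times> cbox 0 1) (\<lambda>(z, t). fx z t)"
  proof (rule continuous_on_blinfun_componentwise)
    fix v :: "complex^'c"
    have "continuous_on (U \<times> {0..1}) (\<lambda>p. D (fst p) (snd p) v)"
      unfolding D_def
      by (intro continuous_intros cpd' continuous_on_compose2[OF cont(1)]
            continuous_on_compose2[OF cont(3)]) auto
    then show "continuous_on (U \<times> cbox 0 1) (\<lambda>p. (case p of (z, t) \<Rightarrow> fx z t) v)"
      by (simp add: case_prod_unfold fx)
  qed
  have "((\<lambda>z. integral (cbox 0 1) (f z)) has_derivative integral (cbox 0 1) (fx y)) (at y within U)"
    by (rule leibniz_rule[where f = f and fx = fx and U = U]) (use 1 2 3 U in auto)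
  then have der: "((\<lambda>z. integral {0..1} (f z)) has_derivative integral {0..1} (fx y)) (at y)"
    by (simp add: at_within_open[OF U(3) U(1)])
  have "continuous_on {0..1} (fx y)"
    using continuous_on_compose2[OF 3, of "{0..1}" "\<lambda>t. (y, t)"] U
    by (force intro!: continuous_on_Pair continuous_on_const continuous_on_id)
  then have int: "fx y integrable_on {0..1}" by (rule integrable_continuous_real)
  have "blinfun_apply (integral {0..1} (fx y)) (c *s v) = c * blinfun_apply (integral {0..1} (fx y)) v" for c v
  proof -
    have "blinfun_apply (integral {0..1} (fx y)) (c *s v) = integral {0..1} (\<lambda>t. c * D y t v)"
      unfolding blinfun_apply_integral[OF int] fx D_def by (simp add: sum_distrib_left mult.assoc)
    also have "\<dots> = c * integral {0..1} (\<lambda>t. D y t v)" by (rule integral_mult_right)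
    finally show ?thesis unfolding blinfun_apply_integral[OF int] fx .
  qed
  with der show ?thesis unfolding f_def by (blast intro: cdiffI)
qed

text \<open>
  Cauchy's formula for the derivative at \<open>0\<close> of the restriction of \<open>F\<close> to a complex line in the
  direction of the \<open>i\<close>-th coordinate, with the circle parametrized by the unit interval.
\<close>

lemma partial_cauchy:
  fixes F :: "complex^'c::finite \<Rightarrow> complex"
  assumes r: "r > 0" and F: "\<And>z. z \<in> ball p (2 * r) \<Longrightarrow> cdiff F z" and y: "y \<in> ball p r"
  shows "partial F i y = integral {0..1} (\<lambda>t. (1 / (of_real r * exp (2 * of_real pi * \<i> * of_real t)))
     * F (1 *\<^sub>R y + (of_real r * exp (2 * of_real pi * \<i> * of_real t)) *s axis i 1))"
proof -
  define g where "g \<zeta> = F (y + \<zeta> *s axis i 1)" for \<zeta> :: complex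
  have in_ball: "y + \<zeta> *s axis i 1 \<in> ball p (2 * r)" if "norm \<zeta> \<le> r" for \<zeta>
  proof -
    have "dist p (y + \<zeta> *s axis i 1) \<le> dist p y + norm (\<zeta> *s axis i 1 :: complex^'c)"
      by (metis add_diff_cancel_left' dist_norm dist_triangle norm_minus_commute)
    also have "\<dots> < r + r" using y that by (simp add: norm_smult_axis)
    finally show ?thesis by simp
  qed
  have der: "(g has_field_derivative partial F i (y + \<zeta> *s axis i 1)) (at \<zeta>)" if "norm \<zeta> \<le> r" for \<zeta>
  proof -
    have "bounded_linear (\<lambda>\<zeta>. \<zeta> *s axis i 1 :: complex^'c)"
      by (rule linear_conv_bounded_linear[THEN iffD1], rule linearI) (auto simp: vec_eq_iff algebra_simps)
    then have "((\<lambda>\<zeta>. y + \<zeta> *s axis i 1) has_derivative (\<lambda>d. d *s axis i 1)) (at \<zeta>)"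
      by (auto intro!: derivative_eq_intros bounded_linear_imp_has_derivative)
    from has_derivative_compose[OF this cdiff_has_derivative[OF F[OF in_ball[OF that]]]]
    have "(g has_derivative (\<lambda>d. \<Sum>j\<in>UNIV. (d *s axis i 1) $ j * partial F j (y + \<zeta> *s axis i 1))) (at \<zeta>)"
      unfolding g_def .
    moreover have "(\<Sum>j\<in>UNIV. (d *s axis i 1) $ j * partial F j z) = partial F i z * d" for d :: complex and z
      by (simp add: axis_def if_distrib[of "\<lambda>x. x * _"] if_distrib[of "\<lambda>x. _ * x"] sum.delta cong: if_cong)
    ultimately show ?thesis by (simp add: has_field_derivative_def)
  qed
  have cont: "continuous_on (cball 0 r) g"
    using der by (intro continuous_at_imp_continuous_on ballI DERIV_isCont) auto
  have hol: "g holomorphic_on ball 0 r"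
    unfolding holomorphic_on_open[OF open_ball] using der by force
  have "contour_integral (circlepath 0 r) (\<lambda>u. g u / (u - 0)^2) = 2 * pi * \<i> * deriv g 0"
    using r by (intro Cauchy_contour_integral_circlepath_2 cont hol) auto
  also have "deriv g 0 = partial F i y"
    using DERIV_imp_deriv[OF der[of 0]] r by simp
  also have "contour_integral (circlepath 0 r) (\<lambda>u. g u / (u - 0)^2)
     = integral {0..1} (\<lambda>t. 2 * of_real pi * \<i> * ((1 / (of_real r * exp (2 * of_real pi * \<i> * of_real t)))
     * F (1 *\<^sub>R y + (of_real r * exp (2 * of_real pi * \<i> * of_real t)) *s axis i 1)))"
    unfolding contour_integral_integral vector_derivative_circlepath
    using r by (intro integral_cong) (simp add: circlepath g_def power2_eq_square)
  finally have "2 * of_real pi * \<i> * partial F i y = 2 * of_real pi * \<i> * integral {0..1}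
    (\<lambda>t. (1 / (of_real r * exp (2 * of_real pi * \<i> * of_real t)))
     * F (1 *\<^sub>R y + (of_real r * exp (2 * of_real pi * \<i> * of_real t)) *s axis i 1))"
    unfolding integral_mult_right by simp
  then show ?thesis by simp
qed

text \<open>
  By Cauchy's formula a partial derivative is an average of values of \<open>F\<close>.  This shows first that it is
  continuous; then the formula may be differentiated under the integral sign.
\<close>

lemma holo_partial:
  fixes F :: "complex^'c::finite \<Rightarrow> complex"
  assumes "holo F p"
  shows "holo (partial F i) p"
proof -
  obtain e where e: "e > 0" "\<And>z. z \<in> ball p e \<Longrightarrow> cdiff F z"
    using assms unfolding holo_def eventually_nhds_metric by (auto simp: dist_commute)
  \<comment> \<open>points of the ball of radius \<open>2 r\<close> are centres of balls of radius \<open>2 r\<close> below\<close>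
  define r where "r = e / 4"
  have r: "r > 0" using e by (simp add: r_def)
  define b where "b i t = (of_real r * exp (2 * of_real pi * \<i> * of_real t)) *s axis i (1::complex)"
    for i :: 'c and t :: real
  have cont_smult: "continuous_on S (\<lambda>t. f t *s (v :: complex^'c))" if "continuous_on S f"
    for S :: "real set" and f v
    by (rule continuous_on_vec_lambda[of S "\<lambda>i t. f t * v $ i", folded vector_scalar_mult_def])
      (intro continuous_intros that)
  have cb: "continuous_on S (b i)" for i S
    unfolding b_def by (intro cont_smult continuous_intros)
  define k where "k t = 1 / (of_real r * exp (2 * of_real pi * \<i> * of_real t))" for t :: real
  have ck: "continuous_on S k" for S
    unfolding k_def using r by (intro continuous_intros) auto
  have nb: "norm (b i t) = r" for i t
    using r by (simp add: b_def norm_smult_axis norm_mult)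
  have near: "1 *\<^sub>R z + b i t \<in> ball p (s + r)" if "z \<in> ball p s" for z i t s
  proof -
    have "dist p (z + b i t) \<le> dist p z + norm (b i t)"
      by (metis add_diff_cancel_left' dist_norm dist_triangle norm_minus_commute)
    then show ?thesis using that by (simp add: nb)
  qed
  have eq: "partial F i y = integral {0..1} (\<lambda>t. k t * F (1 *\<^sub>R y + b i t))"
    if "y \<in> ball p (2 * r)" for i y
  proof -
    have "partial F i y = integral {0..1} (\<lambda>t. (1 / (of_real r * exp (2 * of_real pi * \<i> * of_real t)))
     * F (1 *\<^sub>R y + (of_real r * exp (2 * of_real pi * \<i> * of_real t)) *s axis i 1))"
    proof (rule partial_cauchy[of r y])
      show "cdiff F z" if "z \<in> ball y (2 * r)" for z
      proof (rule e)
        have "dist p z \<le> dist p y + dist y z" by (rule dist_triangle)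
        then show "z \<in> ball p e" using that \<open>y \<in> ball p (2 * r)\<close> by (simp add: r_def)
      qed
    qed (use r in auto)
    then show ?thesis by (simp add: k_def b_def)
  qed
  have cF: "continuous_on (ball p e) F"
    by (rule continuous_on_cdiff[OF e(2)])
  have cpd: "continuous_on (ball p (2 * r)) (partial F i)" for i
  proof -
    have "continuous_on (ball p (2 * r) \<times> {0..1}) (\<lambda>q. k (snd q) * F (1 *\<^sub>R fst q + b i (snd q)))"
    proof (intro continuous_intros continuous_on_compose2[OF ck[of UNIV]] continuous_on_compose2[OF cF]
          continuous_on_compose2[OF cb[of UNIV]])
      have "1 *\<^sub>R fst q + b i (snd q) \<in> ball p e" if "q \<in> ball p (2 * r) \<times> {0..1}" for q
      proof -
        have "1 *\<^sub>R fst q + b i (snd q) \<in> ball p (2 * r + r)"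
          by (rule near) (use that in auto)
        moreover have "ball p (2 * r + r) \<subseteq> ball p e"
          using r by (intro subset_ball) (simp add: r_def)
        ultimately show ?thesis by blast
      qed
      then show "(\<lambda>q. 1 *\<^sub>R fst q + b i (snd q)) ` (ball p (2 * r) \<times> {0..1}) \<subseteq> ball p e"
        by (rule image_subsetI)
    qed auto
    then have "continuous_on (ball p (2 * r) \<times> cbox 0 1) (\<lambda>(y, t). k t * F (1 *\<^sub>R y + b i t))"
      by (simp add: case_prod_unfold)
    from integral_continuous_on_param[OF this] show ?thesis
      using eq by (simp cong: continuous_on_cong_simp)
  qed
  have "cdiff (partial F i) y" if y: "y \<in> ball p r" for y
  proof -
    have "cdiff (\<lambda>z. integral {0..1} (\<lambda>t. k t * F (1 *\<^sub>R z + b i t))) y"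
    proof (rule cdiff_integral[where V = "ball p (2 * r)" and U = "ball p r" and \<alpha> = "\<lambda>t. 1"])
      show "cdiff F z" if "z \<in> ball p (2 * r)" for z
        using that r by (intro e) (auto simp: r_def)
      show "1 *\<^sub>R z + b i t \<in> ball p (2 * r)" if "z \<in> ball p r" for z t
        using near[OF that] by simp
    qed (use y cpd cb ck in auto)
    moreover have "\<forall>\<^sub>F z in nhds y. z \<in> ball p (2 * r)"
      using y r by (intro eventually_nhds_in_open) auto
    then have "\<forall>\<^sub>F z in nhds y. integral {0..1} (\<lambda>t. k t * F (1 *\<^sub>R z + b i t)) = partial F i z"
      by (rule eventually_mono) (simp only: eq)
    ultimately show ?thesis by (rule cdiff_transform)
  qed
  then show ?thesis
    unfolding holo_def eventually_nhds_metric using r by (auto simp: dist_commute)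
qed

text \<open>
  The functions \<open>H i\<close> are the averages of the partial derivatives over the segment from \<open>p\<close> to \<open>y\<close>.  They
  are holomorphic because the partial derivatives are.
\<close>

lemma hadamard:
  fixes F :: "complex^'c::finite \<Rightarrow> complex"
  assumes "holo F p"
  shows "\<exists>H. (\<forall>i. holo (H i) p \<and> H i p = partial F i p) \<and>
    (\<forall>\<^sub>F y in nhds p. F y = F p + (\<Sum>i\<in>UNIV. (y $ i - p $ i) * H i y))"
proof -
  have "\<forall>\<^sub>F y in nhds p. cdiff F y \<and> (\<forall>i. cdiff (partial F i) y \<and> (\<forall>j. cdiff (partial (partial F i) j) y))"
    by (intro eventually_conj eventually_all_finite assms[unfolded holo_def]
        holo_partial[OF assms, unfolded holo_def] holo_partial[OF holo_partial[OF assms], unfolded holo_def])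
  then obtain e where e: "e > 0" "\<And>z. z \<in> ball p e \<Longrightarrow> cdiff F z"
     "\<And>z i. z \<in> ball p e \<Longrightarrow> cdiff (partial F i) z" "\<And>z i j. z \<in> ball p e \<Longrightarrow> cdiff (partial (partial F i) j) z"
    unfolding eventually_nhds_metric by (auto simp: dist_commute)
  define H where "H i y = integral {0..1} (\<lambda>t. 1 * partial F i (t *\<^sub>R y + (1 - t) *\<^sub>R p))" for i y
  have seg: "t *\<^sub>R y + (1 - t) *\<^sub>R p \<in> ball p e" if "y \<in> ball p e" "t \<in> {0..1}" for y t
    using convexD[OF convex_ball[of p e], of y p t "1 - t"] that e(1) by simp
  have "cdiff (H i) y" if "y \<in> ball p e" for i y
    unfolding H_def
  proof (rule cdiff_integral[where V = "ball p e" and U = "ball p e"])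
    show "continuous_on (ball p e) (partial (partial F i) j)" for j
      by (rule continuous_on_cdiff[OF e(4)])
    show "continuous_on {0..1} (\<lambda>t::real. (1 - t) *\<^sub>R p)" by (intro continuous_intros)
  qed (use that e(3) seg in auto)
  then have 1: "holo (H i) p" for i
    unfolding holo_def eventually_nhds_metric using e(1) by (auto simp: dist_commute)
  have 2: "H i p = partial F i p" for i
    by (simp add: H_def flip: scaleR_add_left)
  have "F y = F p + (\<Sum>i\<in>UNIV. (y $ i - p $ i) * H i y)" if y: "y \<in> ball p e" for y
  proof -
    have cont: "continuous_on {0..1} (\<lambda>t. partial F i (t *\<^sub>R y + (1 - t) *\<^sub>R p))" for i
    proof (rule continuous_on_compose2[of "ball p e" "partial F i"])
      show "continuous_on (ball p e) (partial F i)"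
        by (rule continuous_on_cdiff[OF e(3)])
      show "continuous_on {0..1} (\<lambda>t. t *\<^sub>R y + (1 - t) *\<^sub>R p)" by (intro continuous_intros)
    qed (use seg[OF y] in auto)
    have der: "((\<lambda>t. F (t *\<^sub>R y + (1 - t) *\<^sub>R p)) has_vector_derivative
        (\<Sum>i\<in>UNIV. (y $ i - p $ i) * partial F i (t *\<^sub>R y + (1 - t) *\<^sub>R p))) (at t within {0..1})"
      if "t \<in> {0..1}" for t
    proof -
      have "((\<lambda>t. t *\<^sub>R y + (1 - t) *\<^sub>R p) has_derivative (\<lambda>d. d *\<^sub>R (y - p))) (at t within {0..1})"
        by (rule derivative_eq_intros refl | simp)+ (simp add: scaleR_diff_right)
      from has_derivative_compose[OF this cdiff_has_derivative[OF e(2)[OF seg[OF y that]]]]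
      show ?thesis
        unfolding has_vector_derivative_def vector_scaleR_component vector_minus_component
          mult_scaleR_left scaleR_sum_right .
    qed
    have "((\<lambda>t. \<Sum>i\<in>UNIV. (y $ i - p $ i) * partial F i (t *\<^sub>R y + (1 - t) *\<^sub>R p)) has_integral
        F (1 *\<^sub>R y + (1 - 1) *\<^sub>R p) - F (0 *\<^sub>R y + (1 - 0) *\<^sub>R p)) {0..1}"
      by (rule fundamental_theorem_of_calculus) (use der in simp_all)
    then have "F y - F p = integral {0..1} (\<lambda>t. \<Sum>i\<in>UNIV. (y $ i - p $ i) * partial F i (t *\<^sub>R y + (1 - t) *\<^sub>R p))"
      by (simp add: integral_unique)
    also have "\<dots> = (\<Sum>i\<in>UNIV. (y $ i - p $ i) * H i y)"
    proof -
      have "(\<lambda>t. (y $ i - p $ i) * partial F i (t *\<^sub>R y + (1 - t) *\<^sub>R p)) integrable_on {0..1}" for i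
        by (intro integrable_continuous_real continuous_on_mult continuous_on_const cont)
      then show ?thesis by (simp add: integral_sum H_def)
    qed
    finally show ?thesis by (simp add: algebra_simps)
  qed
  then have 3: "\<forall>\<^sub>F y in nhds p. F y = F p + (\<Sum>i\<in>UNIV. (y $ i - p $ i) * H i y)"
    by (intro eventually_mono[OF eventually_nhds_in_open[OF open_ball centre_in_ball[THEN iffD2, OF e(1)]]])
  from 1 2 3 show ?thesis by (intro exI[of _ H] conjI allI)
qed

section \<open>Germs, derivations and the Jacobi identity\<close>

lemma hol_at_iff:
  "hol_at X f x \<longleftrightarrow> (\<exists>F. holo F x \<and> (\<forall>\<^sub>F y in nhds x. y \<in> X \<longrightarrow> F y = f y))"
proof -
  have "hol_at X f x \<longleftrightarrow> (\<exists>F. \<exists>U. open U \<and> x \<in> U \<and> (\<forall>y\<in>U. cdiff F y \<and> (y \<in> X \<longrightarrow> F y = f y)))"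
    unfolding hol_at_def cdiff_def[symmetric]
    by (subst ex_comm) (intro arg_cong[where f = Ex] ext, auto)
  also have "\<dots> \<longleftrightarrow> (\<exists>F. holo F x \<and> (\<forall>\<^sub>F y in nhds x. y \<in> X \<longrightarrow> F y = f y))"
    unfolding holo_def eventually_conj_iff[symmetric] unfolding eventually_nhds by simp
  finally show ?thesis .
qed

lemma hol_at_holo: "holo F p \<Longrightarrow> hol_at X F p"
  unfolding hol_at_iff by (rule exI[of _ F]) simp

lemma hol_at_cong:
  assumes "hol_at X f p" "\<forall>\<^sub>F y in nhds p. y \<in> X \<longrightarrow> f y = g y"
  shows "hol_at X g p"
proof -
  obtain F where F: "holo F p" "\<forall>\<^sub>F y in nhds p. y \<in> X \<longrightarrow> F y = f y"
    using assms(1) unfolding hol_at_iff by blast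
  from F(2) assms(2) have "\<forall>\<^sub>F y in nhds p. y \<in> X \<longrightarrow> F y = g y"
    by eventually_elim simp
  with F(1) show ?thesis unfolding hol_at_iff by blast
qed

lemma hol_at_subset:
  assumes "hol_at Y f p" "X \<subseteq> Y"
  shows "hol_at X f p"
proof -
  obtain F where F: "holo F p" "\<forall>\<^sub>F y in nhds p. y \<in> Y \<longrightarrow> F y = f y"
    using assms(1) unfolding hol_at_iff by blast
  from F(2) have "\<forall>\<^sub>F y in nhds p. y \<in> X \<longrightarrow> F y = f y"
    by eventually_elim (use assms(2) in blast)
  with F(1) show ?thesis unfolding hol_at_iff by blast
qed

lemma hol_at_eventually:
  assumes "hol_at X f p"
  shows "\<forall>\<^sub>F y in nhds p. hol_at X f y"
proof -
  obtain F where F: "holo F p" "\<forall>\<^sub>F y in nhds p. y \<in> X \<longrightarrow> F y = f y"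
    using assms unfolding hol_at_iff by blast
  from holo_eventually[OF F(1)] eventually_eventually[THEN iffD2, OF F(2)]
  show ?thesis by eventually_elim (auto simp: hol_at_iff)
qed

lemma hol_at_const [intro]: "hol_at X (\<lambda>y. c) p"
  and hol_at_nth [intro]: "hol_at X (\<lambda>y. y $ i) p"
  by (auto intro: hol_at_holo)

lemma hol_at_add [intro]: "hol_at X f p \<Longrightarrow> hol_at X g p \<Longrightarrow> hol_at X (\<lambda>y. f y + g y) p"
  and hol_at_mult [intro]: "hol_at X f p \<Longrightarrow> hol_at X g p \<Longrightarrow> hol_at X (\<lambda>y. f y * g y) p"
proof -
  assume "hol_at X f p" "hol_at X g p"
  then obtain F G where FG: "holo F p" "\<forall>\<^sub>F y in nhds p. y \<in> X \<longrightarrow> F y = f y"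
      "holo G p" "\<forall>\<^sub>F y in nhds p. y \<in> X \<longrightarrow> G y = g y"
    unfolding hol_at_iff by blast
  from FG(2,4) have "\<forall>\<^sub>F y in nhds p. y \<in> X \<longrightarrow> F y + G y = f y + g y"
     by eventually_elim simp
  with FG show "hol_at X (\<lambda>y. f y + g y) p"
    unfolding hol_at_iff by (intro exI[of _ "\<lambda>y. F y + G y"]) auto
  from FG(2,4) have "\<forall>\<^sub>F y in nhds p. y \<in> X \<longrightarrow> F y * G y = f y * g y"
     by eventually_elim simp
  with FG show "hol_at X (\<lambda>y. f y * g y) p"
    unfolding hol_at_iff by (intro exI[of _ "\<lambda>y. F y * G y"]) auto
qed

lemma hol_at_uminus [intro]: "hol_at X f p \<Longrightarrow> hol_at X (\<lambda>y. - f y) p"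
  using hol_at_mult[OF hol_at_const[of X "-1"], of f p] by simp

lemma hol_at_diff [intro]: "hol_at X f p \<Longrightarrow> hol_at X g p \<Longrightarrow> hol_at X (\<lambda>y. f y - g y) p"
  using hol_at_add[OF _ hol_at_uminus, of X f p g] by simp

lemma hol_at_sum [intro]:
  "(\<And>i. i \<in> I \<Longrightarrow> hol_at X (f i) p) \<Longrightarrow> hol_at X (\<lambda>y. \<Sum>i\<in>I. f i y) p"
  by (induction I rule: infinite_finite_induct) auto

text \<open>
  Derivations act on total functions, and so their locality is not built in; it is a consequence of
  the Leibniz rule (\<open>derivation_germ\<close>).
\<close>

definition derivation_at ::
    "(complex^'c::finite) set \<Rightarrow> complex^'c \<Rightarrow> ((complex^'c \<Rightarrow> complex) \<Rightarrow> complex) \<Rightarrow> bool" where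
  "derivation_at X p D \<longleftrightarrow> (\<forall>f g c. hol_at X f p \<and> hol_at X g p \<longrightarrow>
     D (\<lambda>q. c * f q) = c * D f \<and> D (\<lambda>q. f q + g q) = D f + D g \<and>
     D (\<lambda>q. f q * g q) = f p * D g + g p * D f)"

context
  fixes X :: "(complex^'c::finite) set" and p D
  assumes D: "derivation_at X p D"
begin

lemma derivation_cmult: "hol_at X f p \<Longrightarrow> D (\<lambda>q. c * f q) = c * D f"
  and derivation_add: "hol_at X f p \<Longrightarrow> hol_at X g p \<Longrightarrow> D (\<lambda>q. f q + g q) = D f + D g"
  and derivation_mult:
    "hol_at X f p \<Longrightarrow> hol_at X g p \<Longrightarrow> D (\<lambda>q. f q * g q) = f p * D g + g p * D f"
  using D unfolding derivation_at_def by blast+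

lemma derivation_const: "D (\<lambda>q. c) = 0"
proof -
  have "D (\<lambda>q. 1 * 1) = 1 * D (\<lambda>q. 1) + 1 * D (\<lambda>q. 1)"
    by (rule derivation_mult) auto
  then have "D (\<lambda>q. 1) = 0" by simp
  moreover have "D (\<lambda>q. c * 1) = c * D (\<lambda>q. 1)" by (rule derivation_cmult) auto
  ultimately show ?thesis by simp
qed

text \<open>
  The difference \<open>d\<close> of the two functions satisfies \<open>d = k d\<close> for a function \<open>k\<close> which vanishes near \<open>p\<close>
  on \<open>X\<close>.  Both factors vanish at \<open>p\<close>, and so \<open>D d = 0\<close> by the Leibniz rule.
\<close>

lemma derivation_germ:
  assumes p: "p \<in> X" and fg: "hol_at X f p" "hol_at X g p"
    and eq: "\<forall>\<^sub>F y in nhds p. y \<in> X \<longrightarrow> f y = g y"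
  shows "D f = D g"
proof -
  obtain U where U: "open U" "p \<in> U" "\<And>y. y \<in> U \<Longrightarrow> y \<in> X \<Longrightarrow> f y = g y"
    using eq unfolding eventually_nhds by blast
  define d where "d y = f y + - 1 * g y" for y
  define k :: "complex^'c \<Rightarrow> complex" where "k y = (if y \<in> U \<inter> X then 0 else 1)" for y
  have d: "hol_at X d p" unfolding d_def using fg by auto
  have k: "hol_at X k p"
    by (rule hol_at_cong[OF hol_at_const[of X 0]], rule eventually_mono[OF eventually_nhds_in_open[OF U(1,2)]])
      (simp add: k_def)
  have "d p = 0" "k p = 0" using p U by (simp_all add: d_def k_def)
  moreover have "(\<lambda>q. k q * d q) = d" by (auto simp: k_def d_def U(3))
  ultimately have "D d = 0" using derivation_mult[OF k d] by simp
  moreover have "D d = D f + - 1 * D g"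
    unfolding d_def using fg derivation_add[OF fg(1), of "\<lambda>y. - 1 * g y"] derivation_cmult[OF fg(2), of "-1"]
    by auto
  ultimately show ?thesis by simp
qed

lemma derivation_sum:
  "(\<And>i. i \<in> I \<Longrightarrow> hol_at X (f i) p) \<Longrightarrow> D (\<lambda>y. \<Sum>i\<in>I. f i y) = (\<Sum>i\<in>I. D (f i))"
proof (induction I rule: infinite_finite_induct)
  case (insert i I)
  have "D (\<lambda>y. f i y + (\<Sum>i\<in>I. f i y)) = D (f i) + D (\<lambda>y. \<Sum>i\<in>I. f i y)"
    by (rule derivation_add) (use insert in auto)
  then show ?case using insert by simp
qed (simp_all add: derivation_const)

text \<open>
  Apply the derivation to the expansion of Hadamard's lemma.  Each summand is a product whose first factor
  vanishes at \<open>p\<close>, so only the derivative of this factor contributes.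
\<close>

lemma derivation_coordinates:
  assumes p: "p \<in> X" and F: "holo F p" and eq: "\<forall>\<^sub>F y in nhds p. y \<in> X \<longrightarrow> F y = f y"
  shows "D f = (\<Sum>i\<in>UNIV. partial F i p * D (\<lambda>y. y $ i))"
proof -
  obtain H where H: "\<And>i. holo (H i) p" "\<And>i. H i p = partial F i p"
    "\<forall>\<^sub>F y in nhds p. F y = F p + (\<Sum>i\<in>UNIV. (y $ i - p $ i) * H i y)"
    using hadamard[OF F] by blast
  have hol: "hol_at X (\<lambda>y. (y $ i - p $ i) * H i y) p" for i
    by (intro hol_at_mult hol_at_diff hol_at_const hol_at_nth hol_at_holo H)
  have f: "hol_at X f p" using hol_at_cong[OF hol_at_holo[OF F] eq] .
  from H(3) eq have ev: "\<forall>\<^sub>F y in nhds p. y \<in> X \<longrightarrow> f y = F p + (\<Sum>i\<in>UNIV. (y $ i - p $ i) * H i y)"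
    by eventually_elim simp
  have "D f = D (\<lambda>y. F p + (\<Sum>i\<in>UNIV. (y $ i - p $ i) * H i y))"
    by (rule derivation_germ[OF p f _ ev]) (intro hol_at_add hol_at_const hol_at_sum hol)
  also have "\<dots> = D (\<lambda>y. F p) + D (\<lambda>y. \<Sum>i\<in>UNIV. (y $ i - p $ i) * H i y)"
    by (intro derivation_add hol_at_const hol_at_sum hol)
  also have "\<dots> = (\<Sum>i\<in>UNIV. D (\<lambda>y. (y $ i - p $ i) * H i y))"
    using hol by (simp add: derivation_const derivation_sum)
  also have "\<dots> = (\<Sum>i\<in>UNIV. partial F i p * D (\<lambda>y. y $ i))"
  proof (rule sum.cong)
    fix i
    have "D (\<lambda>y. (y $ i - p $ i) * H i y) = (p $ i - p $ i) * D (H i) + H i p * D (\<lambda>y. y $ i - p $ i)"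
      by (intro derivation_mult hol_at_diff hol_at_const hol_at_nth hol_at_holo H)
    moreover have "D (\<lambda>y. y $ i + - p $ i) = D (\<lambda>y. y $ i) + D (\<lambda>y. - p $ i)"
      by (intro derivation_add hol_at_const hol_at_nth)
    ultimately show "D (\<lambda>y. (y $ i - p $ i) * H i y) = partial F i p * D (\<lambda>y. y $ i)"
      by (simp add: H derivation_const)
  qed simp
  finally show ?thesis .
qed

end

definition skew_biderivation :: "(complex^'c::finite) set \<Rightarrow>
    ((complex^'c \<Rightarrow> complex) \<Rightarrow> (complex^'c \<Rightarrow> complex) \<Rightarrow> complex^'c \<Rightarrow> complex) \<Rightarrow> bool" where
  "skew_biderivation X B \<longleftrightarrow> (\<forall>p\<in>X. \<forall>f g. hol_at X f p \<and> hol_at X g p \<longrightarrow>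
     hol_at X (B f g) p \<and> B f g p = - B g f p \<and> derivation_at X p (\<lambda>h. B h g p))"

lemma poisson_bracket_imp_skew_biderivation:
  "poisson_bracket X (hol_at X) B \<Longrightarrow> skew_biderivation X B"
  unfolding poisson_bracket_def skew_biderivation_def derivation_at_def by blast

context
  fixes X :: "(complex^'c::finite) set" and B
  assumes B: "skew_biderivation X B"
begin

lemma bider_hol: "p \<in> X \<Longrightarrow> hol_at X f p \<Longrightarrow> hol_at X g p \<Longrightarrow> hol_at X (B f g) p"
  and bider_skew: "p \<in> X \<Longrightarrow> hol_at X f p \<Longrightarrow> hol_at X g p \<Longrightarrow> B f g p = - B g f p"
  and bider_left: "p \<in> X \<Longrightarrow> hol_at X g p \<Longrightarrow> derivation_at X p (\<lambda>h. B h g p)"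
  using B unfolding skew_biderivation_def by blast+

lemma bider_right:
  assumes "p \<in> X" "hol_at X f p"
  shows "derivation_at X p (\<lambda>h. B f h p)"
proof -
  have sk: "B f h p = - B h f p" if "hol_at X h p" for h
    using bider_skew assms that by blast
  note d = bider_left[OF assms]
  show ?thesis
    unfolding derivation_at_def
  proof (intro allI impI)
    fix g h c assume gh: "hol_at X g p \<and> hol_at X h p"
    then have "hol_at X (\<lambda>q. c * g q) p" "hol_at X (\<lambda>q. g q + h q) p" "hol_at X (\<lambda>q. g q * h q) p"
      by auto
    then show "B f (\<lambda>q. c * g q) p = c * B f g p \<and>
       B f (\<lambda>q. g q + h q) p = B f g p + B f h p \<and>
       B f (\<lambda>q. g q * h q) p = g p * B f h p + h p * B f g p"
      using gh derivation_cmult[OF d, of g c] derivation_add[OF d, of g h] derivation_mult[OF d, of g h]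
      by (simp add: sk)
  qed
qed

lemma bider_coordinates:
  assumes p: "p \<in> X"
    and F: "holo F p" "\<forall>\<^sub>F y in nhds p. y \<in> X \<longrightarrow> F y = f y"
    and G: "holo G p" "\<forall>\<^sub>F y in nhds p. y \<in> X \<longrightarrow> G y = g y"
  shows "B f g p = (\<Sum>i\<in>UNIV. \<Sum>j\<in>UNIV. partial F i p * partial G j p * B (\<lambda>y. y $ i) (\<lambda>y. y $ j) p)"
proof -
  have g: "hol_at X g p" using hol_at_cong[OF hol_at_holo[OF G(1)] G(2)] .
  have "B f g p = (\<Sum>i\<in>UNIV. partial F i p * B (\<lambda>y. y $ i) g p)"
    by (rule derivation_coordinates[OF bider_left[OF p g] p F])
  also have "\<dots> = (\<Sum>i\<in>UNIV. \<Sum>j\<in>UNIV. partial F i p * partial G j p * B (\<lambda>y. y $ i) (\<lambda>y. y $ j) p)"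
  proof (rule sum.cong)
    fix i
    have "B (\<lambda>y. y $ i) g p = (\<Sum>j\<in>UNIV. partial G j p * B (\<lambda>y. y $ i) (\<lambda>y. y $ j) p)"
      by (rule derivation_coordinates[OF bider_right[OF p] p G]) auto
    then show "partial F i p * B (\<lambda>y. y $ i) g p
       = (\<Sum>j\<in>UNIV. partial F i p * partial G j p * B (\<lambda>y. y $ i) (\<lambda>y. y $ j) p)"
      by (simp add: sum_distrib_left mult.assoc)
  qed simp
  finally show ?thesis .
qed

definition jacobiator where
  "jacobiator p f g h = B f (B g h) p + B g (B h f) p + B h (B f g) p"

text \<open>
  The terms of the three double brackets that are not of the form required by the Leibniz rule are products
  of two single brackets; they cancel by antisymmetry.
\<close>

lemma jacobiator_derivation:
  assumes p: "p \<in> X" and f: "hol_at X f p" and g: "hol_at X g p"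
  shows "derivation_at X p (jacobiator p f g)"
  unfolding derivation_at_def
proof (intro allI impI)
  fix h k c assume "hol_at X h p \<and> hol_at X k p"
  then have h: "hol_at X h p" and k: "hol_at X k p" by auto
  have ev: "\<forall>\<^sub>F y in nhds p. hol_at X f y \<and> hol_at X g y \<and> hol_at X h y \<and> hol_at X k y"
    by (intro eventually_conj hol_at_eventually f g h k)
  note dR = bider_right[OF p] and dL = bider_left[OF p] and bh = bider_hol[OF p]
  have inner: "B f' (B g' (\<lambda>q. c * h q)) p = c * B f' (B g' h) p"
       "B f' (B (\<lambda>q. c * h q) g') p = c * B f' (B h g') p"
       "B f' (B g' (\<lambda>q. h q + k q)) p = B f' (B g' h) p + B f' (B g' k) p"
       "B f' (B (\<lambda>q. h q + k q) g') p = B f' (B h g') p + B f' (B k g') p"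
       "B f' (B g' (\<lambda>q. h q * k q)) p = h p * B f' (B g' k) p + B g' k p * B f' h p
           + (k p * B f' (B g' h) p + B g' h p * B f' k p)"
       "B f' (B (\<lambda>q. h q * k q) g') p = h p * B f' (B k g') p + B k g' p * B f' h p
           + (k p * B f' (B h g') p + B h g' p * B f' k p)"
    if f': "hol_at X f' p" and g': "hol_at X g' p" for f' g'
  proof -
    have ev: "\<forall>\<^sub>F y in nhds p. hol_at X g' y \<and> hol_at X h y \<and> hol_at X k y"
      by (intro eventually_conj hol_at_eventually g' h k)
    note der = derivation_germ[OF dR[OF f'] p]
    \<comment> \<open>the inner bracket is expanded in a neighbourhood of \<open>p\<close>, since the outer one differentiates it\<close>
    have 1: "\<forall>\<^sub>F y in nhds p. y \<in> X \<longrightarrow> B g' (\<lambda>q. c * h q) y = c * B g' h y"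
      using ev by eventually_elim (auto intro: derivation_cmult[OF bider_right])
    have 2: "\<forall>\<^sub>F y in nhds p. y \<in> X \<longrightarrow> B (\<lambda>q. c * h q) g' y = c * B h g' y"
      using ev by eventually_elim (auto intro: derivation_cmult[OF bider_left])
    have 3: "\<forall>\<^sub>F y in nhds p. y \<in> X \<longrightarrow> B g' (\<lambda>q. h q + k q) y = B g' h y + B g' k y"
      using ev by eventually_elim (auto intro: derivation_add[OF bider_right])
    have 4: "\<forall>\<^sub>F y in nhds p. y \<in> X \<longrightarrow> B (\<lambda>q. h q + k q) g' y = B h g' y + B k g' y"
      using ev by eventually_elim (auto intro: derivation_add[OF bider_left])
    have 5: "\<forall>\<^sub>F y in nhds p. y \<in> X \<longrightarrow> B g' (\<lambda>q. h q * k q) y = h y * B g' k y + k y * B g' h y"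
      using ev by eventually_elim (auto intro: derivation_mult[OF bider_right])
    have 6: "\<forall>\<^sub>F y in nhds p. y \<in> X \<longrightarrow> B (\<lambda>q. h q * k q) g' y = h y * B k g' y + k y * B h g' y"
      using ev by eventually_elim (auto intro: derivation_mult[OF bider_left])
    note hs = f' g' h k hol_at_mult hol_at_add hol_at_const bh
    note dd = derivation_cmult[OF dR[OF f']] derivation_add[OF dR[OF f']] derivation_mult[OF dR[OF f']]
    show "B f' (B g' (\<lambda>q. c * h q)) p = c * B f' (B g' h) p"
      by (subst der[OF _ _ 1]) (simp_all add: dd hs)
    show "B f' (B (\<lambda>q. c * h q) g') p = c * B f' (B h g') p"
      by (subst der[OF _ _ 2]) (simp_all add: dd hs)
    show "B f' (B g' (\<lambda>q. h q + k q)) p = B f' (B g' h) p + B f' (B g' k) p"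
      by (subst der[OF _ _ 3]) (simp_all add: dd hs)
    show "B f' (B (\<lambda>q. h q + k q) g') p = B f' (B h g') p + B f' (B k g') p"
      by (subst der[OF _ _ 4]) (simp_all add: dd hs)
    show "B f' (B g' (\<lambda>q. h q * k q)) p = h p * B f' (B g' k) p + B g' k p * B f' h p
           + (k p * B f' (B g' h) p + B g' h p * B f' k p)"
      by (subst der[OF _ _ 5]) (simp_all add: dd hs)
    show "B f' (B (\<lambda>q. h q * k q) g') p = h p * B f' (B k g') p + B k g' p * B f' h p
           + (k p * B f' (B h g') p + B h g' p * B f' k p)"
      by (subst der[OF _ _ 6]) (simp_all add: dd hs)
  qed
  note fg = bh[OF f g]
  have sk: "B f k p = - B k f p" "B g k p = - B k g p" "B f h p = - B h f p" "B g h p = - B h g p"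
    by (intro bider_skew p f g h k)+
  note outer = derivation_cmult[OF dL[OF fg] h] derivation_add[OF dL[OF fg] h k] derivation_mult[OF dL[OF fg] h k]
  show "jacobiator p f g (\<lambda>q. c * h q) = c * jacobiator p f g h \<and>
        jacobiator p f g (\<lambda>q. h q + k q) = jacobiator p f g h + jacobiator p f g k \<and>
        jacobiator p f g (\<lambda>q. h q * k q) = h p * jacobiator p f g k + k p * jacobiator p f g h"
    unfolding jacobiator_def inner(1)[OF f g] inner(2)[OF g f] inner(3)[OF f g] inner(4)[OF g f]
      inner(5)[OF f g] inner(6)[OF g f] outer
    by (simp add: sk algebra_simps)
qed

text \<open>
  The Jacobiator is cyclic and a derivation in its last argument, so the arguments can be replaced by
  coordinates one after the other.
\<close>

lemma jacobiator_vanishes: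
  assumes p: "p \<in> X"
    and J: "\<And>i j k. jacobiator p (\<lambda>y. y $ i) (\<lambda>y. y $ j) (\<lambda>y. y $ k) = 0"
    and f: "hol_at X f p" and g: "hol_at X g p" and h: "hol_at X h p"
  shows "jacobiator p f g h = 0"
proof -
  have cyc: "jacobiator p f g h = jacobiator p g h f" for f g h
    unfolding jacobiator_def by simp
  have ext: "jacobiator p f g h = 0"
    if "hol_at X f p" "hol_at X g p" "hol_at X h p" "\<And>k. jacobiator p f g (\<lambda>y. y $ k) = 0" for f g h
  proof -
    obtain F where F: "holo F p" "\<forall>\<^sub>F y in nhds p. y \<in> X \<longrightarrow> F y = h y"
      using \<open>hol_at X h p\<close> unfolding hol_at_iff by blast
    show ?thesis
      using derivation_coordinates[OF jacobiator_derivation[OF p that(1,2)] p F] that(4) by simp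
  qed
  have 1: "jacobiator p (\<lambda>y. y $ i) (\<lambda>y. y $ j) h = 0" if "hol_at X h p" for i j h
    by (rule ext) (auto intro: that J)
  have 2: "jacobiator p h (\<lambda>y. y $ i) k = 0" if "hol_at X h p" "hol_at X k p" for h k i
    by (rule ext) (auto simp: cyc[of h] intro: 1 that)
  show ?thesis
    by (rule ext) (auto simp: cyc[of f g] intro: 2 f g h)
qed

end

section \<open>Matrices, determinants and inverses\<close>

lemma isCont_filterlim_nhds: "isCont f x \<Longrightarrow> filterlim f (nhds (f x)) (nhds x)"
  by (simp add: isCont_def tendsto_at_iff_tendsto_nhds)

lemma filterlim_line: "filterlim (\<lambda>t. p + t *\<^sub>R v) (nhds p) (nhds (0::real))"
  for p v :: "'a::real_normed_vector"
proof -
  have "isCont (\<lambda>t::real. p + t *\<^sub>R v) 0" by (intro continuous_intros)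
  from isCont_filterlim_nhds[OF this] show ?thesis by simp
qed

lemma matrix_inv:
  fixes A :: "'n::finite cmat"
  assumes "det A \<noteq> 0"
  shows "A ** matrix_inv A = mat 1" "matrix_inv A ** A = mat 1"
proof -
  have "\<exists>B. A ** B = mat 1 \<and> B ** A = mat 1"
    using assms invertible_det_nz[of A] unfolding invertible_def by simp
  then have "A ** matrix_inv A = mat 1 \<and> matrix_inv A ** A = mat 1"
    unfolding matrix_inv_def by (rule someI_ex)
  then show "A ** matrix_inv A = mat 1" "matrix_inv A ** A = mat 1" by auto
qed

lemma matrix_inv_cancel:
  fixes A :: "'n::finite cmat"
  assumes "det A \<noteq> 0"
  shows "A ** (matrix_inv A ** B) = B" "matrix_inv A ** (A ** B) = B"
    "(B ** A) ** matrix_inv A = B" "(B ** matrix_inv A) ** A = B"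
  by (simp_all add: matrix_mul_assoc matrix_inv[OF assms])
     (simp_all add: matrix_inv[OF assms] flip: matrix_mul_assoc)

lemma matrix_inv_unique:
  fixes A B :: "'n::finite cmat"
  assumes "A ** B = mat 1"
  shows "matrix_inv A = B"
proof -
  have "det A * det B = 1" using assms by (metis det_mul det_I)
  then have "det A \<noteq> 0" by auto
  then show ?thesis
    using matrix_inv_cancel(2)[of A B] by (simp add: assms)
qed

lemma matrix_inv_mult:
  fixes A B :: "'n::finite cmat"
  assumes "det A \<noteq> 0" "det B \<noteq> 0"
  shows "matrix_inv (A ** B) = matrix_inv B ** matrix_inv A"
proof (rule matrix_inv_unique)
  have "A ** B ** (matrix_inv B ** matrix_inv A) = A ** (B ** (matrix_inv B ** matrix_inv A))"
    by (simp add: matrix_mul_assoc)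
  then show "A ** B ** (matrix_inv B ** matrix_inv A) = mat 1"
    by (simp add: matrix_inv_cancel matrix_inv assms)
qed

lemma det_matrix_inv: "det (A :: 'n::finite cmat) \<noteq> 0 \<Longrightarrow> det (matrix_inv A) = 1 / det A"
  by (metis det_I det_mul matrix_inv(2) nonzero_eq_divide_eq)

lemma trace_conj:
  fixes A B :: "'n::finite cmat"
  assumes "det A \<noteq> 0"
  shows "trace (A ** B ** matrix_inv A) = trace B"
  using trace_mul_sym[of "A ** B" "matrix_inv A"] matrix_inv_cancel(2)[OF assms] by simp

lemma trace_sum: "trace (\<Sum>i\<in>I. A i) = (\<Sum>i\<in>I. trace (A i :: 'n::finite cmat))"
  by (induction I rule: infinite_finite_induct) (simp_all add: trace_add trace_0[unfolded mat_0])

lemma trace_zero [simp]: "trace (0 :: 'n::finite cmat) = 0"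
  by (simp add: trace_def)

lemma matrix_add_rdistrib: "(A + B) ** C = A ** C + B ** (C :: 'n::finite cmat)"
  by (simp add: matrix_matrix_mult_def vec_eq_iff sum.distrib algebra_simps)

lemma matrix_mult_zero [simp]: "(0 :: 'n::finite cmat) ** B = 0" "B ** (0 :: 'n cmat) = 0"
  by (simp_all add: matrix_matrix_mult_def vec_eq_iff)

lemma matrix_mult_sum_left: "(\<Sum>i\<in>I. A i) ** (B :: 'n::finite cmat) = (\<Sum>i\<in>I. A i ** B)"
  by (induction I rule: infinite_finite_induct) (simp_all add: matrix_add_rdistrib)

lemma matrix_mult_sum_right: "(B :: 'n::finite cmat) ** (\<Sum>i\<in>I. A i) = (\<Sum>i\<in>I. B ** A i)"
  by (induction I rule: infinite_finite_induct) (simp_all add: matrix_add_ldistrib)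

lemma matrix_mult_uminus [simp]:
  "(- A :: 'n::finite cmat) ** B = - (A ** B)" "A ** (- B) = - (A ** B :: 'n cmat)"
  by (simp_all add: matrix_matrix_mult_def vec_eq_iff sum_negf)

lemma bounded_bilinear_matrix_mult: "bounded_bilinear ((**) :: 'n::finite cmat \<Rightarrow> 'n cmat \<Rightarrow> 'n cmat)"
  unfolding bilinear_conv_bounded_bilinear[symmetric] bilinear_def
  by (auto intro!: linearI
      simp: matrix_add_ldistrib matrix_add_rdistrib matrix_scalar_ac scalar_matrix_assoc)

lemmas has_derivative_matrix_mult = bounded_bilinear.FDERIV[OF bounded_bilinear_matrix_mult]

lemma bounded_linear_trace: "bounded_linear (trace :: 'n::finite cmat \<Rightarrow> complex)"
  by (rule linear_conv_bounded_linear[THEN iffD1])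
    (auto intro!: linearI simp: trace_def sum.distrib scaleR_sum_right)

lemmas has_derivative_trace = bounded_linear.has_derivative[OF bounded_linear_trace]

lemma bounded_linear_entry: "bounded_linear (\<lambda>A :: 'n::finite cmat. A $ a $ b)"
  by (rule bounded_linear_compose[OF bounded_linear_vec_nth bounded_linear_vec_nth])

lemma has_derivative_det_general:
  fixes A :: "'n::finite cmat"
  shows "(det has_derivative (\<lambda>H. \<Sum>p | p permutes UNIV. of_int (sign p) *
      (\<Sum>i\<in>UNIV. H $ i $ p i * (\<Prod>j\<in>UNIV - {i}. A $ j $ p j)))) (at A)"
  unfolding det_def
  by (intro has_derivative_sum has_derivative_mult_right has_derivative_prod
      bounded_linear_imp_has_derivative bounded_linear_entry)

text \<open>
  In the expansion of the determinant over permutations, the differential at the identity matrix only sees the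
  identity permutation.
\<close>

lemma has_derivative_det_at_one: "(det has_derivative trace) (at (mat 1 :: 'n::finite cmat))"
proof -
  have 1: "(\<Sum>i\<in>UNIV. H $ i $ p i * (\<Prod>j\<in>UNIV - {i}. (mat 1 :: 'n cmat) $ j $ p j)) = 0"
    if p: "p permutes UNIV" "p \<noteq> id" for p and H :: "'n cmat"
  proof (rule sum.neutral, rule ballI)
    fix i
    \<comment> \<open>a permutation that fixes all points but one is the identity\<close>
    have "\<exists>j. j \<noteq> i \<and> p j \<noteq> j"
    proof (rule ccontr)
      assume "\<not> ?thesis"
      then have fixed: "p j = j" if "j \<noteq> i" for j using that by blast
      have "p i = i"
        using permutes_inj[OF p(1)] fixed by (metis injD)
      then have "p = id" using fixed by (metis eq_id_iff)
      with p show False by simp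
    qed
    then obtain j where "j \<noteq> i" "p j \<noteq> j" by blast
    then have "(\<Prod>j\<in>UNIV - {i}. (mat 1 :: 'n cmat) $ j $ p j) = 0"
      by (intro prod_zero) (auto simp: mat_def intro!: bexI[of _ j])
    then show "H $ i $ p i * (\<Prod>j\<in>UNIV - {i}. (mat 1 :: 'n cmat) $ j $ p j) = 0" by simp
  qed
  have "(\<Sum>p | p permutes UNIV. of_int (sign p) *
      (\<Sum>i\<in>UNIV. H $ i $ p i * (\<Prod>j\<in>UNIV - {i}. (mat 1 :: 'n cmat) $ j $ p j))) = trace H"
    for H :: "'n cmat"
  proof -
    have "(\<Sum>p | p permutes UNIV. of_int (sign p) *
      (\<Sum>i\<in>UNIV. H $ i $ p i * (\<Prod>j\<in>UNIV - {i}. (mat 1 :: 'n cmat) $ j $ p j)))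
      = (\<Sum>p\<in>{id}. of_int (sign p) *
      (\<Sum>i\<in>UNIV. H $ i $ p i * (\<Prod>j\<in>UNIV - {i}. (mat 1 :: 'n cmat) $ j $ p j)))"
      by (rule sum.mono_neutral_right) (auto simp: permutes_id 1 finite_permutations)
    also have "\<dots> = trace H"
      by (simp add: trace_def mat_def sign_id)
    finally show ?thesis .
  qed
  with has_derivative_det_general[of "mat 1 :: 'n cmat"] show ?thesis by simp
qed

text \<open>
  Translate the derivative at the identity by \<open>det A = det G det (G\<^sup>-\<^sup>1 A)\<close>.
\<close>

lemma has_derivative_det:
  fixes G :: "'n::finite cmat"
  assumes "det G \<noteq> 0"
  shows "(det has_derivative (\<lambda>H. det G * trace (matrix_inv G ** H))) (at G)"
proof -
  have "((\<lambda>A. matrix_inv G ** A) has_derivative (\<lambda>H. matrix_inv G ** H)) (at G)"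
    by (intro bounded_linear_imp_has_derivative
        bounded_bilinear.bounded_linear_right[OF bounded_bilinear_matrix_mult])
  moreover have "(det has_derivative trace) (at (matrix_inv G ** G))"
    by (simp add: matrix_inv assms has_derivative_det_at_one)
  ultimately have "((\<lambda>A. det (matrix_inv G ** A)) has_derivative (\<lambda>H. trace (matrix_inv G ** H))) (at G)"
    by (rule has_derivative_compose)
  from has_derivative_mult_right[OF this, of "det G"]
  show ?thesis using assms by (simp add: det_mul det_matrix_inv)
qed

lemma isCont_det: "isCont det (A :: 'n::finite cmat)"
  using has_derivative_det_general has_derivative_continuous by blast

lemma eventually_det_nonzero:
  "det (A :: 'n::finite cmat) \<noteq> 0 \<Longrightarrow> \<forall>\<^sub>F B in nhds A. det B \<noteq> 0"
  by (rule tendsto_imp_eventually_ne[OF isCont_filterlim_nhds[OF isCont_det[of A]]])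

lemma matrix_inv_cramer:
  fixes A :: "'n::finite cmat"
  assumes "det A \<noteq> 0"
  shows "matrix_inv A $ k $ b = det (\<chi> i j. if j = k then (if i = b then 1 else 0) else A $ i $ j) / det A"
proof -
  have "A *v (matrix_inv A *v axis b 1) = axis b 1"
    by (simp add: matrix_vector_mul_assoc matrix_inv assms)
  then have "(matrix_inv A *v axis b 1) $ k = det (\<chi> i j. if j = k then axis b 1 $ i else A $ i $ j) / det A"
    using cramer[OF assms, of "matrix_inv A *v axis b 1" "axis b 1"] by simp
  moreover have "(matrix_inv A *v axis b 1) $ k = matrix_inv A $ k $ b"
    by (simp add: matrix_vector_mult_def axis_def if_distrib[of "\<lambda>x. _ * x"] cong: if_cong)
  ultimately show ?thesis by (simp add: axis_def cong: if_cong)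
qed

text \<open>
  By Cramer's rule the entries of the inverse are quotients of determinants.
\<close>

lemma differentiable_matrix_inv:
  fixes G :: "'n::finite cmat"
  assumes "det G \<noteq> 0"
  shows "matrix_inv differentiable (at G)"
proof -
  have "\<exists>D. ((\<lambda>A. matrix_inv A $ k $ b) has_derivative D) (at G)" for k b
  proof -
    define Q :: "'n cmat \<Rightarrow> 'n cmat"
      where "Q A = (\<chi> i j. if j = k then (if i = b then 1 else 0) else A $ i $ j)" for A
    have "(Q has_derivative (\<lambda>H. \<chi> i j. if j = k then 0 else H $ i $ j)) (at G)"
    proof (intro has_derivative_vec_of_components)
      fix i j
      show "((\<lambda>A. Q A $ i $ j) has_derivative (\<lambda>H. (\<chi> i j. if j = k then 0 else H $ i $ j) $ i $ j)) (at G)"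
        by (cases "j = k") (auto simp: Q_def intro!: bounded_linear_imp_has_derivative bounded_linear_entry)
    qed
    from has_derivative_compose[OF this has_derivative_det_general]
    obtain D1 where D1: "((\<lambda>A. det (Q A)) has_derivative D1) (at G)" by blast
    from has_derivative_divide'[OF D1 has_derivative_det[OF assms] assms]
    obtain D2 where D2: "((\<lambda>A. det (Q A) / det A) has_derivative D2) (at G)" by blast
    have "\<forall>\<^sub>F A in nhds G. det (Q A) / det A = matrix_inv A $ k $ b"
      using eventually_det_nonzero[OF assms]
      by (rule eventually_mono) (simp add: matrix_inv_cramer Q_def)
    from has_derivative_transform_nhds[OF D2 this] show ?thesis by blast
  qed
  then obtain D where D: "\<And>k b. ((\<lambda>A. matrix_inv A $ k $ b) has_derivative D k b) (at G)" by metis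
  have "(matrix_inv has_derivative (\<lambda>H. \<chi> k b. D k b H)) (at G)"
    by (intro has_derivative_vec_of_components) (simp add: D)
  then show ?thesis unfolding differentiable_def by blast
qed

text \<open>
  Differentiate \<open>A A\<^sup>-\<^sup>1 = 1\<close>.
\<close>

lemma has_derivative_matrix_inv:
  fixes G :: "'n::finite cmat"
  assumes "det G \<noteq> 0"
  shows "(matrix_inv has_derivative (\<lambda>H. - (matrix_inv G ** H ** matrix_inv G))) (at G)"
proof -
  obtain D where D: "(matrix_inv has_derivative D) (at G)"
    using differentiable_matrix_inv[OF assms] unfolding differentiable_def by blast
  from has_derivative_matrix_mult[OF has_derivative_ident D]
  have 1: "((\<lambda>A. A ** matrix_inv A) has_derivative (\<lambda>H. G ** D H + H ** matrix_inv G)) (at G)" .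
  have "\<forall>\<^sub>F A in nhds G. mat 1 = A ** matrix_inv A"
    using eventually_det_nonzero[OF assms] by (rule eventually_mono) (simp add: matrix_inv)
  from has_derivative_transform_nhds[OF has_derivative_const this]
  have 2: "((\<lambda>A. A ** matrix_inv A) has_derivative (\<lambda>H. 0)) (at G)" .
  have "D H = - (matrix_inv G ** H ** matrix_inv G)" for H
  proof -
    have "G ** D H = - (H ** matrix_inv G)"
      using has_derivative_unique[OF 1 2] by (metis add_eq_0_iff2)
    then have "matrix_inv G ** (G ** D H) = - (matrix_inv G ** H ** matrix_inv G)"
      by (simp add: matrix_mul_assoc)
    then show ?thesis by (simp add: matrix_inv_cancel assms)
  qed
  then have "D = (\<lambda>H. - (matrix_inv G ** H ** matrix_inv G))" by (rule ext)
  with D show ?thesis by simp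
qed

section \<open>Matrix coordinates of points\<close>

lemma Gmat_mk_point [simp]: "Gmat j (mk_point G L) = G j"
  and Lmat_mk_point [simp]: "Lmat j (mk_point G L) = L j"
  by (simp_all add: Gmat_def Lmat_def mk_point_def vec_eq_iff)

lemma Gmat_nth: "Gmat j x $ a $ b = x $ Inl (j, a, b)"
  and Lmat_nth: "Lmat j x $ a $ b = x $ Inr (j, a, b)"
  by (simp_all add: Gmat_def Lmat_def)

lemma point_eqI: "(\<And>j. Gmat j x = Gmat j y) \<Longrightarrow> (\<And>j. Lmat j x = Lmat j y) \<Longrightarrow> x = y"
  unfolding vec_eq_iff Gmat_nth Lmat_nth by (metis sum.exhaust prod_cases3)

lemma Gmat_act [simp]: "Gmat j (act S x) = S ** Gmat j x"
  and Lmat_act [simp]: "Lmat j (act S x) = Lmat j x"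
  by (simp_all add: act_def)

lemma Gmat_linear: "Gmat j (x + y) = Gmat j x + Gmat j y" "Gmat j (r *\<^sub>R x) = r *\<^sub>R Gmat j x"
   "Gmat j (c *s x) = mat c ** Gmat j x" "Gmat j 0 = 0" "Gmat j (- x) = - Gmat j x"
   "Gmat j (x - y) = Gmat j x - Gmat j y"
  by (simp_all add: Gmat_def vec_eq_iff matrix_matrix_mult_def mat_def if_distrib[of "\<lambda>x. x * _"]
      sum.delta cong: if_cong)

lemma Lmat_linear: "Lmat j (x + y) = Lmat j x + Lmat j y" "Lmat j (r *\<^sub>R x) = r *\<^sub>R Lmat j x"
   "Lmat j (c *s x) = mat c ** Lmat j x" "Lmat j 0 = 0" "Lmat j (- x) = - Lmat j x"
   "Lmat j (x - y) = Lmat j x - Lmat j y"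
  by (simp_all add: Lmat_def vec_eq_iff matrix_matrix_mult_def mat_def if_distrib[of "\<lambda>x. x * _"]
      sum.delta cong: if_cong)

lemma bounded_linear_Gmat: "bounded_linear (Gmat j)" and bounded_linear_Lmat: "bounded_linear (Lmat j)"
  by (auto intro!: linear_conv_bounded_linear[THEN iffD1] linearI simp: Gmat_linear Lmat_linear)

lemmas has_derivative_Gmat = bounded_linear_imp_has_derivative[OF bounded_linear_Gmat]
lemmas has_derivative_Lmat = bounded_linear_imp_has_derivative[OF bounded_linear_Lmat]

lemma has_derivative_mk_point:
  assumes "\<And>j. (G j has_derivative G' j) (at x)" "\<And>j. (L j has_derivative L' j) (at x)"
  shows "((\<lambda>x. mk_point (\<lambda>j. G j x) (\<lambda>j. L j x)) has_derivative
           (\<lambda>v. mk_point (\<lambda>j. G' j v) (\<lambda>j. L' j v))) (at x)"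
proof (rule has_derivative_vec_of_components)
  fix i :: "('a \<times> 'c \<times> 'c) + ('a \<times> 'c \<times> 'c)"
  show "((\<lambda>y. mk_point (\<lambda>j. G j y) (\<lambda>j. L j y) $ i) has_derivative
         (\<lambda>v. mk_point (\<lambda>j. G' j v) (\<lambda>j. L' j v) $ i)) (at x)"
    by (cases i) (auto simp: mk_point_def intro!: bounded_linear.has_derivative[OF bounded_linear_entry] assms)
qed

lemma mat_commute: "mat c ** A = A ** (mat c :: 'n::finite cmat)"
  by (simp add: vec_eq_iff matrix_matrix_mult_def mat_def if_distrib[of "\<lambda>x. x * _"]
      if_distrib[of "\<lambda>x. _ * x"] sum.delta sum.delta' mult.commute cong: if_cong)

lemma mat_mult_nth: "(mat c ** A :: 'n::finite cmat) $ a $ b = c * A $ a $ b"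
  by (simp add: matrix_matrix_mult_def mat_def if_distrib[of "\<lambda>x. x * _"] sum.delta cong: if_cong)

lemma trace_mat_mult: "trace (mat c ** A :: 'n::finite cmat) = c * trace A"
  by (simp add: trace_def mat_mult_nth sum_distrib_left)

lemma cdiff_Gmat_nth [intro]: "cdiff (\<lambda>y. Gmat j y $ a $ b) p"
  and holo_Gmat_nth [intro]: "holo (\<lambda>y. Gmat j y $ a $ b) p"
  and holo_Lmat_nth [intro]: "holo (\<lambda>y. Lmat j y $ a $ b) p"
  unfolding Gmat_nth Lmat_nth by auto

lemma eventually_Gmat_invertible:
  assumes "det (Gmat j p) \<noteq> 0"
  shows "\<forall>\<^sub>F y in nhds p. det (Gmat j y) \<noteq> 0"
proof -
  have "isCont (\<lambda>y. det (Gmat j y)) p"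
    by (rule continuous_within_compose3[OF isCont_det])
      (rule linear_continuous_at[OF bounded_linear_Gmat])
  then have "filterlim (\<lambda>y. det (Gmat j y)) (nhds (det (Gmat j p))) (nhds p)"
    by (rule isCont_filterlim_nhds)
  then show ?thesis using assms by (rule tendsto_imp_eventually_ne)
qed

lemma has_derivative_inv_Gmat:
  assumes "det (Gmat j p) \<noteq> 0"
  shows "((\<lambda>y. matrix_inv (Gmat j y)) has_derivative
    (\<lambda>v. - (matrix_inv (Gmat j p) ** Gmat j v ** matrix_inv (Gmat j p)))) (at p)"
  by (rule has_derivative_compose[OF has_derivative_Gmat has_derivative_matrix_inv[OF assms]])

lemma holo_inv_Gmat_nth [intro]:
  assumes "det (Gmat j p) \<noteq> 0"
  shows "holo (\<lambda>y. matrix_inv (Gmat j y) $ a $ b) p"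
proof -
  have "cdiff (\<lambda>y. matrix_inv (Gmat j y) $ a $ b) y" if "det (Gmat j y) \<noteq> 0" for y
  proof (rule cdiffI[OF bounded_linear.has_derivative[OF bounded_linear_entry has_derivative_inv_Gmat[OF that]]])
    fix c v
    have "matrix_inv (Gmat j y) ** Gmat j (c *s v) ** matrix_inv (Gmat j y)
       = mat c ** (matrix_inv (Gmat j y) ** Gmat j v ** matrix_inv (Gmat j y))"
      by (metis Gmat_linear(3) mat_commute matrix_mul_assoc)
    then show "(- (matrix_inv (Gmat j y) ** Gmat j (c *s v) ** matrix_inv (Gmat j y))) $ a $ b =
      c * (- (matrix_inv (Gmat j y) ** Gmat j v ** matrix_inv (Gmat j y))) $ a $ b"
      by (simp add: mat_mult_nth)
  qed
  then show ?thesis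
    unfolding holo_def by (rule eventually_mono[OF eventually_Gmat_invertible[OF assms]])
qed

lemma holo_matrix_mult [intro]:
  assumes "\<And>a b. holo (\<lambda>y. A y $ a $ b) p" "\<And>a b. holo (\<lambda>y. B y $ a $ b) p"
  shows "holo (\<lambda>y. (A y ** B y :: 'n::finite cmat) $ a $ b) p"
  by (simp add: matrix_matrix_mult_def) (intro holo_sum holo_mult assms)

section \<open>Tangent vectors of the unreduced space and of \<open>SL(n)\<close>\<close>

text \<open>
  An invertible matrix becomes unimodular when one row, here an arbitrary one, is divided by the
  determinant.  This is a local retraction onto \<open>SL(n)\<close>.
\<close>

definition unimodularize :: "'n::finite cmat \<Rightarrow> 'n cmat" where
  "unimodularize G = (\<chi> i. if i = (SOME i. True) then (1 / det G) *s G $ i else G $ i)"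

lemma det_unimodularize: "det G \<noteq> 0 \<Longrightarrow> det (unimodularize G) = 1"
  unfolding unimodularize_def
  using det_row_mul[of "SOME i. True" "1 / det G" "\<lambda>i. G $ i" "\<lambda>i. G $ i"] by simp

lemma unimodularize_SL: "det G = 1 \<Longrightarrow> unimodularize G = G"
  by (simp add: unimodularize_def vec_eq_iff)

lemma has_derivative_unimodularize:
  fixes G :: "'n::finite cmat"
  assumes "det G = 1"
  shows "(unimodularize has_derivative (\<lambda>H. \<chi> i. if i = (SOME i. True)
     then H $ i - trace (matrix_inv G ** H) *s G $ i else H $ i)) (at G)"
proof (intro has_derivative_vec_of_components)
  fix i j
  have e: "((\<lambda>A :: 'n cmat. A $ i $ j) has_derivative (\<lambda>H. H $ i $ j)) (at G)"
    by (rule bounded_linear_imp_has_derivative[OF bounded_linear_entry])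
  have d: "(det has_derivative (\<lambda>H. trace (matrix_inv G ** H))) (at G)"
    using has_derivative_det[of G] assms by simp
  have "((\<lambda>A. A $ i $ j / det A) has_derivative
      (\<lambda>H. (H $ i $ j * det G - G $ i $ j * trace (matrix_inv G ** H)) / (det G * det G))) (at G)"
    by (rule has_derivative_divide'[OF e d]) (simp add: assms)
  then show "((\<lambda>A. unimodularize A $ i $ j) has_derivative (\<lambda>H. (\<chi> i. if i = (SOME i. True)
     then H $ i - trace (matrix_inv G ** H) *s G $ i else H $ i) $ i $ j)) (at G)"
    using e by (cases "i = (SOME i. True)") (simp_all add: unimodularize_def assms mult.commute)
qed

text \<open>
  The linear projection onto the traceless diagonal matrices.
\<close>

definition traceless_diag :: "'n::finite cmat \<Rightarrow> 'n cmat" where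
  "traceless_diag L = (\<chi> a b. if a = b then L $ a $ a - trace L / of_nat CARD('n) else 0)"

lemma trace_traceless_diag: "trace (traceless_diag L) = 0"
  by (simp add: traceless_diag_def trace_def sum_subtractf)

lemma traceless_diag_fixed: "(\<And>a b. a \<noteq> b \<Longrightarrow> L $ a $ b = 0) \<Longrightarrow> trace L = 0 \<Longrightarrow> traceless_diag L = L"
  by (simp add: traceless_diag_def vec_eq_iff)

lemma bounded_linear_traceless_diag: "bounded_linear traceless_diag"
  by (rule linear_conv_bounded_linear[THEN iffD1])
    (auto intro!: linearI simp: traceless_diag_def vec_eq_iff trace_def sum.distrib add_divide_distrib
      scaleR_sum_right[symmetric] scaleR_diff_right divide_inverse distrib_right)

text \<open>
  A retraction of a neighbourhood of \<open>A0\<close> onto \<open>A0\<close>: it turns straight lines into curves in \<open>A0\<close>.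
\<close>

definition retract_A0 :: "('N::finite, 'n::finite) point \<Rightarrow> ('N, 'n) point" where
  "retract_A0 x = mk_point (\<lambda>j. unimodularize (Gmat j x)) (\<lambda>j. traceless_diag (Lmat j x))"

text \<open>
  The linear equations of the tangent space of \<open>A0\<close> at \<open>x\<close> (see \<open>tangent_A0\<close>).
\<close>

definition TA0 :: "('N::finite, 'n::finite) point \<Rightarrow> ('N, 'n) point set" where
  "TA0 x = {v. \<forall>j. trace (matrix_inv (Gmat j x) ** Gmat j v) = 0 \<and>
      (\<forall>a b. a \<noteq> b \<longrightarrow> Lmat j v $ a $ b = 0) \<and> trace (Lmat j v) = 0}"

lemma A0_det: "x \<in> A0 \<Longrightarrow> det (Gmat j x) = 1"
  and A0_offdiag: "x \<in> A0 \<Longrightarrow> a \<noteq> b \<Longrightarrow> Lmat j x $ a $ b = 0"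
  and A0_trace: "x \<in> A0 \<Longrightarrow> trace (Lmat j x) = 0"
  and A0_distinct: "x \<in> A0 \<Longrightarrow> a \<noteq> b \<Longrightarrow> Lmat j x $ a $ a \<noteq> Lmat j x $ b $ b"
  and A0_nonresonant: "x \<in> A0 \<Longrightarrow> a \<noteq> b \<Longrightarrow> Lmat j x $ a $ a - Lmat j x $ b $ b \<notin> \<int>"
  by (auto simp: A0_def SL_def h_ss_nr_def)

lemma A0_det_nz [simp]: "x \<in> A0 \<Longrightarrow> det (Gmat j x) \<noteq> 0"
  by (simp add: A0_det)

lemma A0I:
  assumes "\<And>j. det (Gmat j x) = 1" "\<And>j a b. a \<noteq> b \<Longrightarrow> Lmat j x $ a $ b = 0"
    "\<And>j. trace (Lmat j x) = 0" "\<And>j a b. a \<noteq> b \<Longrightarrow> Lmat j x $ a $ a - Lmat j x $ b $ b \<notin> \<int>"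
  shows "x \<in> A0"
proof -
  have "Lmat j x $ a $ a \<noteq> Lmat j x $ b $ b" if "a \<noteq> b" for j a b
    using assms(4)[OF that, of j] by auto
  then show ?thesis using assms by (auto simp: A0_def SL_def h_ss_nr_def)
qed

lemma retract_A0_fixes: "x \<in> A0 \<Longrightarrow> retract_A0 x = x"
  by (intro point_eqI) (simp_all add: retract_A0_def unimodularize_SL A0_det traceless_diag_fixed A0_offdiag A0_trace)

text \<open>
  The conditions on the eigenvalues are open because the integers are closed.
\<close>

lemma eventually_retract_A0:
  assumes p: "p \<in> A0"
  shows "\<forall>\<^sub>F y in nhds p. retract_A0 y \<in> A0"
proof -
  have "\<forall>\<^sub>F y in nhds p. Lmat j y $ a $ a - Lmat j y $ b $ b \<notin> \<int>" if "a \<noteq> b" for j a b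
  proof -
    have "open ((\<lambda>y. Lmat j y $ a $ a - Lmat j y $ b $ b) -` (- \<int>))"
      unfolding Lmat_nth by (intro open_vimage open_Compl closed_Ints continuous_intros)
    from eventually_nhds_in_open[OF this, of p] show ?thesis
      using A0_nonresonant[OF p that] by simp
  qed
  then have 1: "\<forall>\<^sub>F y in nhds p. \<forall>j a b. a \<noteq> b \<longrightarrow> Lmat j y $ a $ a - Lmat j y $ b $ b \<notin> \<int>"
    by (intro eventually_all_finite) (metis (mono_tags, lifting) always_eventually eventually_mono)
  have 2: "\<forall>\<^sub>F y in nhds p. \<forall>j. det (Gmat j y) \<noteq> 0"
    by (intro eventually_all_finite eventually_Gmat_invertible) (simp add: p)
  from 1 2 show ?thesis
    by eventually_elim (rule A0I; simp add: retract_A0_def det_unimodularize trace_traceless_diag; simp add: traceless_diag_def)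
qed

text \<open>
  The derivative of a retraction is the identity on the tangent vectors of its image.
\<close>

lemma has_derivative_retract_A0:
  assumes p: "p \<in> A0"
  obtains D where "(retract_A0 has_derivative D) (at p)" "\<And>v. v \<in> TA0 p \<Longrightarrow> D v = v"
proof
  show "(retract_A0 has_derivative (\<lambda>v. mk_point
      (\<lambda>j. \<chi> i. if i = (SOME i. True)
          then Gmat j v $ i - trace (matrix_inv (Gmat j p) ** Gmat j v) *s Gmat j p $ i else Gmat j v $ i)
      (\<lambda>j. traceless_diag (Lmat j v)))) (at p)"
    unfolding retract_A0_def
    by (intro has_derivative_mk_point has_derivative_compose[OF has_derivative_Gmat has_derivative_unimodularize]
        bounded_linear.has_derivative[OF bounded_linear_traceless_diag] has_derivative_Lmat A0_det p)
  show "mk_point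
      (\<lambda>j. \<chi> i. if i = (SOME i. True)
          then Gmat j v $ i - trace (matrix_inv (Gmat j p) ** Gmat j v) *s Gmat j p $ i else Gmat j v $ i)
      (\<lambda>j. traceless_diag (Lmat j v)) = v" if "v \<in> TA0 p" for v
    using that by (intro point_eqI) (auto simp: TA0_def traceless_diag_fixed vec_eq_iff)
qed

text \<open>
  Curves have to stay in the set for all times.  A curve that does so for small times is made constant
  elsewhere, since only the derivative at \<open>0\<close> matters.
\<close>

lemma tangentI_eventually:
  assumes x: "x \<in> X" and \<gamma>: "\<gamma> 0 = x" "(\<gamma> has_vector_derivative v) (at 0)"
    and ev: "\<forall>\<^sub>F t in nhds 0. \<gamma> t \<in> X"
  shows "v \<in> tangent X x"
proof -
  define \<delta> where "\<delta> t = (if \<gamma> t \<in> X then \<gamma> t else x)" for t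
  have "\<forall>\<^sub>F t in nhds 0. \<gamma> t = \<delta> t" using ev by (rule eventually_mono) (simp add: \<delta>_def)
  with \<gamma>(2) have "(\<delta> has_vector_derivative v) (at 0)"
    unfolding has_vector_derivative_def by (rule has_derivative_transform_nhds)
  then have "curve_at X x v \<delta>" using x \<gamma>(1) by (auto simp: curve_at_def \<delta>_def)
  then show ?thesis unfolding tangent_def by blast
qed

lemma has_vector_derivative_compose:
  assumes "(\<gamma> has_vector_derivative v) (at t)" "(F has_derivative D) (at (\<gamma> t))"
  shows "((\<lambda>t. F (\<gamma> t)) has_vector_derivative D v) (at t)"
proof -
  have "((\<lambda>t. F (\<gamma> t)) has_derivative (\<lambda>h. D (h *\<^sub>R v))) (at t)"
    using has_derivative_compose[OF assms(1)[unfolded has_vector_derivative_def] assms(2)] .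
  moreover have "(\<lambda>h. D (h *\<^sub>R v)) = (\<lambda>h. h *\<^sub>R D v)"
    by (rule ext, rule linear_cmul[OF has_derivative_linear[OF assms(2)]])
  ultimately show ?thesis unfolding has_vector_derivative_def by (simp only:)
qed

lemma const_along_curve:
  assumes \<gamma>: "curve_at X x v \<gamma>" and F: "(F has_derivative D) (at x)" and c: "\<And>y. y \<in> X \<Longrightarrow> F y = c"
  shows "D v = 0"
proof -
  have "((\<lambda>t. F (\<gamma> t)) has_vector_derivative D v) (at 0)"
    by (rule has_vector_derivative_compose) (use \<gamma> F in \<open>simp_all add: curve_at_def\<close>)
  moreover have "(\<lambda>t. F (\<gamma> t)) = (\<lambda>t. c)" using \<gamma> c by (auto simp: curve_at_def)
  ultimately have "((\<lambda>t. c) has_vector_derivative D v) (at 0)" by simp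
  from vector_derivative_unique_at[OF this has_vector_derivative_const] show ?thesis .
qed

lemma tangent_A0_subset: "p \<in> A0 \<Longrightarrow> tangent A0 p \<subseteq> TA0 p"
proof
  fix v assume p: "p \<in> A0" and "v \<in> tangent A0 p"
  then obtain \<gamma> where \<gamma>: "curve_at A0 p v \<gamma>" unfolding tangent_def by blast
  have "((\<lambda>y. det (Gmat j y)) has_derivative (\<lambda>v. 1 * trace (matrix_inv (Gmat j p) ** Gmat j v))) (at p)" for j
    using has_derivative_compose[OF has_derivative_Gmat has_derivative_det[of "Gmat j p"]] p
    by (simp add: A0_det)
  from const_along_curve[OF \<gamma> this, where c = 1] have 1: "trace (matrix_inv (Gmat j p) ** Gmat j v) = 0" for j
    by (simp add: A0_det)
  have 2: "Lmat j v $ a $ b = 0" if "a \<noteq> b" for j a b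
    by (rule const_along_curve[OF \<gamma> bounded_linear.has_derivative[OF bounded_linear_entry has_derivative_Lmat], of _ _ _ 0])
      (simp add: A0_offdiag that)
  have 3: "trace (Lmat j v) = 0" for j
    by (rule const_along_curve[OF \<gamma> has_derivative_trace[OF has_derivative_Lmat], of _ 0])
      (simp add: A0_trace)
  from 1 2 3 show "v \<in> TA0 p" by (simp add: TA0_def)
qed

lemma tangent_A0:
  assumes p: "p \<in> A0"
  shows "tangent A0 p = TA0 p"
proof (rule antisym[OF tangent_A0_subset[OF p]], rule subsetI)
  fix v assume v: "v \<in> TA0 p"
  obtain D where D: "(retract_A0 has_derivative D) (at p)" "\<And>v. v \<in> TA0 p \<Longrightarrow> D v = v"
    using has_derivative_retract_A0[OF p] by blast
  have line: "((\<lambda>t. p + t *\<^sub>R v) has_vector_derivative v) (at 0)"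
    by (auto intro!: derivative_eq_intros)
  have "((\<lambda>t. retract_A0 (p + t *\<^sub>R v)) has_vector_derivative D v) (at 0)"
    by (rule has_vector_derivative_compose[OF line]) (simp add: D)
  moreover have "\<forall>\<^sub>F t in nhds 0. retract_A0 (p + t *\<^sub>R v) \<in> A0"
    by (rule eventually_compose_filterlim[OF eventually_retract_A0[OF p] filterlim_line])
  ultimately show "v \<in> tangent A0 p"
    by (intro tangentI_eventually[of p A0 "\<lambda>t. retract_A0 (p + t *\<^sub>R v)"]) (simp_all add: p D(2)[OF v] retract_A0_fixes)
qed

lemma tangent_SL: "tangent SL (mat 1 :: 'n::finite cmat) = {X. trace X = 0}"
proof (intro antisym subsetI)
  fix X :: "'n cmat" assume "X \<in> tangent SL (mat 1)"
  then obtain \<gamma> where \<gamma>: "curve_at SL (mat 1) X \<gamma>" unfolding tangent_def by blast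
  show "X \<in> {X. trace X = 0}"
    using const_along_curve[OF \<gamma> has_derivative_det_at_one, of 1] by (simp add: SL_def)
next
  fix X :: "'n cmat" assume X: "X \<in> {X. trace X = 0}"
  have line: "((\<lambda>t. mat 1 + t *\<^sub>R X) has_vector_derivative X) (at 0)"
    by (auto intro!: derivative_eq_intros)
  have "(unimodularize has_derivative (\<lambda>H. \<chi> i. if i = (SOME i. True)
     then H $ i - trace (matrix_inv (mat 1) ** H) *s (mat 1 :: 'n cmat) $ i else H $ i)) (at (mat 1 + 0 *\<^sub>R X))"
    using has_derivative_unimodularize[of "mat 1 :: 'n cmat"] by simp
  from has_vector_derivative_compose[OF line this]
  have "((\<lambda>t. unimodularize (mat 1 + t *\<^sub>R X)) has_vector_derivative (\<chi> i. if i = (SOME i. True)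
     then X $ i - trace (matrix_inv (mat 1) ** X) *s (mat 1 :: 'n cmat) $ i else X $ i)) (at 0)" .
  moreover have "(\<chi> i. if i = (SOME i. True)
     then X $ i - trace (matrix_inv (mat 1) ** X) *s (mat 1 :: 'n cmat) $ i else X $ i) = X"
  proof -
    have "matrix_inv (mat 1 :: 'n cmat) = mat 1" by (rule matrix_inv_unique) simp
    then have "trace (matrix_inv (mat 1) ** X) = 0" using X by simp
    then show ?thesis by (simp add: vec_eq_iff)
  qed
  ultimately have "((\<lambda>t. unimodularize (mat 1 + t *\<^sub>R X)) has_vector_derivative X) (at 0)" by simp
  moreover have "\<forall>\<^sub>F t in nhds 0. det (mat 1 + t *\<^sub>R X) \<noteq> 0"
    by (rule eventually_compose_filterlim[OF eventually_det_nonzero filterlim_line]) simp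
  then have "\<forall>\<^sub>F t in nhds 0. unimodularize (mat 1 + t *\<^sub>R X) \<in> SL"
    by (rule eventually_mono) (simp add: SL_def det_unimodularize)
  ultimately show "X \<in> tangent SL (mat 1)"
    by (intro tangentI_eventually[of _ _ "\<lambda>t. unimodularize (mat 1 + t *\<^sub>R X)"]) (simp_all add: SL_def unimodularize_SL)
qed

section \<open>Curves in solution sets\<close>

text \<open>
  If \<open>f (s, t) = s + o(s, t)\<close> then the equation \<open>f (s, t) = 0\<close> has a solution \<open>s = o(t)\<close>: for every \<open>e\<close> and all
  small \<open>t\<close> the map \<open>s \<mapsto> s - f (s, t)\<close> maps the ball of radius \<open>e |t|\<close> into itself, and Brouwer's theorem
  gives a fixed point.  A single solution that works for all \<open>e\<close> is a solution of smallest norm.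
\<close>

lemma implicit_curve:
  fixes f :: "'s::euclidean_space \<times> real \<Rightarrow> 's"
  assumes der: "(f has_derivative fst) (at (0, 0))" and f0: "f (0, 0) = 0"
    and cont: "\<forall>\<^sub>F z in nhds (0, 0). isCont f z"
  obtains \<sigma> where "\<sigma> 0 = 0" "(\<sigma> has_vector_derivative 0) (at 0)" "\<forall>\<^sub>F t in nhds 0. f (\<sigma> t, t) = 0"
proof -
  obtain \<epsilon> where \<epsilon>: "\<epsilon> > 0" "\<And>z. dist z (0, 0) < \<epsilon> \<Longrightarrow> isCont f z"
    using cont unfolding eventually_nhds_metric by blast
  \<comment> \<open>pairs \<open>(s, t)\<close> of norm at most \<open>r\<close> each have distance at most \<open>2 r < \<epsilon>\<close> from the origin\<close>
  define r where "r = \<epsilon> / 3"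
  have r: "r > 0" using \<epsilon> by (simp add: r_def)
  have nrm: "dist (s, t) (0, 0) \<le> norm s + \<bar>t\<bar>" for s :: 's and t :: real
    using norm_Pair_le[of s t] by (simp add: dist_norm zero_prod_def[symmetric])
  have cont_slice: "continuous_on (cball 0 r) (\<lambda>s. f (s, t))" if t: "\<bar>t\<bar> \<le> r" for t
  proof (rule continuous_at_imp_continuous_on, rule ballI)
    fix s :: 's assume "s \<in> cball 0 r"
    then have "dist (s, t) (0, 0) < \<epsilon>" using nrm[of s t] t r by (simp add: r_def)
    then show "isCont (\<lambda>s. f (s, t)) s"
      using \<epsilon>(2) by (intro isCont_o2[of s "\<lambda>s. (s, t)" f]) (auto intro!: continuous_intros)
  qed
  define Z where "Z t = {s \<in> cball 0 r. f (s, t) = 0}" for t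
  have minimal: "\<exists>s. s \<in> Z t \<and> (\<forall>s'\<in>Z t. norm s \<le> norm s')" if "Z t \<noteq> {}" "\<bar>t\<bar> \<le> r" for t
  proof -
    have "closed (Z t)"
      using continuous_closed_preimage[OF cont_slice[OF that(2)] closed_cball, of "{0}"]
      by (simp add: Z_def vimage_def Int_def)
    moreover have "bounded (Z t)"
      by (rule bounded_subset[OF bounded_cball[of 0 r]]) (auto simp: Z_def)
    ultimately have "compact (Z t)" by (simp add: compact_eq_bounded_closed)
    from continuous_attains_inf[OF this that(1), of norm] show ?thesis
      by (auto intro: continuous_intros)
  qed
  define \<sigma> where "\<sigma> t = (SOME s. s \<in> Z t \<and> (\<forall>s'\<in>Z t. norm s \<le> norm s'))" for t
  have \<sigma>: "\<sigma> t \<in> Z t" "\<And>s. s \<in> Z t \<Longrightarrow> norm (\<sigma> t) \<le> norm s" if "Z t \<noteq> {}" "\<bar>t\<bar> \<le> r" for t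
    using someI_ex[OF minimal[OF that]] unfolding \<sigma>_def by blast+
  have small: "\<exists>d>0. \<forall>t. \<bar>t\<bar> < d \<longrightarrow> \<bar>t\<bar> \<le> r \<and> Z t \<noteq> {} \<and> norm (\<sigma> t) \<le> e * \<bar>t\<bar>" if "e > 0" for e
  proof -
    \<comment> \<open>for factors up to \<open>1\<close>, the ball of radius \<open>e' |t|\<close> stays inside the one on which \<open>f\<close> is continuous\<close>
    define e' where "e' = min e 1"
    have e': "0 < e'" "e' \<le> 1" "e' \<le> e" using that by (auto simp: e'_def)
    obtain \<delta> where \<delta>: "\<delta> > 0"
      "\<And>z. norm (z - (0, 0)) < \<delta> \<Longrightarrow> norm (f z - f (0, 0) - fst (z - (0, 0))) \<le> e' / 2 * norm (z - (0, 0))"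
      using der e'(1) unfolding has_derivative_at_alt by (meson half_gt_zero)
    define d where "d = min (\<delta> / 2) r"
    have "\<bar>t\<bar> \<le> r \<and> Z t \<noteq> {} \<and> norm (\<sigma> t) \<le> e * \<bar>t\<bar>" if t: "\<bar>t\<bar> < d" for t
    proof -
      have tr: "\<bar>t\<bar> \<le> r" and t\<delta>: "\<bar>t\<bar> < \<delta> / 2" using t by (auto simp: d_def)
      have "\<exists>s\<in>Z t. norm s \<le> e' * \<bar>t\<bar>"
      proof (cases "t = 0")
        case True
        then show ?thesis using f0 r by (auto simp: Z_def intro!: bexI[of _ 0])
      next
        case False
        define \<rho> where "\<rho> = e' * \<bar>t\<bar>"
        have \<rho>: "\<rho> > 0" "\<rho> \<le> \<bar>t\<bar>"
          using False e' by (auto simp: \<rho>_def mult_le_cancel_right1)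
        have sub: "cball 0 \<rho> \<subseteq> cball (0 :: 's) r" using \<rho> tr by (intro subset_cball) simp
        have self: "norm (s - f (s, t)) \<le> \<rho>" if "norm s \<le> \<rho>" for s
        proof -
          have le: "norm (s, t) \<le> 2 * \<bar>t\<bar>"
            using norm_Pair_le[of s t] that \<rho> by simp
          then have "norm ((s, t) - (0, 0)) < \<delta>" using t\<delta> by simp
          from \<delta>(2)[OF this] have "norm (f (s, t) - s) \<le> e' / 2 * norm (s, t)"
            by (simp add: f0)
          also have "\<dots> \<le> e' / 2 * (2 * \<bar>t\<bar>)" using le e' by (intro mult_left_mono) auto
          finally show ?thesis by (simp add: \<rho>_def norm_minus_commute)
        qed
        have c1: "continuous_on (cball 0 \<rho>) (\<lambda>s. s - f (s, t))"
          by (intro continuous_intros continuous_on_subset[OF cont_slice[OF tr] sub])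
        have c2: "(\<lambda>s. s - f (s, t)) \<in> cball 0 \<rho> \<rightarrow> cball 0 \<rho>" using self by auto
        obtain s where s: "s \<in> cball 0 \<rho>" "s - f (s, t) = s"
          by (rule brouwer_ball[OF \<rho>(1) c1 c2])
        then have "s \<in> Z t" using sub by (auto simp: Z_def)
        moreover have "norm s \<le> e' * \<bar>t\<bar>" using s by (simp add: \<rho>_def)
        ultimately show ?thesis by blast
      qed
      then obtain s where s: "s \<in> Z t" "norm s \<le> e' * \<bar>t\<bar>" by blast
      then have "Z t \<noteq> {}" by blast
      from \<sigma>(2)[OF this tr s(1)] s(2) have "norm (\<sigma> t) \<le> e' * \<bar>t\<bar>" by simp
      also have "\<dots> \<le> e * \<bar>t\<bar>" using e' by (intro mult_right_mono) auto
      finally show ?thesis using tr \<open>Z t \<noteq> {}\<close> by simp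
    qed
    moreover have "d > 0" using \<delta>(1) r by (simp add: d_def)
    ultimately show ?thesis by blast
  qed
  obtain d where d: "d > 0" "\<And>t. \<bar>t\<bar> < d \<Longrightarrow> \<bar>t\<bar> \<le> r \<and> Z t \<noteq> {} \<and> norm (\<sigma> t) \<le> 1 * \<bar>t\<bar>"
    using small[of 1] by auto
  have \<sigma>0: "\<sigma> 0 = 0" using d(2)[of 0] d(1) by simp
  have "(\<sigma> has_derivative (\<lambda>h. h *\<^sub>R 0)) (at 0)"
    unfolding has_derivative_at_alt
  proof (intro conjI allI impI)
    fix e :: real assume "e > 0"
    from small[OF this] show "\<exists>d>0. \<forall>y. norm (y - 0) < d \<longrightarrow>
        norm (\<sigma> y - \<sigma> 0 - (y - 0) *\<^sub>R 0) \<le> e * norm (y - 0)"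
      by (auto simp: \<sigma>0)
  qed simp
  then have der\<sigma>: "(\<sigma> has_vector_derivative 0) (at 0)" by (simp add: has_vector_derivative_def)
  have "\<forall>\<^sub>F t in nhds 0. f (\<sigma> t, t) = 0"
  proof -
    have "f (\<sigma> t, t) = 0" if "dist t 0 < d" for t
      using \<sigma>(1)[of t] d(2)[of t] that by (simp add: Z_def)
    then show ?thesis unfolding eventually_nhds_metric using d(1) by blast
  qed
  from that[OF \<sigma>0 der\<sigma> this] show ?thesis .
qed

section \<open>Tangent vectors of the level set\<close>

lemma trace_scaleR: "trace (r *\<^sub>R A) = r *\<^sub>R trace (A :: 'n::finite cmat)"
  by (simp add: trace_def scaleR_sum_right)

lemma TA0_add: "u \<in> TA0 x \<Longrightarrow> v \<in> TA0 x \<Longrightarrow> u + v \<in> TA0 x"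
  by (simp add: TA0_def Gmat_linear Lmat_linear matrix_add_ldistrib trace_add)

lemma TA0_smult: "u \<in> TA0 x \<Longrightarrow> c *s u \<in> TA0 x"
proof -
  have "A ** (mat c ** B) = mat c ** (A ** B)" for A B :: "'b cmat"
    by (metis mat_commute matrix_mul_assoc)
  then show "u \<in> TA0 x \<Longrightarrow> c *s u \<in> TA0 x"
    by (simp add: TA0_def Gmat_linear Lmat_linear trace_mat_mult mat_mult_nth)
qed

lemma TA0_scaleR: "u \<in> TA0 x \<Longrightarrow> r *\<^sub>R u \<in> TA0 x"
proof -
  have "r *\<^sub>R u = complex_of_real r *s u" by (simp add: vec_eq_iff scaleR_conv_of_real[where 'a = complex])
  then show "u \<in> TA0 x \<Longrightarrow> r *\<^sub>R u \<in> TA0 x" by (simp add: TA0_smult)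
qed

text \<open>
  The differential of the moment map.
\<close>

definition moment_deriv :: "('N::finite, 'n::finite) point \<Rightarrow> ('N, 'n) point \<Rightarrow> 'n cmat" where
  "moment_deriv x v = (\<Sum>j\<in>UNIV. Gmat j v ** Lmat j x ** matrix_inv (Gmat j x)
     + Gmat j x ** Lmat j v ** matrix_inv (Gmat j x)
     - Gmat j x ** Lmat j x ** (matrix_inv (Gmat j x) ** Gmat j v ** matrix_inv (Gmat j x)))"

lemma has_derivative_moment_map:
  assumes "\<And>j. det (Gmat j x) \<noteq> 0"
  shows "(moment_map has_derivative moment_deriv x) (at x)"
proof -
  have "((\<lambda>y. Gmat j y ** Lmat j y ** matrix_inv (Gmat j y)) has_derivative
      (\<lambda>v. Gmat j v ** Lmat j x ** matrix_inv (Gmat j x)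
     + Gmat j x ** Lmat j v ** matrix_inv (Gmat j x)
     - Gmat j x ** Lmat j x ** (matrix_inv (Gmat j x) ** Gmat j v ** matrix_inv (Gmat j x)))) (at x)" for j
  proof -
    have "((\<lambda>y. Gmat j y ** Lmat j y ** matrix_inv (Gmat j y)) has_derivative
      (\<lambda>v. Gmat j x ** Lmat j x ** - (matrix_inv (Gmat j x) ** Gmat j v ** matrix_inv (Gmat j x))
        + (Gmat j x ** Lmat j v + Gmat j v ** Lmat j x) ** matrix_inv (Gmat j x))) (at x)"
      by (intro has_derivative_matrix_mult has_derivative_Gmat has_derivative_Lmat
          has_derivative_inv_Gmat assms)
    then show ?thesis by (simp add: matrix_add_rdistrib algebra_simps)
  qed
  from has_derivative_sum[of UNIV, OF this] show ?thesis
    unfolding moment_map_def[abs_def] moment_deriv_def[abs_def] .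
qed

lemma trace_moment_map: "x \<in> A0 \<Longrightarrow> trace (moment_map x) = 0"
  by (simp add: moment_map_def trace_sum trace_conj A0_trace)

text \<open>
  A right inverse of \<open>\<xi> \<mapsto> [\<xi>, L]\<close> on matrices with zero diagonal, for a diagonal matrix \<open>L\<close>.
\<close>

definition ad_inverse :: "'n::finite cmat \<Rightarrow> 'n cmat \<Rightarrow> 'n cmat" where
  "ad_inverse L A = (\<chi> i k. if i = k then 0 else A $ i $ k / (L $ k $ k - L $ i $ i))"

text \<open>
  A right inverse of the differential of the moment map on traceless matrices.  Only the factor with one
  chosen index \<open>j0\<close> moves: after conjugation with \<open>G\<close>, the off-diagonal part of \<open>s\<close> is produced by moving
  \<open>G\<close> and the diagonal part by moving \<open>L\<close>.
\<close>

definition moment_section :: "('N::finite, 'n::finite) point \<Rightarrow> 'n cmat \<Rightarrow> ('N, 'n) point" where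
  "moment_section x s = (let j0 = SOME j. True; s' = matrix_inv (Gmat j0 x) ** s ** Gmat j0 x in
     mk_point (\<lambda>j. if j = j0
         then Gmat j0 x ** ad_inverse (Lmat j0 x) s' else 0)
       (\<lambda>j. if j = j0 then traceless_diag s' else 0))"

lemma trace_nth_zero: "(\<And>a. A $ a $ a = 0) \<Longrightarrow> trace A = 0"
  by (simp add: trace_def)

lemma moment_section_TA0:
  assumes "x \<in> A0"
  shows "moment_section x s \<in> TA0 x"
  using assms by (auto simp: TA0_def moment_section_def Let_def matrix_inv_cancel trace_traceless_diag)
    (auto simp: traceless_diag_def ad_inverse_def intro!: trace_nth_zero)

lemma diag_mult_nth:
  fixes L A :: "'n::finite cmat"
  assumes "\<And>a b. a \<noteq> b \<Longrightarrow> L $ a $ b = 0"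
  shows "(L ** A) $ a $ b = L $ a $ a * A $ a $ b" "(A ** L) $ a $ b = A $ a $ b * L $ b $ b"
proof -
  have "(\<Sum>k\<in>UNIV. L $ a $ k * A $ k $ b) = (\<Sum>k\<in>{a}. L $ a $ k * A $ k $ b)"
    using assms by (intro sum.mono_neutral_right) auto
  then show "(L ** A) $ a $ b = L $ a $ a * A $ a $ b" by (simp add: matrix_matrix_mult_def)
  have "(\<Sum>k\<in>UNIV. A $ a $ k * L $ k $ b) = (\<Sum>k\<in>{b}. A $ a $ k * L $ k $ b)"
    using assms by (intro sum.mono_neutral_right) auto
  then show "(A ** L) $ a $ b = A $ a $ b * L $ b $ b" by (simp add: matrix_matrix_mult_def)
qed

lemma matrix_diff_distrib:
  fixes A B C :: "'n::finite cmat"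
  shows "A ** (B - C) = A ** B - A ** C" "(B - C) ** A = B ** A - C ** A"
  using matrix_add_ldistrib[of A B "- C"] matrix_add_rdistrib[of B "- C" A] by simp_all

text \<open>
  The trace is subtracted since the moment map is traceless; in this form the identity holds for all
  matrices \<open>s\<close>.
\<close>

lemma moment_deriv_moment_section:
  fixes x :: "('N::finite, 'n::finite) point"
  assumes x: "x \<in> A0"
  shows "moment_deriv x (moment_section x s) = s - mat (trace s / of_nat CARD('n))"
proof -
  define j0 :: 'N where "j0 = (SOME j. True)"
  define G where "G = Gmat j0 x"
  define L where "L = Lmat j0 x"
  define s' where "s' = matrix_inv G ** s ** G"
  define \<xi> where "\<xi> = ad_inverse L s'"
  have G: "det G \<noteq> 0" using x by (simp add: G_def)
  have moment_section: "Gmat j (moment_section x s) = (if j = j0 then G ** \<xi> else 0)"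
    "Lmat j (moment_section x s) = (if j = j0 then traceless_diag s' else 0)" for j
    unfolding moment_section_def Let_def by (simp_all add: j0_def G_def L_def s'_def \<xi>_def)
  have s: "s = G ** s' ** matrix_inv G"
    by (simp add: s'_def matrix_mul_assoc[symmetric] matrix_inv_cancel(1)[OF G] matrix_inv[OF G])
  have tr: "trace s = trace s'" by (subst s) (rule trace_conj[OF G])
  have "moment_deriv x (moment_section x s) = (\<Sum>j\<in>UNIV. if j = j0 then G ** \<xi> ** L ** matrix_inv G
     + G ** traceless_diag s' ** matrix_inv G - G ** L ** (matrix_inv G ** (G ** \<xi>) ** matrix_inv G) else 0)"
    unfolding moment_deriv_def by (intro sum.cong) (auto simp: moment_section G_def L_def)
  also have "\<dots> = G ** (\<xi> ** L + traceless_diag s' - L ** \<xi>) ** matrix_inv G"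
    by (simp add: matrix_inv_cancel[OF G] matrix_diff_distrib matrix_add_ldistrib matrix_add_rdistrib matrix_mul_assoc)
  also have "\<xi> ** L + traceless_diag s' - L ** \<xi> = s' - mat (trace s' / of_nat CARD('n))"
  proof -
    have off: "L $ a $ b = 0" if "a \<noteq> b" for a b using A0_offdiag[OF x that] by (simp add: L_def)
    have dis: "L $ a $ a \<noteq> L $ b $ b" if "a \<noteq> b" for a b using A0_distinct[OF x that] by (simp add: L_def)
    show ?thesis
      unfolding vec_eq_iff
    proof (intro allI)
      fix a b
      show "(\<xi> ** L + traceless_diag s' - L ** \<xi>) $ a $ b = (s' - mat (trace s' / of_nat CARD('n))) $ a $ b"
      proof (cases "a = b")
        case False
        then have "s' $ a $ b / (L $ b $ b - L $ a $ a) * (L $ b $ b - L $ a $ a) = s' $ a $ b"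
          using dis[of b a] by simp
        then show ?thesis using False
          by (simp add: diag_mult_nth[OF off] \<xi>_def ad_inverse_def traceless_diag_def mat_def right_diff_distrib diff_divide_distrib mult.commute)
      qed (simp add: diag_mult_nth[OF off] \<xi>_def ad_inverse_def traceless_diag_def mat_def)
    qed
  qed
  also have "G ** \<dots> ** matrix_inv G = s - mat (trace s / of_nat CARD('n))"
  proof -
    have "G ** mat c ** matrix_inv G = mat c" for c
      by (simp add: mat_commute[of c, symmetric] matrix_mul_assoc[symmetric] matrix_inv[OF G])
    then show ?thesis by (simp add: matrix_diff_distrib s[symmetric] tr)
  qed
  finally show ?thesis .
qed

lemma linear_moment_section: "linear (moment_section (x :: ('N::finite, 'n::finite) point))"
proof (rule linearI)
  have o: "ad_inverse L (A + B) = ad_inverse L A + ad_inverse L B" "ad_inverse L (r *\<^sub>R A) = r *\<^sub>R ad_inverse L A"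
    for L A B :: "'n cmat" and r
    by (simp_all add: ad_inverse_def vec_eq_iff add_divide_distrib divide_inverse distrib_right)
  note d = linear_add[OF bounded_linear.linear[OF bounded_linear_traceless_diag]]
    linear_cmul[OF bounded_linear.linear[OF bounded_linear_traceless_diag]]
  have m: "A ** (r *\<^sub>R B) = r *\<^sub>R (A ** B)" "(r *\<^sub>R A) ** B = r *\<^sub>R (A ** B)"
    for A B :: "'n cmat" and r
    by (simp_all add: matrix_scalar_ac scalar_matrix_assoc)
  show "moment_section x (s + t) = moment_section x s + moment_section x t" for s t
    by (intro point_eqI)
      (simp_all add: Gmat_linear Lmat_linear moment_section_def Let_def matrix_add_ldistrib matrix_add_rdistrib o d)
  show "moment_section x (r *\<^sub>R s) = r *\<^sub>R moment_section x s" for r s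
    by (intro point_eqI) (simp_all add: Gmat_linear Lmat_linear moment_section_def Let_def m o d)
qed

lemma isCont_retract_A0:
  assumes "\<And>j. det (Gmat j y) \<noteq> 0"
  shows "isCont retract_A0 y"
  unfolding isCont_def
proof (rule vec_tendstoI)
  fix i
  have 1: "((\<lambda>z. Gmat j z $ a $ b) \<longlongrightarrow> Gmat j y $ a $ b) (at y)" for j a b
    using cdiff_isCont[OF cdiff_Gmat_nth] by (simp add: isCont_def)
  have 2: "((\<lambda>z. det (Gmat j z)) \<longlongrightarrow> det (Gmat j y)) (at y)" for j
  proof -
    have "isCont (\<lambda>z. det (Gmat j z)) y"
      by (rule has_derivative_continuous[OF has_derivative_compose[OF has_derivative_Gmat has_derivative_det_general]])
    then show ?thesis by (simp add: isCont_def)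
  qed
  have 3: "((\<lambda>z. traceless_diag (Lmat j z) $ a $ b) \<longlongrightarrow> traceless_diag (Lmat j y) $ a $ b) (at y)" for j a b
  proof -
    have "isCont (\<lambda>z. traceless_diag (Lmat j z) $ a $ b) y"
      by (rule has_derivative_continuous[OF bounded_linear.has_derivative[OF bounded_linear_entry
          bounded_linear.has_derivative[OF bounded_linear_traceless_diag has_derivative_Lmat]]])
    then show ?thesis by (simp add: isCont_def)
  qed
  have 4: "((\<lambda>z. unimodularize (Gmat j z) $ a $ b) \<longlongrightarrow> unimodularize (Gmat j y) $ a $ b) (at y)" for j a b
    by (cases "a = (SOME i. True)")
      (simp_all add: unimodularize_def, auto intro!: tendsto_intros 1 2 assms)
  show "((\<lambda>z. retract_A0 z $ i) \<longlongrightarrow> retract_A0 y $ i) (at y)"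
    by (cases i) (auto simp: retract_A0_def mk_point_def intro: 3 4)
qed

lemma level_set_A0: "x \<in> level_set \<Longrightarrow> x \<in> A0"
  by (simp add: level_set_def)

lemma tangent_mono: "X \<subseteq> Y \<Longrightarrow> tangent X x \<subseteq> tangent Y x"
  unfolding tangent_def curve_at_def by (intro Collect_mono ex_mono) auto

text \<open>
  For a vector \<open>v\<close> in the kernel, the line through \<open>p\<close> in the direction \<open>v\<close> is corrected by the right inverse
  \<open>moment_section\<close> and retracted to \<open>A0\<close>; the size of the correction is determined by \<open>implicit_curve\<close>.
\<close>

lemma tangent_level_set:
  fixes p :: "('N::finite, 'n::finite) point"
  assumes p: "p \<in> level_set"
  shows "tangent level_set p = {v \<in> TA0 p. moment_deriv p v = 0}"
proof (intro antisym subsetI)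
  have pA: "p \<in> A0" using p by (rule level_set_A0)
  fix v assume v: "v \<in> tangent level_set p"
  have "v \<in> TA0 p"
    using tangent_mono[of level_set A0 p] v tangent_A0_subset[OF pA] by (auto simp: level_set_def)
  moreover obtain \<gamma> where \<gamma>: "curve_at level_set p v \<gamma>" using v unfolding tangent_def by blast
  have "moment_deriv p v = 0"
    by (rule const_along_curve[OF \<gamma> has_derivative_moment_map, of 0]) (simp_all add: pA level_set_def)
  ultimately show "v \<in> {v \<in> TA0 p. moment_deriv p v = 0}" by simp
next
  have pA: "p \<in> A0" using p by (rule level_set_A0)
  fix v assume "v \<in> {v \<in> TA0 p. moment_deriv p v = 0}"
  then have v: "v \<in> TA0 p" "moment_deriv p v = 0" by auto
  obtain D where D: "(retract_A0 has_derivative D) (at p)" "\<And>v. v \<in> TA0 p \<Longrightarrow> D v = v"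
    using has_derivative_retract_A0[OF pA] by blast
  define A :: "'n cmat \<times> real \<Rightarrow> ('N, 'n) point" where "A z = p + (snd z *\<^sub>R v + moment_section p (fst z))" for z
  \<comment> \<open>the trace term makes the derivative in \<open>s\<close> invertible on all matrices; it is zero at solutions,
    because the moment map is traceless\<close>
  define f :: "'n cmat \<times> real \<Rightarrow> 'n cmat"
    where "f z = moment_map (retract_A0 (A z)) + mat (trace (fst z) / of_nat CARD('n))" for z
  have blsec: "bounded_linear (moment_section p)" using linear_moment_section linear_conv_bounded_linear by blast
  have "linear (\<lambda>s :: 'n cmat. mat (trace s / of_nat CARD('n)) :: 'n cmat)"
    by (rule linearI) (simp_all add: mat_def vec_eq_iff trace_add trace_scaleR add_divide_distrib divide_inverse distrib_right)
  then have bltr: "bounded_linear (\<lambda>s :: 'n cmat. mat (trace s / of_nat CARD('n)) :: 'n cmat)"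
    by (simp add: linear_conv_bounded_linear)
  have s0: "moment_section p 0 = 0" by (rule linear_0[OF linear_moment_section])
  have A0: "A (0, 0) = p" by (simp add: A_def s0)
  have derA: "(A has_derivative (\<lambda>z. snd z *\<^sub>R v + moment_section p (fst z))) (at z)" for z
    unfolding A_def
    by (auto intro!: derivative_eq_intros bounded_linear.has_derivative[OF blsec])
  have inT: "t *\<^sub>R v + moment_section p s \<in> TA0 p" for t s
    by (intro TA0_add TA0_scaleR v moment_section_TA0 pA)
  have dmu_lin: "moment_deriv p (t *\<^sub>R v + w) = moment_deriv p w" for t w
    using has_derivative_linear[OF has_derivative_moment_map[of p]] pA v(2)
    by (simp add: linear_add linear_cmul)
  have "((\<lambda>z. retract_A0 (A z)) has_derivative (\<lambda>z. D (snd z *\<^sub>R v + moment_section p (fst z)))) (at (0, 0))"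
    by (rule has_derivative_compose[OF derA]) (simp add: A0 D)
  then have "((\<lambda>z. retract_A0 (A z)) has_derivative (\<lambda>z. snd z *\<^sub>R v + moment_section p (fst z))) (at (0, 0))"
    by (simp add: D(2)[OF inT])
  from has_derivative_compose[OF this, of moment_map "moment_deriv p"]
  have "((\<lambda>z. moment_map (retract_A0 (A z))) has_derivative (\<lambda>z. moment_deriv p (snd z *\<^sub>R v + moment_section p (fst z)))) (at (0, 0))"
    by (simp add: A0 retract_A0_fixes pA has_derivative_moment_map)
  from has_derivative_add[OF this bounded_linear.has_derivative[OF bltr has_derivative_fst[OF has_derivative_ident]]]
  have der: "(f has_derivative fst) (at (0, 0))"
    unfolding f_def by (simp add: dmu_lin moment_deriv_moment_section[OF pA])
  have f0: "f (0, 0) = 0" using p by (simp add: f_def A0 retract_A0_fixes pA level_set_def)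
  have contA: "isCont A z" for z by (rule has_derivative_continuous[OF derA])
  have "\<forall>\<^sub>F y in nhds p. retract_A0 y \<in> A0 \<and> (\<forall>j. det (Gmat j y) \<noteq> 0)"
    by (intro eventually_conj eventually_retract_A0 pA eventually_all_finite eventually_Gmat_invertible) (simp add: pA)
  then have "\<forall>\<^sub>F z in nhds (0, 0). retract_A0 (A z) \<in> A0 \<and> (\<forall>j. det (Gmat j (A z)) \<noteq> 0)"
    by (rule eventually_compose_filterlim) (use isCont_filterlim_nhds[OF contA, of "(0, 0)"] A0 in simp)
  then have cont: "\<forall>\<^sub>F z in nhds (0, 0). isCont f z"
  proof (rule eventually_mono)
    fix z assume z: "retract_A0 (A z) \<in> A0 \<and> (\<forall>j. det (Gmat j (A z)) \<noteq> 0)"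
    have "isCont (\<lambda>z. retract_A0 (A z)) z"
      by (rule isCont_o2[OF contA isCont_retract_A0]) (use z in simp)
    moreover have "isCont moment_map (retract_A0 (A z))"
      by (rule has_derivative_continuous[OF has_derivative_moment_map]) (use z in simp)
    ultimately have "isCont (\<lambda>z. moment_map (retract_A0 (A z))) z" by (rule isCont_o2)
    moreover have "isCont (\<lambda>z :: 'n cmat \<times> real. mat (trace (fst z) / of_nat CARD('n)) :: 'n cmat) z"
      by (rule has_derivative_continuous[OF bounded_linear.has_derivative[OF bltr has_derivative_fst[OF has_derivative_ident]]])
    ultimately show "isCont f z" unfolding f_def by (rule isCont_add)
  qed
  obtain \<sigma> where \<sigma>: "\<sigma> 0 = 0" "(\<sigma> has_vector_derivative 0) (at 0)" "\<forall>\<^sub>F t in nhds 0. f (\<sigma> t, t) = 0"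
    by (rule implicit_curve[OF der f0 cont])
  define \<gamma> where "\<gamma> t = p + (t *\<^sub>R v + moment_section p (\<sigma> t))" for t
  have "((\<lambda>t. moment_section p (\<sigma> t)) has_vector_derivative moment_section p 0) (at 0)"
    by (rule bounded_linear.has_vector_derivative[OF blsec \<sigma>(2)])
  then have "(\<gamma> has_vector_derivative (1 *\<^sub>R v + moment_section p 0)) (at 0)"
    unfolding \<gamma>_def by (auto intro!: derivative_eq_intros)
  then have \<gamma>: "(\<gamma> has_vector_derivative v) (at 0)" by (simp add: s0)
  have \<gamma>0: "\<gamma> 0 = p" by (simp add: \<gamma>_def \<sigma>(1) s0)
  have "((\<lambda>t. retract_A0 (\<gamma> t)) has_vector_derivative D v) (at 0)"
    by (rule has_vector_derivative_compose[OF \<gamma>]) (simp add: \<gamma>0 D)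
  moreover have "isCont \<gamma> 0"
    by (rule has_derivative_continuous[OF \<gamma>[unfolded has_vector_derivative_def]])
  from isCont_filterlim_nhds[OF this] have "\<forall>\<^sub>F t in nhds 0. retract_A0 (\<gamma> t) \<in> A0"
    by (intro eventually_compose_filterlim[OF eventually_retract_A0[OF pA]]) (simp add: \<gamma>0)
  with \<sigma>(3) have "\<forall>\<^sub>F t in nhds 0. retract_A0 (\<gamma> t) \<in> level_set"
  proof eventually_elim
    case (elim t)
    have mm: "moment_map (retract_A0 (\<gamma> t)) = - mat (trace (\<sigma> t) / of_nat CARD('n))"
      using elim(1) by (simp add: f_def A_def \<gamma>_def add_eq_0_iff2)
    have "trace (moment_map (retract_A0 (\<gamma> t))) = 0" by (rule trace_moment_map[OF elim(2)])
    then have "trace (\<sigma> t) = 0" unfolding mm by (simp add: trace_def mat_def sum_negf)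
    then show ?case using mm elim(2) by (simp add: level_set_def mat_0)
  qed
  ultimately show "v \<in> tangent level_set p"
    by (intro tangentI_eventually[of p _ "\<lambda>t. retract_A0 (\<gamma> t)"]) (simp_all add: p \<gamma>0 retract_A0_fixes pA D(2)[OF v(1)])
qed

section \<open>The exterior derivative of the potential\<close>

text \<open>
  The logarithmic derivative \<open>G\<^sub>j\<^sup>-\<^sup>1 dG\<^sub>j\<close> evaluated at \<open>v\<close>.
\<close>

definition left_triv :: "'N \<Rightarrow> ('N::finite, 'n::finite) point \<Rightarrow> ('N, 'n) point \<Rightarrow> 'n cmat" where
  "left_triv j x v = matrix_inv (Gmat j x) ** Gmat j v"

text \<open>
  The exterior derivative of \<open>theta_A\<close> in the left trivialization (see \<open>ext_d1_theta_A\<close>).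
\<close>

definition omega :: "('N::finite, 'n::finite) point \<Rightarrow> ('N, 'n) point \<Rightarrow> ('N, 'n) point \<Rightarrow> complex" where
  "omega x u w = (\<Sum>j\<in>UNIV. trace (Lmat j u ** left_triv j x w) - trace (Lmat j w ** left_triv j x u)
     - trace (Lmat j x ** (left_triv j x u ** left_triv j x w - left_triv j x w ** left_triv j x u)))"

lemma left_triv_linear: "left_triv j x (c *s u + v) = mat c ** left_triv j x u + left_triv j x v"
  by (simp add: left_triv_def Gmat_linear matrix_add_ldistrib) (metis mat_commute matrix_mul_assoc)

lemma trace_uminus [simp]: "trace (- A :: 'n::finite cmat) = - trace A"
  by (simp add: trace_def sum_negf)

lemma omega_skew: "omega x u w = - omega x w u"
  unfolding omega_def sum_negf[symmetric]
  by (intro sum.cong refl) (simp add: matrix_diff_distrib trace_sub)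

lemma mat_mult_right: "A ** (mat c ** B) = mat c ** (A ** B :: 'n::finite cmat)"
  by (metis mat_commute matrix_mul_assoc)

lemma omega_linear: "omega x (c *s u + v) w = c * omega x u w + omega x v w"
  unfolding omega_def sum_distrib_left sum.distrib[symmetric]
  by (intro sum.cong refl)
    (simp only: left_triv_linear Lmat_linear matrix_add_ldistrib matrix_add_rdistrib matrix_diff_distrib
      trace_add trace_sub trace_mat_mult mat_mult_right matrix_mul_assoc[symmetric], simp add: algebra_simps)

lemma omega_sum: "omega x (\<Sum>i\<in>I. c i *s u i) w = (\<Sum>i\<in>I. c i * omega x (u i) w)"
proof (induction I rule: infinite_finite_induct)
  case empty
  show ?case using omega_linear[of x 1 0 0 w] by simp
next
  case (infinite A)
  then show ?case using omega_linear[of x 1 0 0 w] by simp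
qed (simp add: omega_linear)

lemma has_derivative_left_triv:
  assumes "det (Gmat j x) \<noteq> 0"
  shows "((\<lambda>y. left_triv j y v) has_derivative (\<lambda>u. - (left_triv j x u ** left_triv j x v))) (at x)"
proof -
  have "((\<lambda>y. left_triv j y v) has_derivative (\<lambda>u. matrix_inv (Gmat j x) ** 0 +
      - (matrix_inv (Gmat j x) ** Gmat j u ** matrix_inv (Gmat j x)) ** Gmat j v)) (at x)"
    unfolding left_triv_def
    by (intro has_derivative_matrix_mult has_derivative_inv_Gmat assms has_derivative_const)
  then show ?thesis by (simp add: left_triv_def matrix_mul_assoc)
qed

lemma theta_A_left_triv: "theta_A x v = (\<Sum>j\<in>UNIV. trace (Lmat j x ** left_triv j x v))"
  by (simp add: theta_A_def left_triv_def matrix_mul_assoc)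

lemma ext_d1_theta_A:
  assumes "\<And>j. det (Gmat j x) \<noteq> 0"
  shows "ext_d1 theta_A x u v = omega x u v"
proof -
  have "((\<lambda>y. theta_A y v) has_derivative (\<lambda>u. \<Sum>j\<in>UNIV.
      trace (Lmat j x ** - (left_triv j x u ** left_triv j x v) + Lmat j u ** left_triv j x v))) (at x)" for v
    unfolding theta_A_left_triv
    by (intro has_derivative_sum has_derivative_trace has_derivative_matrix_mult has_derivative_left_triv
        has_derivative_Lmat assms)
  from frechet_derivative_at[OF this]
  have "frechet_derivative (\<lambda>y. theta_A y v) (at x) = (\<lambda>u. \<Sum>j\<in>UNIV.
      trace (Lmat j x ** - (left_triv j x u ** left_triv j x v) + Lmat j u ** left_triv j x v))" for v by simp
  note fd = this
  show ?thesis
    unfolding ext_d1_def omega_def fd sum_subtractf[symmetric]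
    by (intro sum.cong refl) (simp add: trace_add trace_sub matrix_diff_distrib)
qed

lemma has_derivative_omega:
  assumes "\<And>j. det (Gmat j x) \<noteq> 0"
  shows "((\<lambda>y. omega y v w) has_derivative (\<lambda>u. \<Sum>j\<in>UNIV.
     trace (Lmat j v ** - (left_triv j x u ** left_triv j x w)) - trace (Lmat j w ** - (left_triv j x u ** left_triv j x v))
     - trace (Lmat j x ** (left_triv j x v ** - (left_triv j x u ** left_triv j x w) + - (left_triv j x u ** left_triv j x v) ** left_triv j x w
          - (left_triv j x w ** - (left_triv j x u ** left_triv j x v) + - (left_triv j x u ** left_triv j x w) ** left_triv j x v))
        + Lmat j u ** (left_triv j x v ** left_triv j x w - left_triv j x w ** left_triv j x v)))) (at x)"
proof -
  have c: "((\<lambda>y. Lmat j v ** left_triv j y w) has_derivative (\<lambda>u. Lmat j v ** - (left_triv j x u ** left_triv j x w))) (at x)" for j v w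
    using has_derivative_matrix_mult[OF has_derivative_const[of "Lmat j v"] has_derivative_left_triv[OF assms, of j w]]
    by simp
  show ?thesis
    unfolding omega_def
    by (intro has_derivative_sum has_derivative_trace has_derivative_diff has_derivative_matrix_mult
        has_derivative_left_triv has_derivative_Lmat assms c)
qed

text \<open>
  Expanding the derivatives, all traces of products cancel in pairs.
\<close>

lemma ext_d2_ext_d1_theta_A:
  fixes x :: "('N::finite, 'n::finite) point"
  assumes x: "\<And>j. det (Gmat j x) \<noteq> 0"
  shows "ext_d2 (ext_d1 theta_A) x u v w = 0"
proof -
  have ev: "\<forall>\<^sub>F y in nhds x. omega y v w = ext_d1 theta_A y v w" for v w
  proof -
    have "\<forall>\<^sub>F y in nhds x. \<forall>j. det (Gmat j y) \<noteq> 0"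
      by (intro eventually_all_finite eventually_Gmat_invertible x)
    then show ?thesis by (rule eventually_mono) (simp add: ext_d1_theta_A)
  qed
  have fd: "frechet_derivative (\<lambda>y. ext_d1 theta_A y v w) (at x) = (\<lambda>u. \<Sum>j\<in>UNIV.
     trace (Lmat j v ** - (left_triv j x u ** left_triv j x w)) - trace (Lmat j w ** - (left_triv j x u ** left_triv j x v))
     - trace (Lmat j x ** (left_triv j x v ** - (left_triv j x u ** left_triv j x w) + - (left_triv j x u ** left_triv j x v) ** left_triv j x w
          - (left_triv j x w ** - (left_triv j x u ** left_triv j x v) + - (left_triv j x u ** left_triv j x w) ** left_triv j x v))
        + Lmat j u ** (left_triv j x v ** left_triv j x w - left_triv j x w ** left_triv j x v)))" for v w
    by (rule frechet_derivative_at[OF has_derivative_transform_nhds[OF has_derivative_omega[OF x] ev], symmetric])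
  show ?thesis
    unfolding ext_d2_def fd sum.distrib[symmetric]
    by (intro sum.neutral ballI)
      (simp add: trace_add trace_sub matrix_diff_distrib matrix_add_ldistrib matrix_add_rdistrib
        matrix_mul_assoc algebra_simps)
qed

section \<open>Hamiltonian vectors of the coordinates\<close>

text \<open>
  The prescribed brackets of the coordinates \<open>i\<close> and \<open>k\<close> as functions on the ambient space: the entries of
  \<open>- G G r\<close> and \<open>- G \<Omega>\<close>.  Off-diagonal entries of the \<open>L\<^sub>j\<close> have zero brackets.
\<close>

definition poisson_entry :: "('N::finite \<times> 'n::finite \<times> 'n) + ('N \<times> 'n \<times> 'n) \<Rightarrow>
    ('N \<times> 'n \<times> 'n) + ('N \<times> 'n \<times> 'n) \<Rightarrow> ('N, 'n) point \<Rightarrow> complex" where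
  "poisson_entry i k y = (case i of
     Inl (j, a, b) \<Rightarrow> (case k of
        Inl (j', c, d) \<Rightarrow> if j = j' \<and> b \<noteq> d
          then Gmat j y $ c $ b * Gmat j y $ a $ d / (Lmat j y $ b $ b - Lmat j y $ d $ d) else 0
      | Inr (j', c, d) \<Rightarrow> if j = j' \<and> c = d
          then - (Gmat j y $ a $ b * ((if b = c then 1 else 0) - 1 / of_nat CARD('n))) else 0)
   | Inr (j, a, b) \<Rightarrow> (case k of
        Inl (j', c, d) \<Rightarrow> if j = j' \<and> a = b
          then Gmat j y $ c $ d * ((if d = a then 1 else 0) - 1 / of_nat CARD('n)) else 0
      | Inr _ \<Rightarrow> 0))"

definition coord_ham :: "('N::finite \<times> 'n::finite \<times> 'n) + ('N \<times> 'n \<times> 'n) \<Rightarrow> ('N, 'n) point \<Rightarrow> ('N, 'n) point"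
  where "coord_ham i y = (\<chi> k. poisson_entry i k y)"

lemma coord_ham_nth [simp]: "coord_ham i y $ k = poisson_entry i k y"
  by (simp add: coord_ham_def)

text \<open>
  The logarithmic derivative along the Hamiltonian vector of the coordinate \<open>i\<close> (see
  \<open>left_triv_coord_ham\<close>).
\<close>

definition coord_ham_triv :: "('N::finite \<times> 'n::finite \<times> 'n) + ('N \<times> 'n \<times> 'n) \<Rightarrow> 'N \<Rightarrow> ('N, 'n) point \<Rightarrow> 'n cmat" where
  "coord_ham_triv i j' y = (case i of
     Inl (j, a, b) \<Rightarrow> (\<chi> k d. if j = j' \<and> k = b \<and> d \<noteq> b
        then Gmat j y $ a $ d / (Lmat j y $ b $ b - Lmat j y $ d $ d) else 0)
   | Inr (j, a, b) \<Rightarrow> (\<chi> k d. if j = j' \<and> a = b \<and> k = d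
        then (if d = a then 1 else 0) - 1 / of_nat CARD('n) else 0))"

lemma Gmat_coord_ham: "Gmat j' (coord_ham i y) = Gmat j' y ** coord_ham_triv i j' y"
proof -
  have "poisson_entry i (Inl (j', c, d)) y = (\<Sum>k\<in>UNIV. Gmat j' y $ c $ k * coord_ham_triv i j' y $ k $ d)" for c d
  proof (cases i)
    case (Inl q)
    obtain j a b where q: "q = (j, a, b)" by (cases q)
    have "(\<Sum>k\<in>UNIV. Gmat j' y $ c $ k * coord_ham_triv i j' y $ k $ d) = (\<Sum>k\<in>{b}. Gmat j' y $ c $ k * coord_ham_triv i j' y $ k $ d)"
      by (rule sum.mono_neutral_right) (auto simp: Inl q coord_ham_triv_def)
    then show ?thesis by (auto simp: Inl q coord_ham_triv_def poisson_entry_def)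
  next
    case (Inr q)
    obtain j a b where q: "q = (j, a, b)" by (cases q)
    have "(\<Sum>k\<in>UNIV. Gmat j' y $ c $ k * coord_ham_triv i j' y $ k $ d) = (\<Sum>k\<in>{d}. Gmat j' y $ c $ k * coord_ham_triv i j' y $ k $ d)"
      by (rule sum.mono_neutral_right) (auto simp: Inr q coord_ham_triv_def)
    then show ?thesis by (auto simp: Inr q coord_ham_triv_def poisson_entry_def)
  qed
  then show ?thesis by (simp add: vec_eq_iff Gmat_nth[of _ "coord_ham _ _"] matrix_matrix_mult_def)
qed

lemma Lmat_coord_ham: "Lmat j' (coord_ham i y) = (case i of
     Inl (j, a, b) \<Rightarrow> (\<chi> c d. if j = j' \<and> c = d
          then - (Gmat j y $ a $ b * ((if b = c then 1 else 0) - 1 / of_nat CARD('n))) else 0)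
   | Inr _ \<Rightarrow> (0 :: 'n::finite cmat))"
  by (auto simp: vec_eq_iff Lmat_nth poisson_entry_def split: sum.splits)

lemma left_triv_coord_ham: "x \<in> A0 \<Longrightarrow> left_triv j (x) (coord_ham i x) = coord_ham_triv i j x"
  by (simp add: left_triv_def Gmat_coord_ham matrix_inv_cancel)

lemma coord_ham_TA0:
  fixes x :: "('N::finite, 'n::finite) point"
  assumes x: "x \<in> A0"
  shows "coord_ham i x \<in> TA0 x"
proof -
  have "trace (coord_ham_triv i j' x) = 0" for j'
  proof (cases i)
    case (Inl q) then show ?thesis
      by (cases q) (auto simp: coord_ham_triv_def intro!: trace_nth_zero)
  next
    case (Inr q)
    obtain j a b where "q = (j, a, b)" by (cases q)
    then show ?thesis
      by (cases "j = j'"; cases "a = b") (simp_all add: Inr coord_ham_triv_def trace_def sum_subtractf)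
  qed
  moreover have "trace (Lmat j' (coord_ham i x)) = 0" for j'
  proof (cases i)
    case (Inl q)
    obtain j a b where "q = (j, a, b)" by (cases q)
    then show ?thesis
      by (cases "j = j'")
        (simp_all add: Inl Lmat_coord_ham trace_def sum_negf sum_subtractf sum_distrib_left[symmetric])
  qed (simp add: Lmat_coord_ham)
  moreover have "Lmat j' (coord_ham i x) $ a $ b = 0" if "a \<noteq> b" for j' a b
    using that by (auto simp: Lmat_coord_ham split: sum.splits)
  ultimately show ?thesis
    by (simp add: TA0_def left_triv_coord_ham[OF x, unfolded left_triv_def])
qed

text \<open>
  The commutator with a diagonal matrix multiplies the entries by differences of eigenvalues.
\<close>

lemma trace_diag_commutator:
  fixes L A B :: "'n::finite cmat"
  assumes "\<And>a b. a \<noteq> b \<Longrightarrow> L $ a $ b = 0"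
  shows "trace (L ** (A ** B - B ** A)) = (\<Sum>k\<in>UNIV. \<Sum>d\<in>UNIV. (L $ k $ k - L $ d $ d) * A $ k $ d * B $ d $ k)"
proof -
  have "trace (L ** (A ** B - B ** A)) = (\<Sum>k\<in>UNIV. \<Sum>d\<in>UNIV. L $ k $ k * A $ k $ d * B $ d $ k)
      - (\<Sum>k\<in>UNIV. \<Sum>d\<in>UNIV. L $ k $ k * B $ k $ d * A $ d $ k)"
    by (simp add: trace_def diag_mult_nth[OF assms] matrix_matrix_mult_def[of A] matrix_matrix_mult_def[of B]
        right_diff_distrib sum_subtractf sum_distrib_left mult.assoc)
  also have "(\<Sum>k\<in>UNIV. \<Sum>d\<in>UNIV. L $ k $ k * B $ k $ d * A $ d $ k)
     = (\<Sum>k\<in>UNIV. \<Sum>d\<in>UNIV. L $ d $ d * A $ k $ d * B $ d $ k)"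
    by (subst sum.swap) (simp add: mult_ac)
  finally show ?thesis by (simp add: sum_subtractf left_diff_distrib)
qed

lemma trace_diag_mult:
  fixes L A :: "'n::finite cmat"
  assumes "\<And>a b. a \<noteq> b \<Longrightarrow> L $ a $ b = 0"
  shows "trace (L ** A) = (\<Sum>k\<in>UNIV. L $ k $ k * A $ k $ k)"
  by (simp add: trace_def diag_mult_nth[OF assms])

text \<open>
  The prescribed brackets are the brackets of the form \<open>omega\<close>: by the differences of eigenvalues in
  \<open>trace_diag_commutator\<close> the denominators of \<open>r\<close> cancel, and the missing diagonal term is the one that
  \<open>\<Omega>\<close> contributes.
\<close>

lemma omega_coord_ham:
  fixes x :: "('N::finite, 'n::finite) point"
  assumes x: "x \<in> A0" and w: "w \<in> TA0 x"
  shows "omega x (coord_ham i x) w = - w $ i"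
proof -
  have trxi: "(\<Sum>k\<in>UNIV. left_triv j x w $ k $ k) = 0" for j
    using w by (simp add: TA0_def left_triv_def trace_def)
  have trL: "(\<Sum>k\<in>UNIV. Lmat j w $ k $ k) = 0" for j
    using w by (simp add: TA0_def trace_def)
  have Lw: "Lmat j w $ a $ b = 0" if "a \<noteq> b" for j a b
    using w that by (simp add: TA0_def)
  have Gw: "Gmat j w = Gmat j x ** left_triv j x w" for j
    by (simp add: left_triv_def matrix_inv_cancel x)
  have Lh: "Lmat j (coord_ham i x) $ a $ b = 0" if "a \<noteq> b" for j a b
    using coord_ham_TA0[OF x, of i] that by (simp add: TA0_def)
  have omega: "omega x (coord_ham i x) w = (\<Sum>j\<in>UNIV. (\<Sum>k\<in>UNIV. Lmat j (coord_ham i x) $ k $ k * left_triv j x w $ k $ k)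
      - (\<Sum>k\<in>UNIV. Lmat j w $ k $ k * coord_ham_triv i j x $ k $ k)
      - (\<Sum>k\<in>UNIV. \<Sum>d\<in>UNIV. (Lmat j x $ k $ k - Lmat j x $ d $ d) * coord_ham_triv i j x $ k $ d * left_triv j x w $ d $ k))"
    unfolding omega_def left_triv_coord_ham[OF x]
    by (intro sum.cong refl arg_cong2[where f = "(-)"] trace_diag_mult trace_diag_commutator Lh Lw
        A0_offdiag x)
  show ?thesis
  proof (cases i)
    case (Inl q)
    obtain j0 a b where q: "q = (j0, a, b)" by (cases q)
    let ?S = "\<lambda>j. (\<Sum>k\<in>UNIV. Lmat j (coord_ham i x) $ k $ k * left_triv j x w $ k $ k)
      - (\<Sum>k\<in>UNIV. Lmat j w $ k $ k * coord_ham_triv i j x $ k $ k)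
      - (\<Sum>k\<in>UNIV. \<Sum>d\<in>UNIV. (Lmat j x $ k $ k - Lmat j x $ d $ d) * coord_ham_triv i j x $ k $ d * left_triv j x w $ d $ k)"
    have "(\<Sum>j\<in>UNIV. ?S j) = (\<Sum>j\<in>{j0}. ?S j)"
      by (rule sum.mono_neutral_right) (auto simp: Inl q Lmat_coord_ham coord_ham_triv_def)
    also have "\<dots> = ?S j0" by simp
    also have "(\<Sum>k\<in>UNIV. Lmat j0 w $ k $ k * coord_ham_triv i j0 x $ k $ k) = 0"
      by (rule sum.neutral) (simp add: Inl q coord_ham_triv_def)
    also have "(\<Sum>k\<in>UNIV. Lmat j0 (coord_ham i x) $ k $ k * left_triv j0 x w $ k $ k)
        = - (Gmat j0 x $ a $ b * left_triv j0 x w $ b $ b)"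
    proof -
      have "(\<Sum>k\<in>UNIV. Lmat j0 (coord_ham i x) $ k $ k * left_triv j0 x w $ k $ k)
         = (\<Sum>k\<in>UNIV. (if b = k then - (Gmat j0 x $ a $ b * left_triv j0 x w $ k $ k) else 0)
           + Gmat j0 x $ a $ b / of_nat CARD('n) * left_triv j0 x w $ k $ k)"
        by (intro sum.cong refl) (simp add: Inl q Lmat_coord_ham algebra_simps)
      also have "\<dots> = - (Gmat j0 x $ a $ b * left_triv j0 x w $ b $ b)"
        unfolding sum.distrib sum_distrib_left[symmetric] by (simp add: trxi)
      finally show ?thesis .
    qed
    also have "(\<Sum>k\<in>UNIV. \<Sum>d\<in>UNIV. (Lmat j0 x $ k $ k - Lmat j0 x $ d $ d) * coord_ham_triv i j0 x $ k $ d * left_triv j0 x w $ d $ k)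
       = (\<Sum>k\<in>{b}. \<Sum>d\<in>UNIV. (Lmat j0 x $ k $ k - Lmat j0 x $ d $ d) * coord_ham_triv i j0 x $ k $ d * left_triv j0 x w $ d $ k)"
      by (rule sum.mono_neutral_right) (auto simp: Inl q coord_ham_triv_def)
    also have "\<dots> = (\<Sum>d\<in>UNIV. if d = b then 0 else Gmat j0 x $ a $ d * left_triv j0 x w $ d $ b)"
      using A0_distinct[OF x] by (auto intro!: sum.cong simp: Inl q coord_ham_triv_def)
    also have "\<dots> = (\<Sum>d\<in>UNIV. Gmat j0 x $ a $ d * left_triv j0 x w $ d $ b) - Gmat j0 x $ a $ b * left_triv j0 x w $ b $ b"
      by (simp add: sum.remove[of UNIV b])
    also have "(\<Sum>d\<in>UNIV. Gmat j0 x $ a $ d * left_triv j0 x w $ d $ b) = Gmat j0 w $ a $ b"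
      by (simp add: Gw matrix_matrix_mult_def)
    finally show ?thesis unfolding omega by (simp add: Inl q Gmat_nth)
  next
    case (Inr q)
    obtain j0 a b where q: "q = (j0, a, b)" by (cases q)
    let ?S = "\<lambda>j. \<Sum>k\<in>UNIV. Lmat j w $ k $ k * coord_ham_triv i j x $ k $ k"
    have c0: "(\<Sum>k\<in>UNIV. \<Sum>d\<in>UNIV. (Lmat j x $ k $ k - Lmat j x $ d $ d) * coord_ham_triv i j x $ k $ d * left_triv j x w $ d $ k) = 0" for j
      by (intro sum.neutral ballI) (simp add: Inr q coord_ham_triv_def)
    have "omega x (coord_ham i x) w = - (\<Sum>j\<in>UNIV. ?S j)"
      unfolding omega c0 by (simp add: Inr Lmat_coord_ham sum_negf)
    also have "(\<Sum>j\<in>UNIV. ?S j) = (\<Sum>j\<in>{j0}. ?S j)"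
      by (rule sum.mono_neutral_right) (auto simp: Inr q coord_ham_triv_def)
    also have "\<dots> = Lmat j0 w $ a $ b"
    proof (cases "a = b")
      case True
      have "?S j0 = (\<Sum>k\<in>UNIV. (if k = a then Lmat j0 w $ k $ k else 0)
           - Lmat j0 w $ k $ k / of_nat CARD('n))"
        by (intro sum.cong refl) (simp add: Inr q coord_ham_triv_def True algebra_simps)
      also have "\<dots> = Lmat j0 w $ a $ a"
        unfolding sum_subtractf sum_divide_distrib[symmetric] by (simp add: trL)
      finally show ?thesis using True by simp
    next
      case False
      then show ?thesis by (simp add: Lw Inr q coord_ham_triv_def)
    qed
    finally show ?thesis by (simp add: Inr q Lmat_nth)
  qed
qed

text \<open>
  Evaluating the form at the Hamiltonian vector of a coordinate recovers this coordinate.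
\<close>

lemma omega_nondegenerate:
  assumes x: "x \<in> A0" and u: "u \<in> TA0 x" and v: "v \<in> TA0 x"
    and eq: "\<And>w. w \<in> TA0 x \<Longrightarrow> omega x u w = omega x v w"
  shows "u = v"
proof -
  have "u $ i = v $ i" for i
    using eq[OF coord_ham_TA0[OF x, of i]] omega_skew[of x u] omega_skew[of x v] omega_coord_ham[OF x u, of i] omega_coord_ham[OF x v, of i]
    by simp
  then show ?thesis by (simp add: vec_eq_iff)
qed

section \<open>Differentials and Hamiltonian vectors\<close>

text \<open>
  The derivative of \<open>f\<close> along a curve in \<open>X\<close> is the derivative of any ambient extension, and so it depends only
  on the velocity of the curve.
\<close>

lemma extension_along_curve:
  assumes F: "holo F x" "\<forall>\<^sub>F y in nhds x. y \<in> X \<longrightarrow> F y = f y" and \<gamma>: "curve_at X x v \<gamma>"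
  shows "((\<lambda>t. f (\<gamma> t)) has_vector_derivative (\<Sum>i\<in>UNIV. v $ i * partial F i x)) (at 0)"
proof -
  have \<gamma>': "(\<gamma> has_vector_derivative v) (at 0)" "\<gamma> 0 = x" "\<And>t. \<gamma> t \<in> X"
    using \<gamma> by (auto simp: curve_at_def)
  have "((\<lambda>t. F (\<gamma> t)) has_vector_derivative (\<Sum>i\<in>UNIV. v $ i * partial F i x)) (at 0)"
    by (rule has_vector_derivative_compose[OF \<gamma>'(1)])
      (unfold \<gamma>'(2), rule cdiff_has_derivative[OF holo_imp_cdiff[OF F(1)]])
  moreover have "isCont \<gamma> 0"
    by (rule has_derivative_continuous[OF \<gamma>'(1)[unfolded has_vector_derivative_def]])
  from eventually_compose_filterlim[OF F(2) isCont_filterlim_nhds[OF this, unfolded \<gamma>'(2)]]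
  have "\<forall>\<^sub>F t in nhds 0. F (\<gamma> t) = f (\<gamma> t)"
    by (rule eventually_mono) (use \<gamma>'(3) in blast)
  ultimately show ?thesis
    unfolding has_vector_derivative_def by (rule has_derivative_transform_nhds)
qed

lemma hol_at_curve:
  assumes f: "hol_at X f x"
  obtains d where "\<And>\<gamma>. curve_at X x v \<gamma> \<Longrightarrow> ((\<lambda>t. f (\<gamma> t)) has_vector_derivative d) (at 0)"
proof -
  obtain F where F: "holo F x" "\<forall>\<^sub>F y in nhds x. y \<in> X \<longrightarrow> F y = f y"
    using f unfolding hol_at_iff by blast
  from that[OF extension_along_curve[OF F]] show ?thesis .
qed

lemma differential_unique:
  assumes f: "hol_at X f x" and \<gamma>: "curve_at X x v \<gamma>"
    and d: "((\<lambda>t. f (\<gamma> t)) has_vector_derivative d) (at 0)"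
  shows "differential X f x v = d"
proof -
  obtain d' where d': "\<And>\<gamma>. curve_at X x v \<gamma> \<Longrightarrow> ((\<lambda>t. f (\<gamma> t)) has_vector_derivative d') (at 0)"
    using hol_at_curve[OF f, of v] by blast
  have dd: "d' = d" by (rule vector_derivative_unique_at[OF d'[OF \<gamma>] d])
  show ?thesis
    unfolding differential_def
  proof (rule the_equality)
    show "\<forall>\<gamma>. curve_at X x v \<gamma> \<longrightarrow> ((\<lambda>t. f (\<gamma> t)) has_vector_derivative d) (at 0)"
      using d' unfolding dd by (intro allI impI)
    show "e = d" if "\<forall>\<gamma>. curve_at X x v \<gamma> \<longrightarrow> ((\<lambda>t. f (\<gamma> t)) has_vector_derivative e) (at 0)" for e
      by (rule vector_derivative_unique_at[OF that[rule_format, OF \<gamma>] d])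
  qed
qed

lemma differential_curve:
  assumes f: "hol_at X f x" and \<gamma>: "curve_at X x v \<gamma>"
  shows "((\<lambda>t. f (\<gamma> t)) has_vector_derivative differential X f x v) (at 0)"
proof -
  obtain d where d: "\<And>\<gamma>. curve_at X x v \<gamma> \<Longrightarrow> ((\<lambda>t. f (\<gamma> t)) has_vector_derivative d) (at 0)"
    using hol_at_curve[OF f, of v] by blast
  show ?thesis using d[OF \<gamma>] differential_unique[OF f \<gamma> d[OF \<gamma>]] by simp
qed

lemma differential_extension:
  assumes v: "v \<in> tangent X x" and F: "holo F x" "\<forall>\<^sub>F y in nhds x. y \<in> X \<longrightarrow> F y = f y"
  shows "differential X f x v = (\<Sum>i\<in>UNIV. v $ i * partial F i x)"
proof -
  obtain \<gamma> where \<gamma>: "curve_at X x v \<gamma>" using v unfolding tangent_def by blast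
  show ?thesis
    by (rule differential_unique[OF hol_at_cong[OF hol_at_holo[OF F(1)] F(2)] \<gamma> extension_along_curve[OF F \<gamma>]])
qed

lemma differential_nth: "v \<in> tangent X x \<Longrightarrow> differential X (\<lambda>y. y $ i) x v = v $ i"
proof -
  assume v: "v \<in> tangent X x"
  then obtain \<gamma> where \<gamma>: "curve_at X x v \<gamma>" unfolding tangent_def by blast
  show ?thesis
  proof (rule differential_unique[OF hol_at_nth \<gamma>])
    show "((\<lambda>t. \<gamma> t $ i) has_vector_derivative v $ i) (at 0)"
      by (rule bounded_linear.has_vector_derivative[OF bounded_linear_vec_nth]) (use \<gamma> in \<open>simp add: curve_at_def\<close>)
  qed
qed

lemma differential_subset:
  assumes "X \<subseteq> Y" "hol_at Y f x" "v \<in> tangent X x"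
  shows "differential X f x v = differential Y f x v"
proof -
  obtain \<gamma> where \<gamma>: "curve_at X x v \<gamma>" using assms(3) unfolding tangent_def by blast
  then have \<gamma>Y: "curve_at Y x v \<gamma>" using assms(1) by (auto simp: curve_at_def)
  show ?thesis
    by (rule differential_unique[OF hol_at_subset[OF assms(2,1)] \<gamma> differential_curve[OF assms(2) \<gamma>Y]])
qed

lemma differential_cong:
  assumes f: "hol_at X f x" and fg: "\<forall>\<^sub>F y in nhds x. y \<in> X \<longrightarrow> f y = g y" and v: "v \<in> tangent X x"
  shows "differential X f x v = differential X g x v"
proof -
  obtain F where F: "holo F x" "\<forall>\<^sub>F y in nhds x. y \<in> X \<longrightarrow> F y = f y"
    using f unfolding hol_at_iff by blast
  from F(2) fg have "\<forall>\<^sub>F y in nhds x. y \<in> X \<longrightarrow> F y = g y" by eventually_elim simp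
  from differential_extension[OF v F] differential_extension[OF v F(1) this] show ?thesis by simp
qed

lemma differential_derivation:
  assumes v: "v \<in> tangent X x"
  shows "derivation_at X x (\<lambda>f. differential X f x v)"
  unfolding derivation_at_def
proof (intro allI impI)
  fix f g c assume "hol_at X f x \<and> hol_at X g x"
  then have f: "hol_at X f x" and g: "hol_at X g x" by auto
  obtain \<gamma> where \<gamma>: "curve_at X x v \<gamma>" using v unfolding tangent_def by blast
  have \<gamma>0: "\<gamma> 0 = x" using \<gamma> by (simp add: curve_at_def)
  note df = differential_curve[OF f \<gamma>] and dg = differential_curve[OF g \<gamma>]
  have 1: "((\<lambda>t. c * f (\<gamma> t)) has_vector_derivative c * differential X f x v) (at 0)"
    by (rule has_vector_derivative_mult_right[OF df])
  have 2: "((\<lambda>t. f (\<gamma> t) + g (\<gamma> t)) has_vector_derivative differential X f x v + differential X g x v) (at 0)"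
    by (rule has_vector_derivative_add[OF df dg])
  have 3: "((\<lambda>t. f (\<gamma> t) * g (\<gamma> t)) has_vector_derivative
      f x * differential X g x v + g x * differential X f x v) (at 0)"
    using has_vector_derivative_mult[OF df dg] by (simp add: \<gamma>0 mult.commute)
  have "differential X (\<lambda>q. c * f q) x v = c * differential X f x v"
    by (rule differential_unique[OF hol_at_mult[OF hol_at_const f] \<gamma> 1])
  moreover have "differential X (\<lambda>q. f q + g q) x v = differential X f x v + differential X g x v"
    by (rule differential_unique[OF hol_at_add[OF f g] \<gamma> 2])
  moreover have "differential X (\<lambda>q. f q * g q) x v = f x * differential X g x v + g x * differential X f x v"
    by (rule differential_unique[OF hol_at_mult[OF f g] \<gamma> 3])
  ultimately show "differential X (\<lambda>q. c * f q) x v = c * differential X f x v \<and>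
     differential X (\<lambda>q. f q + g q) x v = differential X f x v + differential X g x v \<and>
     differential X (\<lambda>q. f q * g q) x v = f x * differential X g x v + g x * differential X f x v"
    by blast
qed

text \<open>
  The sign is the one for which \<open>{p, q} = 1\<close> when the form is \<open>dp \<and> dq\<close>.
\<close>

definition is_ham_vector :: "(('N::finite, 'n::finite) point \<Rightarrow> complex) \<Rightarrow> ('N, 'n) point \<Rightarrow> ('N, 'n) point \<Rightarrow> bool"
  where "is_ham_vector f p u \<longleftrightarrow> u \<in> TA0 p \<and> (\<forall>w\<in>TA0 p. omega p u w = - differential A0 f p w)"

definition ham_vector :: "(('N::finite, 'n::finite) point \<Rightarrow> complex) \<Rightarrow> ('N, 'n) point \<Rightarrow> ('N, 'n) point"
  where "ham_vector f p = (THE u. is_ham_vector f p u)"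

lemma is_ham_vector_unique:
  assumes "p \<in> A0" "is_ham_vector f p u" "is_ham_vector f p v"
  shows "u = v"
  using assms omega_nondegenerate[OF assms(1), of u v] by (simp add: is_ham_vector_def)

lemma TA0_sum: "(\<And>i. i \<in> I \<Longrightarrow> u i \<in> TA0 p) \<Longrightarrow> (\<Sum>i\<in>I. c i *s u i) \<in> TA0 p"
proof (induction I rule: infinite_finite_induct)
  case (insert i I)
  then show ?case by (auto intro: TA0_add TA0_smult)
qed (auto simp: TA0_def Gmat_linear Lmat_linear)

lemma is_ham_vector_extension:
  assumes p: "p \<in> A0" and F: "holo F p" "\<forall>\<^sub>F y in nhds p. y \<in> A0 \<longrightarrow> F y = f y"
  shows "is_ham_vector f p (\<Sum>i\<in>UNIV. partial F i p *s coord_ham i p)"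
  unfolding is_ham_vector_def
proof (intro conjI ballI)
  show "(\<Sum>i\<in>UNIV. partial F i p *s coord_ham i p) \<in> TA0 p" by (intro TA0_sum coord_ham_TA0 p)
  fix w assume w: "w \<in> TA0 p"
  have "omega p (\<Sum>i\<in>UNIV. partial F i p *s coord_ham i p) w = (\<Sum>i\<in>UNIV. partial F i p * - w $ i)"
    by (simp add: omega_sum omega_coord_ham[OF p w])
  also have "\<dots> = - differential A0 f p w"
    using w by (simp add: differential_extension[OF _ F] tangent_A0[OF p] sum_negf mult.commute)
  finally show "omega p (\<Sum>i\<in>UNIV. partial F i p *s coord_ham i p) w = - differential A0 f p w" .
qed

lemma ham_vector_eq: "p \<in> A0 \<Longrightarrow> is_ham_vector f p u \<Longrightarrow> ham_vector f p = u"
  unfolding ham_vector_def by (rule the_equality) (auto intro: is_ham_vector_unique)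

lemma is_ham_vector_ham_vector:
  assumes p: "p \<in> A0" and f: "hol_at A0 f p"
  shows "is_ham_vector f p (ham_vector f p)"
proof -
  obtain F where F: "holo F p" "\<forall>\<^sub>F y in nhds p. y \<in> A0 \<longrightarrow> F y = f y"
    using f unfolding hol_at_iff by blast
  have h: "is_ham_vector f p (\<Sum>i\<in>UNIV. partial F i p *s coord_ham i p)" by (rule is_ham_vector_extension[OF p F])
  show ?thesis using h ham_vector_eq[OF p h] by simp
qed

lemma ham_vector_tangent: "p \<in> A0 \<Longrightarrow> hol_at A0 f p \<Longrightarrow> ham_vector f p \<in> tangent A0 p"
  using is_ham_vector_ham_vector[of p f] by (simp add: is_ham_vector_def tangent_A0)

lemma omega_ham_vector: "p \<in> A0 \<Longrightarrow> hol_at A0 f p \<Longrightarrow> w \<in> TA0 p \<Longrightarrow> omega p (ham_vector f p) w = - differential A0 f p w"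
  using is_ham_vector_ham_vector[of p f] by (simp add: is_ham_vector_def)

lemma ham_vector_nth:
  assumes p: "p \<in> A0"
  shows "ham_vector (\<lambda>y. y $ i) p = coord_ham i p"
proof (rule ham_vector_eq[OF p])
  show "is_ham_vector (\<lambda>y. y $ i) p (coord_ham i p)"
    unfolding is_ham_vector_def
    by (simp add: coord_ham_TA0[OF p] omega_coord_ham[OF p] differential_nth tangent_A0[OF p])
qed

section \<open>The bracket relations in coordinates\<close>

lemma elem_mat_nth: "elem_mat i j $ a $ b = (if a = i \<and> b = j then 1 else 0)"
  by (simp add: elem_mat_def)

lemma kron_nth: "(A \<otimes>\<^sub>K B) $ (a, c) $ (b, d) = A $ a $ b * B $ c $ d"
  by (simp add: kron_def)

text \<open>
  The sum over pairs \<open>i < j\<close> in the definition of \<open>r_mat\<close>: at most one pair contributes, and antisymmetry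
  makes the order of its elements irrelevant.
\<close>

lemma antisymmetric_delta_sum:
  fixes \<phi> :: "'n::{finite, linorder} \<Rightarrow> 'n \<Rightarrow> complex"
  assumes \<phi>: "\<And>i j. \<phi> i j = - \<phi> j i"
  shows "(\<Sum>(i, j)\<in>{(i, j). i < j}. \<phi> i j * ((if k = i \<and> b = j \<and> l = j \<and> d = i then 1 else 0)
      - (if k = j \<and> b = i \<and> l = i \<and> d = j then 1 else 0)))
    = (if k = d \<and> l = b \<and> b \<noteq> d then \<phi> d b else 0)"
proof (cases "k = d \<and> l = b \<and> b \<noteq> d")
  case False
  show ?thesis
  proof -
    have 1: "(if k = d \<and> l = b \<and> b \<noteq> d then \<phi> d b else 0) = 0" using False by (simp only: if_False)
    show ?thesis
      unfolding 1
    proof (rule sum.neutral, rule ballI)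
      fix x :: "'n \<times> 'n" assume x: "x \<in> {(i, j). i < j}"
      obtain i j where ij: "x = (i, j)" by (cases x)
      with x have "i < j" by simp
      then have ne: "i \<noteq> j" by blast
      have c: "\<not> (k = i \<and> b = j \<and> l = j \<and> d = i)" "\<not> (k = j \<and> b = i \<and> l = i \<and> d = j)"
        using False ne by blast+
      show "(case x of (i, j) \<Rightarrow> \<phi> i j * ((if k = i \<and> b = j \<and> l = j \<and> d = i then 1 else 0)
        - (if k = j \<and> b = i \<and> l = i \<and> d = j then 1 else 0))) = 0"
        unfolding ij using c by (simp only: case_prod_conv if_False diff_self mult_zero_right)
    qed
  qed
next
  case True
  define i0 where "i0 = min b d"
  define j0 where "j0 = max b d"
  have "(\<Sum>(i, j)\<in>{(i, j). i < j}. \<phi> i j * ((if k = i \<and> b = j \<and> l = j \<and> d = i then 1 else 0)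
      - (if k = j \<and> b = i \<and> l = i \<and> d = j then 1 else 0)))
    = (\<Sum>(i, j)\<in>{(i0, j0)}. \<phi> i j * ((if k = i \<and> b = j \<and> l = j \<and> d = i then 1 else 0)
      - (if k = j \<and> b = i \<and> l = i \<and> d = j then 1 else 0)))"
  proof (rule sum.mono_neutral_right)
    have bd: "b < d \<or> d < b" using True by (meson linorder_neq_iff)
    then show "{(i0, j0)} \<subseteq> {(i, j). i < j}" by (auto simp: i0_def j0_def min_def max_def)
    show "\<forall>x\<in>{(i, j). i < j} - {(i0, j0)}. (case x of (i, j) \<Rightarrow> \<phi> i j *
        ((if k = i \<and> b = j \<and> l = j \<and> d = i then 1 else 0)
        - (if k = j \<and> b = i \<and> l = i \<and> d = j then 1 else 0))) = 0"
    proof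
      fix x assume x: "x \<in> {(i, j). i < j} - {(i0, j0)}"
      obtain i j where ij: "x = (i, j)" by (cases x)
      with x have "i < j" "(i, j) \<noteq> (i0, j0)" by auto
      then have c: "\<not> (k = i \<and> b = j \<and> l = j \<and> d = i)" "\<not> (k = j \<and> b = i \<and> l = i \<and> d = j)"
        using bd by (auto simp: i0_def j0_def)
      show "(case x of (i, j) \<Rightarrow> \<phi> i j * ((if k = i \<and> b = j \<and> l = j \<and> d = i then 1 else 0)
        - (if k = j \<and> b = i \<and> l = i \<and> d = j then 1 else 0))) = 0"
        unfolding ij using c by (simp only: case_prod_conv if_False diff_self mult_zero_right)
    qed
  qed simp
  also have "\<dots> = \<phi> i0 j0 * ((if k = i0 \<and> b = j0 \<and> l = j0 \<and> d = i0 then 1 else 0)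
      - (if k = j0 \<and> b = i0 \<and> l = i0 \<and> d = j0 then 1 else 0))"
    by simp
  also have "\<dots> = \<phi> d b"
  proof (cases "b < d")
    case less: True
    then have i0: "i0 = b" "j0 = d" by (auto simp: i0_def j0_def)
    have c: "k = d \<and> b = b \<and> l = b \<and> d = d" "\<not> (k = b \<and> b = d \<and> l = d \<and> d = b)" using True by auto
    show ?thesis unfolding i0 \<phi>[of d b] using c by (simp only: if_False if_True) simp
  next
    case False
    then have i0: "i0 = d" "j0 = b" using True by (auto simp: i0_def j0_def)
    have c: "k = d \<and> b = b \<and> l = b \<and> d = d" "\<not> (k = b \<and> b = d \<and> l = d \<and> d = b)" using True by auto
    show ?thesis unfolding i0 using c by (simp only: if_False if_True) simp
  qed
  also have "\<phi> d b = (if k = d \<and> l = b \<and> b \<noteq> d then \<phi> d b else 0)"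
    by (rule if_P[OF True, symmetric])
  finally show ?thesis .
qed

lemma r_mat_nth:
  fixes L :: "'n::{finite, linorder} cmat"
  shows "r_mat L $ (k, l) $ (b, d) =
    (if k = d \<and> l = b \<and> b \<noteq> d then 1 / (L $ d $ d - L $ b $ b) else 0)"
proof -
  have delta_mult: "(if P then 1 else 0) * (if Q then 1 else 0) = (if P \<and> Q then 1 else 0 :: complex)" for P Q
    by simp
  have "r_mat L $ (k, l) $ (b, d) = (\<Sum>q\<in>{(i, j). i < j}. (case q of (i, j) \<Rightarrow>
      mat (1 / (L $ i $ i - L $ j $ j)) **
       (elem_mat i j \<otimes>\<^sub>K elem_mat j i - elem_mat j i \<otimes>\<^sub>K elem_mat i j)) $ (k, l) $ (b, d))"
    by (simp only: r_mat_def sum_component)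
  also have "\<dots> = (\<Sum>(i, j)\<in>{(i, j). i < j}. 1 / (L $ i $ i - L $ j $ j) *
       ((if k = i \<and> b = j \<and> l = j \<and> d = i then 1 else 0) - (if k = j \<and> b = i \<and> l = i \<and> d = j then 1 else 0)))"
  proof (intro sum.cong refl, clarify)
    fix i j :: 'n
    show "(mat (1 / (L $ i $ i - L $ j $ j)) **
         (elem_mat i j \<otimes>\<^sub>K elem_mat j i - elem_mat j i \<otimes>\<^sub>K elem_mat i j)) $ (k, l) $ (b, d) =
       1 / (L $ i $ i - L $ j $ j) *
       ((if k = i \<and> b = j \<and> l = j \<and> d = i then 1 else 0) - (if k = j \<and> b = i \<and> l = i \<and> d = j then 1 else 0))"
      by (simp only: mat_mult_nth vector_minus_component kron_nth elem_mat_nth delta_mult conj_assoc)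
  qed
  also have "\<dots> = (if k = d \<and> l = b \<and> b \<noteq> d then 1 / (L $ d $ d - L $ b $ b) else 0)"
    by (rule antisymmetric_delta_sum) (subst minus_diff_eq[symmetric], subst divide_minus_right, rule refl)
  finally show ?thesis .
qed

lemma kron_mult_nth:
  "((A \<otimes>\<^sub>K mat 1) ** (mat 1 \<otimes>\<^sub>K B)) $ (a, c) $ (k, l) = A $ a $ k * B $ c $ l"
proof -
  have "((A \<otimes>\<^sub>K mat 1) ** (mat 1 \<otimes>\<^sub>K B)) $ (a, c) $ (k, l)
     = (\<Sum>q\<in>UNIV. A $ a $ fst q * (if c = snd q then 1 else 0) * ((if fst q = k then 1 else 0) * B $ snd q $ l))"
    by (simp add: matrix_matrix_mult_def kron_def mat_def)
  also have "\<dots> = (\<Sum>q\<in>{(k, c)}. A $ a $ fst q * (if c = snd q then 1 else 0) * ((if fst q = k then 1 else 0) * B $ snd q $ l))"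
    by (rule sum.mono_neutral_right) auto
  finally show ?thesis by simp
qed

lemma GG_entry:
  fixes A B L :: "'n::{finite, linorder} cmat"
  shows "(- ((A \<otimes>\<^sub>K mat 1) ** (mat 1 \<otimes>\<^sub>K B) ** r_mat L)) $ (a, c) $ (b, d) =
    (if b \<noteq> d then B $ c $ b * A $ a $ d / (L $ b $ b - L $ d $ d) else 0)"
proof -
  have "((A \<otimes>\<^sub>K mat 1) ** (mat 1 \<otimes>\<^sub>K B) ** r_mat L) $ (a, c) $ (b, d)
     = (\<Sum>q\<in>UNIV. A $ a $ fst q * B $ c $ snd q * r_mat L $ q $ (b, d))"
    by (simp add: matrix_matrix_mult_def[of "_ ** _"]) (metis (no_types, lifting) kron_mult_nth prod.collapse)
  also have "\<dots> = (\<Sum>q\<in>{(d, b)}. A $ a $ fst q * B $ c $ snd q * r_mat L $ q $ (b, d))"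
    by (rule sum.mono_neutral_right) (auto simp: r_mat_nth split: if_splits)
  also have "\<dots> = (if b \<noteq> d then A $ a $ d * B $ c $ b / (L $ d $ d - L $ b $ b) else 0)"
    by (simp add: r_mat_nth)
  also have "\<dots> = - (if b \<noteq> d then B $ c $ b * A $ a $ d / (L $ b $ b - L $ d $ d) else 0)"
    by (simp add: minus_divide_right mult.commute)
  finally show ?thesis by simp
qed

lemma Omega_nth:
  fixes k :: "'n::finite"
  shows "Omega $ (k, l) $ (b, d) = (if k = b \<and> l = d then (if b = d then 1 else 0) - 1 / of_nat CARD('n) else 0)"
proof -
  have "(\<Sum>i\<in>UNIV. elem_mat i i $ k $ b * elem_mat i i $ l $ d)
     = (\<Sum>i\<in>{k}. (if k = b \<and> l = d \<and> b = d then 1 else 0 :: complex))"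
    by (rule sum.mono_neutral_cong_right) (auto simp: elem_mat_nth)
  moreover have "(mat (1 / of_nat CARD('n)) ** (mat 1 \<otimes>\<^sub>K mat 1) :: ('n \<times> 'n) cmat) $ (k, l) $ (b, d)
     = 1 / of_nat CARD('n) * (if k = b \<and> l = d then 1 else 0)"
    by (simp only: mat_mult_nth) (simp add: kron_def mat_def)
  ultimately show ?thesis
    by (auto simp: Omega_def sum_component kron_def)
qed

lemma GL_entry:
  fixes A :: "'n::finite cmat"
  shows "(- ((A \<otimes>\<^sub>K mat 1) ** Omega)) $ (a, c) $ (b, d) =
    (if c = d then - (A $ a $ b * ((if b = c then 1 else 0) - 1 / of_nat CARD('n))) else 0)"
proof -
  have "((A \<otimes>\<^sub>K mat 1) ** Omega) $ (a, c) $ (b, d)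
     = (\<Sum>q\<in>UNIV. A $ a $ fst q * (if c = snd q then 1 else 0) * Omega $ q $ (b, d))"
    by (simp add: matrix_matrix_mult_def kron_def mat_def)
  also have "\<dots> = (\<Sum>q\<in>{(b, c)}. A $ a $ fst q * (if c = snd q then 1 else 0) * Omega $ q $ (b, d))"
    by (rule sum.mono_neutral_right) (auto simp: Omega_nth split: if_splits)
  also have "\<dots> = A $ a $ b * Omega $ (b, c) $ (b, d)"
    by simp
  finally have e: "((A \<otimes>\<^sub>K mat 1) ** Omega) $ (a, c) $ (b, d) = A $ a $ b * Omega $ (b, c) $ (b, d)" .
  show ?thesis
  proof (cases "c = d")
    case True
    then show ?thesis unfolding vector_uminus_component e Omega_nth by simp
  next
    case False
    then show ?thesis unfolding vector_uminus_component e Omega_nth by simp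
  qed
qed

lemma index_cases:
  fixes i :: "('a \<times> 'b \<times> 'c) + ('d \<times> 'e \<times> 'f)"
  obtains j a b where "i = Inl (j, a, b)" | j a b where "i = Inr (j, a, b)"
  by (cases i) auto

lemma poisson_entry_skew: "poisson_entry k i y = - poisson_entry i k y"
proof -
  have sw: "u * v / (s - t) = - (v * u / (t - s))" for s t u v :: complex
    by (metis divide_minus_right minus_diff_eq mult.commute)
  show ?thesis
  proof (cases i rule: index_cases)
    case i: (1 j a b)
    show ?thesis
    proof (cases k rule: index_cases)
      case k: (1 j' c d)
      show ?thesis unfolding i k poisson_entry_def
        using sw[of "Gmat j y $ a $ d" "Gmat j y $ c $ b" "Lmat j y $ d $ d" "Lmat j y $ b $ b"]
        by (cases "j = j'"; cases "b = d") simp_all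
    next
      case k: (2 j' c d)
      show ?thesis unfolding i k poisson_entry_def by simp
    qed
  next
    case i: (2 j a b)
    show ?thesis
    proof (cases k rule: index_cases)
      case k: (1 j' c d)
      show ?thesis unfolding i k poisson_entry_def by simp
    next
      case k: (2 j' c d)
      show ?thesis unfolding i k poisson_entry_def by simp
    qed
  qed
qed

lemma bracket_matrix_nth:
  "bracket_matrix B (Gmat j) (Gmat k) x $ (a, c) $ (b, d) = B (\<lambda>y. y $ Inl (j, a, b)) (\<lambda>y. y $ Inl (k, c, d)) x"
  "bracket_matrix B (Gmat j) (Lmat k) x $ (a, c) $ (b, d) = B (\<lambda>y. y $ Inl (j, a, b)) (\<lambda>y. y $ Inr (k, c, d)) x"
  "bracket_matrix B (Lmat j) (Lmat k) x $ (a, c) $ (b, d) = B (\<lambda>y. y $ Inr (j, a, b)) (\<lambda>y. y $ Inr (k, c, d)) x"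
  by (simp_all add: bracket_matrix_def Gmat_nth Lmat_nth)

lemma A0_poisson_structure_coordinates:
  fixes B :: "('N::finite, 'n::{finite, linorder}) bracket"
  shows "A0_poisson_structure B \<longleftrightarrow> poisson_bracket A0 (hol_at A0) B \<and>
     (\<forall>x\<in>A0. \<forall>i k. B (\<lambda>y. y $ i) (\<lambda>y. y $ k) x = poisson_entry i k x)"
proof (cases "poisson_bracket A0 (hol_at A0) B")
  case True
  then have bid: "skew_biderivation A0 B" by (rule poisson_bracket_imp_skew_biderivation)
  have "(\<forall>j k. bracket_matrix B (Gmat j) (Gmat k) x =
          (if j = k then - ((Gmat j x \<otimes>\<^sub>K mat 1) ** (mat 1 \<otimes>\<^sub>K Gmat k x) ** r_mat (Lmat k x))
           else 0) \<and>
        bracket_matrix B (Gmat j) (Lmat k) x =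
          (if j = k then - ((Gmat k x \<otimes>\<^sub>K mat 1) ** Omega) else 0) \<and>
        bracket_matrix B (Lmat j) (Lmat k) x = 0) \<longleftrightarrow>
      (\<forall>i k. B (\<lambda>y. y $ i) (\<lambda>y. y $ k) x = poisson_entry i k x)" (is "?L \<longleftrightarrow> ?R") if x: "x \<in> A0" for x
  proof
    assume L: ?L
    have gg: "B (\<lambda>y. y $ Inl (j, a, b)) (\<lambda>y. y $ Inl (k, c, d)) x = poisson_entry (Inl (j, a, b)) (Inl (k, c, d)) x"
      for j k a b c d
      unfolding bracket_matrix_nth[symmetric] using L by (simp only: if_distrib[of "\<lambda>A. A $ _"] GG_entry) (simp add: poisson_entry_def)
    have gl: "B (\<lambda>y. y $ Inl (j, a, b)) (\<lambda>y. y $ Inr (k, c, d)) x = poisson_entry (Inl (j, a, b)) (Inr (k, c, d)) x"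
      for j k a b c d
      unfolding bracket_matrix_nth[symmetric] using L by (simp only: if_distrib[of "\<lambda>A. A $ _"] GL_entry) (simp add: poisson_entry_def)
    have ll: "B (\<lambda>y. y $ Inr (j, a, b)) (\<lambda>y. y $ Inr (k, c, d)) x = poisson_entry (Inr (j, a, b)) (Inr (k, c, d)) x"
      for j k a b c d
      unfolding bracket_matrix_nth[symmetric] using L by (simp add: poisson_entry_def)
    have lg: "B (\<lambda>y. y $ Inr (k, c, d)) (\<lambda>y. y $ Inl (j, a, b)) x = poisson_entry (Inr (k, c, d)) (Inl (j, a, b)) x"
      for j k a b c d
      using bider_skew[OF bid x hol_at_nth hol_at_nth] gl poisson_entry_skew by metis
    show ?R
      using gg gl ll lg by (metis sum.exhaust prod_cases3)
  next
    assume R: ?R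
    have gg: "bracket_matrix B (Gmat j) (Gmat k) x $ (a, c) $ (b, d) =
          (if j = k then - ((Gmat j x \<otimes>\<^sub>K mat 1) ** (mat 1 \<otimes>\<^sub>K Gmat k x) ** r_mat (Lmat k x))
           else 0) $ (a, c) $ (b, d)" for j k a b c d
      unfolding bracket_matrix_nth R[rule_format]
      by (simp only: if_distrib[of "\<lambda>A. A $ _"] GG_entry) (simp add: poisson_entry_def)
    have gl: "bracket_matrix B (Gmat j) (Lmat k) x $ (a, c) $ (b, d) =
          (if j = k then - ((Gmat k x \<otimes>\<^sub>K mat 1) ** Omega) else 0) $ (a, c) $ (b, d)" for j k a b c d
      unfolding bracket_matrix_nth R[rule_format]
      by (simp only: if_distrib[of "\<lambda>A. A $ _"] GL_entry) (simp add: poisson_entry_def)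
    have ll: "bracket_matrix B (Lmat j) (Lmat k) x $ (a, c) $ (b, d) = 0 $ (a, c) $ (b, d)" for j k a b c d
      unfolding bracket_matrix_nth R[rule_format] by (simp add: poisson_entry_def)
    show ?L
      unfolding vec_eq_iff split_paired_All using gg gl ll by simp
  qed
  with True show ?thesis unfolding A0_poisson_structure_def by simp
qed (simp add: A0_poisson_structure_def)

text \<open>
  The Leibniz rule leaves no freedom: the prescribed brackets of coordinates determine the bracket, and it is
  the one of the form \<open>omega\<close>.
\<close>

lemma bracket_ham_vector:
  fixes B :: "('N::finite, 'n::{finite, linorder}) bracket"
  assumes B: "A0_poisson_structure B" and p: "p \<in> A0" and f: "hol_at A0 f p" and g: "hol_at A0 g p"
  shows "B f g p = differential A0 g p (ham_vector f p)"
proof -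
  have bid: "skew_biderivation A0 B" and co: "\<And>i k. B (\<lambda>y. y $ i) (\<lambda>y. y $ k) p = poisson_entry i k p"
    using B p poisson_bracket_imp_skew_biderivation unfolding A0_poisson_structure_coordinates by auto
  obtain F where F: "holo F p" "\<forall>\<^sub>F y in nhds p. y \<in> A0 \<longrightarrow> F y = f y"
    using f unfolding hol_at_iff by blast
  obtain G where G: "holo G p" "\<forall>\<^sub>F y in nhds p. y \<in> A0 \<longrightarrow> G y = g y"
    using g unfolding hol_at_iff by blast
  have "B f g p = (\<Sum>i\<in>UNIV. \<Sum>j\<in>UNIV. partial F i p * partial G j p * poisson_entry i j p)"
    unfolding bider_coordinates[OF bid p F G] co ..
  also have "\<dots> = (\<Sum>j\<in>UNIV. \<Sum>i\<in>UNIV. partial F i p * partial G j p * poisson_entry i j p)" by (rule sum.swap)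
  also have "\<dots> = (\<Sum>j\<in>UNIV. (\<Sum>i\<in>UNIV. partial F i p *s coord_ham i p) $ j * partial G j p)"
    by (simp add: sum_distrib_left mult_ac)
  also have "\<dots> = differential A0 g p (ham_vector f p)"
    using differential_extension[OF ham_vector_tangent[OF p f] G] ham_vector_eq[OF p is_ham_vector_extension[OF p F]] by simp
  finally show ?thesis .
qed

section \<open>Existence of the Poisson structure\<close>

definition A0_bracket :: "('N::finite, 'n::finite) bracket" where
  "A0_bracket f g p = differential A0 g p (ham_vector f p)"

lemma holo_if: "(P \<Longrightarrow> holo f p) \<Longrightarrow> (\<not> P \<Longrightarrow> holo g p) \<Longrightarrow> holo (\<lambda>y. if P then f y else g y) p"
  by (cases P) simp_all

lemma has_derivative_if:
  "(P \<Longrightarrow> (f has_derivative f') F) \<Longrightarrow> (\<not> P \<Longrightarrow> (g has_derivative g') F) \<Longrightarrow>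
   ((\<lambda>y. if P then f y else g y) has_derivative (\<lambda>v. if P then f' v else g' v)) F"
  by (cases P) simp_all

lemma holo_poisson_entry:
  assumes p: "p \<in> A0"
  shows "holo (poisson_entry i k) p"
proof -
  have 1: "holo (\<lambda>y. Gmat j y $ c $ b * Gmat j y $ a $ d / (Lmat j y $ b $ b - Lmat j y $ d $ d)) p"
    if "b \<noteq> d" for j a b c d
    using A0_distinct[OF p that, of j]
    by (intro holo_divide holo_mult holo_diff holo_Gmat_nth holo_Lmat_nth) simp
  have 2: "holo (\<lambda>y. Gmat j y $ a $ b * e) p" for j a b e
    by (intro holo_mult holo_Gmat_nth holo_const)
  show ?thesis
    unfolding poisson_entry_def
    by (cases i rule: index_cases; cases k rule: index_cases;
        simp only: sum.case prod.case; intro holo_if holo_const 1 2 holo_uminus; simp)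
qed

lemma A0_bracket_skew:
  assumes p: "p \<in> A0" and f: "hol_at A0 f p" and g: "hol_at A0 g p"
  shows "A0_bracket f g p = - A0_bracket g f p"
proof -
  have T: "ham_vector f p \<in> TA0 p" "ham_vector g p \<in> TA0 p"
    using ham_vector_tangent[OF p f] ham_vector_tangent[OF p g] tangent_A0[OF p] by simp_all
  show ?thesis
    using omega_ham_vector[OF p f T(2)] omega_ham_vector[OF p g T(1)] omega_skew[of p "ham_vector f p" "ham_vector g p"]
    unfolding A0_bracket_def by simp
qed

text \<open>
  In a whole neighbourhood of \<open>p\<close> the bracket is the sum of the prescribed entries times partial derivatives
  of extensions, which are holomorphic.
\<close>

lemma A0_bracket_hol:
  assumes p: "p \<in> A0" and f: "hol_at A0 f p" and g: "hol_at A0 g p"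
  shows "hol_at A0 (A0_bracket f g) p"
proof -
  obtain F where F: "holo F p" "\<forall>\<^sub>F y in nhds p. y \<in> A0 \<longrightarrow> F y = f y"
    using f unfolding hol_at_iff by blast
  obtain G where G: "holo G p" "\<forall>\<^sub>F y in nhds p. y \<in> A0 \<longrightarrow> G y = g y"
    using g unfolding hol_at_iff by blast
  let ?K = "\<lambda>y. \<Sum>k\<in>UNIV. (\<Sum>i\<in>UNIV. partial F i y * poisson_entry i k y) * partial G k y"
  have "holo ?K p"
    by (intro holo_sum holo_mult holo_poisson_entry p holo_partial F G)
  moreover have "\<forall>\<^sub>F y in nhds p. y \<in> A0 \<longrightarrow> ?K y = A0_bracket f g y"
    using holo_eventually[OF F(1)] holo_eventually[OF G(1)]
      eventually_eventually[THEN iffD2, OF F(2)] eventually_eventually[THEN iffD2, OF G(2)]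
  proof eventually_elim
    case (elim y)
    show ?case
    proof
      assume y: "y \<in> A0"
      have fy: "hol_at A0 f y" by (rule hol_at_cong[OF hol_at_holo[OF elim(1)] elim(3)])
      have "ham_vector f y = (\<Sum>i\<in>UNIV. partial F i y *s coord_ham i y)"
        by (rule ham_vector_eq[OF y is_ham_vector_extension[OF y elim(1,3)]])
      then show "?K y = A0_bracket f g y"
        unfolding A0_bracket_def differential_extension[OF ham_vector_tangent[OF y fy] elim(2,4)]
        by simp
    qed
  qed
  ultimately show ?thesis unfolding hol_at_iff by blast
qed

lemma skew_biderivation_A0_bracket: "skew_biderivation A0 A0_bracket"
  unfolding skew_biderivation_def
proof (intro ballI allI impI conjI)
  fix p f g assume p: "p \<in> A0" and "hol_at A0 f p \<and> hol_at A0 g p"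
  then have f: "hol_at A0 f p" and g: "hol_at A0 g p" by auto
  show "hol_at A0 (A0_bracket f g) p" by (rule A0_bracket_hol[OF p f g])
  show "A0_bracket f g p = - A0_bracket g f p" by (rule A0_bracket_skew[OF p f g])
  have sk: "A0_bracket h g p = - differential A0 h p (ham_vector g p)" if "hol_at A0 h p" for h
    using A0_bracket_skew[OF p that g] by (simp add: A0_bracket_def)
  note d = differential_derivation[OF ham_vector_tangent[OF p g]]
  show "derivation_at A0 p (\<lambda>h. A0_bracket h g p)"
    unfolding derivation_at_def
  proof (intro allI impI)
    fix h k c assume hk: "hol_at A0 h p \<and> hol_at A0 k p"
    then have "hol_at A0 (\<lambda>q. c * h q) p" "hol_at A0 (\<lambda>q. h q + k q) p" "hol_at A0 (\<lambda>q. h q * k q) p"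
      by auto
    then show "A0_bracket (\<lambda>q. c * h q) g p = c * A0_bracket h g p \<and> A0_bracket (\<lambda>q. h q + k q) g p = A0_bracket h g p + A0_bracket k g p \<and>
       A0_bracket (\<lambda>q. h q * k q) g p = h p * A0_bracket k g p + k p * A0_bracket h g p"
      using hk derivation_cmult[OF d, of h c] derivation_add[OF d, of h k] derivation_mult[OF d, of h k]
      by (simp add: sk)
  qed
qed

lemma A0_bracket_nth: "p \<in> A0 \<Longrightarrow> A0_bracket (\<lambda>y. y $ i) (\<lambda>y. y $ k) p = poisson_entry i k p"
  by (simp add: A0_bracket_def ham_vector_nth differential_nth tangent_A0 coord_ham_TA0)

text \<open>
  The derivative of \<open>poisson_entry i k\<close> at \<open>y\<close> in the direction \<open>v\<close> (see
  \<open>has_derivative_poisson_entry\<close>).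
\<close>

definition poisson_entry_deriv :: "('N::finite \<times> 'n::finite \<times> 'n) + ('N \<times> 'n \<times> 'n) \<Rightarrow>
    ('N \<times> 'n \<times> 'n) + ('N \<times> 'n \<times> 'n) \<Rightarrow> ('N, 'n) point \<Rightarrow> ('N, 'n) point \<Rightarrow> complex" where
  "poisson_entry_deriv i k y v = (case i of
     Inl (j, a, b) \<Rightarrow> (case k of
        Inl (j', c, d) \<Rightarrow> if j = j' \<and> b \<noteq> d
          then ((Gmat j y $ c $ b * Gmat j v $ a $ d + Gmat j v $ c $ b * Gmat j y $ a $ d)
              * (Lmat j y $ b $ b - Lmat j y $ d $ d)
              - Gmat j y $ c $ b * Gmat j y $ a $ d * (Lmat j v $ b $ b - Lmat j v $ d $ d))
            / ((Lmat j y $ b $ b - Lmat j y $ d $ d) * (Lmat j y $ b $ b - Lmat j y $ d $ d)) else 0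
      | Inr (j', c, d) \<Rightarrow> if j = j' \<and> c = d
          then - (Gmat j v $ a $ b * ((if b = c then 1 else 0) - 1 / of_nat CARD('n))) else 0)
   | Inr (j, a, b) \<Rightarrow> (case k of
        Inl (j', c, d) \<Rightarrow> if j = j' \<and> a = b
          then Gmat j v $ c $ d * ((if d = a then 1 else 0) - 1 / of_nat CARD('n)) else 0
      | Inr _ \<Rightarrow> 0))"

lemma has_derivative_poisson_entry:
  assumes p: "p \<in> A0"
  shows "(poisson_entry i k has_derivative poisson_entry_deriv i k p) (at p)"
proof -
  have G: "((\<lambda>y. Gmat j y $ a $ b) has_derivative (\<lambda>v. Gmat j v $ a $ b)) (at p)" for j a b
    by (rule bounded_linear.has_derivative[OF bounded_linear_entry has_derivative_Gmat])
  have L: "((\<lambda>y. Lmat j y $ a $ b) has_derivative (\<lambda>v. Lmat j v $ a $ b)) (at p)" for j a b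
    by (rule bounded_linear.has_derivative[OF bounded_linear_entry has_derivative_Lmat])
  have 1: "((\<lambda>y. Gmat j y $ c $ b * Gmat j y $ a $ d / (Lmat j y $ b $ b - Lmat j y $ d $ d)) has_derivative
     (\<lambda>v. ((Gmat j p $ c $ b * Gmat j v $ a $ d + Gmat j v $ c $ b * Gmat j p $ a $ d)
              * (Lmat j p $ b $ b - Lmat j p $ d $ d)
              - Gmat j p $ c $ b * Gmat j p $ a $ d * (Lmat j v $ b $ b - Lmat j v $ d $ d))
            / ((Lmat j p $ b $ b - Lmat j p $ d $ d) * (Lmat j p $ b $ b - Lmat j p $ d $ d)))) (at p)" if "b \<noteq> d" for j a b c d
    by (intro has_derivative_divide' has_derivative_mult has_derivative_diff G L)
      (use A0_distinct[OF p that, of j] in simp)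
  have 2: "((\<lambda>y. Gmat j y $ a $ b * e) has_derivative (\<lambda>v. Gmat j v $ a $ b * e)) (at p)" for j a b e
    by (rule has_derivative_mult_left[OF G])
  show ?thesis
    unfolding poisson_entry_def[abs_def] poisson_entry_deriv_def[abs_def]
    by (cases i rule: index_cases; cases k rule: index_cases;
        simp only: sum.case prod.case; intro has_derivative_if has_derivative_const 1 2 has_derivative_minus[OF 2]; simp)
qed

lemma A0_bracket_nested:
  assumes p: "p \<in> A0"
  shows "A0_bracket (\<lambda>y. y $ i) (A0_bracket (\<lambda>y. y $ j) (\<lambda>y. y $ k)) p = poisson_entry_deriv j k p (coord_ham i p)"
proof -
  have ev: "\<forall>\<^sub>F y in nhds p. y \<in> A0 \<longrightarrow> poisson_entry j k y = A0_bracket (\<lambda>y. y $ j) (\<lambda>y. y $ k) y"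
    by (simp add: A0_bracket_nth)
  have "A0_bracket (\<lambda>y. y $ i) (A0_bracket (\<lambda>y. y $ j) (\<lambda>y. y $ k)) p = (\<Sum>l\<in>UNIV. coord_ham i p $ l * partial (poisson_entry j k) l p)"
    unfolding A0_bracket_def[of "\<lambda>y. y $ i"] ham_vector_nth[OF p]
    by (rule differential_extension[OF _ holo_poisson_entry[OF p] ev]) (simp add: tangent_A0[OF p] coord_ham_TA0[OF p])
  also have "\<dots> = poisson_entry_deriv j k p (coord_ham i p)"
    by (rule fun_cong[OF has_derivative_unique[OF cdiff_has_derivative[OF holo_imp_cdiff[OF holo_poisson_entry[OF p]]]
          has_derivative_poisson_entry[OF p]]])
  finally show ?thesis .
qed

lemma telescoping_fractions:
  fixes u v w :: complex
  assumes "u \<noteq> v" "v \<noteq> w" "w \<noteq> u"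
  shows "1 / ((u - v) * (v - w)) + 1 / ((v - w) * (w - u)) + 1 / ((w - u) * (u - v)) = 0"
proof -
  have "1 / ((u - v) * (v - w)) + 1 / ((v - w) * (w - u)) + 1 / ((w - u) * (u - v))
     = ((w - u) + (u - v) + (v - w)) / ((u - v) * (v - w) * (w - u))"
    using assms by (simp add: divide_simps)
  then show ?thesis by simp
qed

text \<open>
  With \<open>\<kappa> s t = 1 / (\<lambda>\<^sub>s - \<lambda>\<^sub>t)\<close> the two products of entries of \<open>G\<close> that occur have the coefficients
  \<open>\<plusminus> (\<kappa> b d \<kappa> d f + \<kappa> d f \<kappa> f b + \<kappa> f b \<kappa> b d) = 0\<close>.  If two of the columns agree, the derivatives
  of the denominators enter and compensate for the missing terms.
\<close>

lemma jacobi_GGG: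
  assumes p: "p \<in> A0"
  shows "poisson_entry_deriv (Inl (j, c, d)) (Inl (j, e, f)) p (coord_ham (Inl (j, a, b)) p)
    + poisson_entry_deriv (Inl (j, e, f)) (Inl (j, a, b)) p (coord_ham (Inl (j, c, d)) p)
    + poisson_entry_deriv (Inl (j, a, b)) (Inl (j, c, d)) p (coord_ham (Inl (j, e, f)) p) = 0"
proof -
  define g where "g r s = Gmat j p $ r $ s" for r s
  define l where "l s = Lmat j p $ s $ s" for s
  define \<kappa> where "\<kappa> s t = 1 / (l s - l t)" for s t
  have ne: "l s - l t \<noteq> 0" if "s \<noteq> t" for s t
    using A0_distinct[OF p that, of j] by (simp add: l_def)
  have v: "Gmat j (coord_ham (Inl (j, a, b)) p) $ r $ s = (if b \<noteq> s then g r b * g a s * \<kappa> b s else 0)" for a b r s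
    by (simp add: Gmat_nth[of j "coord_ham _ _"] poisson_entry_def g_def \<kappa>_def l_def)
  have vl: "Lmat j (coord_ham (Inl (j, a, b)) p) $ s $ s - Lmat j (coord_ham (Inl (j, a, b)) p) $ t $ t
      = - (g a b * ((if b = s then 1 else 0) - (if b = t then 1 else 0)))" for a b s t
    by (simp add: Lmat_nth[of j "coord_ham _ _"] poisson_entry_def g_def algebra_simps)
  have dp: "poisson_entry_deriv (Inl (j, c, d)) (Inl (j, e, f)) p v = (if d \<noteq> f then
      (g e d * Gmat j v $ c $ f + Gmat j v $ e $ d * g c f) * \<kappa> d f
      - g e d * g c f * (Lmat j v $ d $ d - Lmat j v $ f $ f) * \<kappa> d f * \<kappa> d f else 0)" for c d e f v
  proof (cases "d = f")
    case False
    have "(A * L - B) / (L * L) = A * (1 / L) - B * (1 / L) * (1 / L)" if "L \<noteq> 0" for A B L :: complex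
      using that by (simp add: field_simps)
    from this[OF ne[OF False]] False show ?thesis
      unfolding poisson_entry_deriv_def \<kappa>_def by (simp add: g_def l_def)
  qed (simp add: poisson_entry_deriv_def)
  have sw: "\<kappa> t s = - \<kappa> s t" for s t
    unfolding \<kappa>_def by (metis divide_minus_right minus_diff_eq)
  have tel: "\<kappa> b d * \<kappa> d f + \<kappa> d f * \<kappa> f b + \<kappa> f b * \<kappa> b d = 0" if "b \<noteq> d" "d \<noteq> f" "f \<noteq> b"
    using telescoping_fractions[of "l b" "l d" "l f"] ne that by (simp add: \<kappa>_def)
  define x where "x = \<kappa> b d"
  define y where "y = \<kappa> d f"
  define z where "z = \<kappa> f b"
  have \<kappa>: "\<kappa> b d = x" "\<kappa> d b = - x" "\<kappa> d f = y" "\<kappa> f d = - y" "\<kappa> f b = z" "\<kappa> b f = - z"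
    using sw unfolding x_def y_def z_def by blast+
  consider "b = d" "d = f" | "b = d" "d \<noteq> f" "f \<noteq> b" | "b \<noteq> d" "d = f" "f \<noteq> b" | "b \<noteq> d" "d \<noteq> f" "f = b"
    | "b \<noteq> d" "d \<noteq> f" "f \<noteq> b" by blast
  then show ?thesis
  proof cases
    case 1
    then show ?thesis by (simp add: dp)
  next
    case 2
    have zy: "z = - y" using \<kappa>(3,6) unfolding 2(1) by (metis minus_minus)
    show ?thesis using 2(2,3) unfolding 2(1) dp v vl \<kappa> zy 
      by (simp add: \<kappa>[unfolded 2(1)] zy algebra_simps)
  next
    case 3
    have zx: "z = - x" using \<kappa>(1,6) unfolding 3(2) by (metis minus_minus)
    show ?thesis using 3(1,3) unfolding 3(2) dp v vl
      by (simp add: \<kappa>[unfolded 3(2)] zx algebra_simps)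
  next
    case 4
    have yx: "y = - x" using \<kappa>(2,3) unfolding 4(3) by (metis minus_minus)
    show ?thesis using 4(1,2) unfolding 4(3) dp v vl
      by (simp add: \<kappa>[unfolded 4(3)] yx algebra_simps)
  next
    case 5
    have t: "x * y + y * z + z * x = 0" using tel[OF 5] by (simp add: \<kappa>)
    have "poisson_entry_deriv (Inl (j, c, d)) (Inl (j, e, f)) p (coord_ham (Inl (j, a, b)) p)
    + poisson_entry_deriv (Inl (j, e, f)) (Inl (j, a, b)) p (coord_ham (Inl (j, c, d)) p)
    + poisson_entry_deriv (Inl (j, a, b)) (Inl (j, c, d)) p (coord_ham (Inl (j, e, f)) p)
      = (g e b * g a d * g c f - g e d * g c b * g a f) * (x * y + y * z + z * x)"
      using 5 unfolding dp v vl by (simp add: \<kappa> algebra_simps)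
    then show ?thesis by (simp add: t)
  qed
qed

text \<open>
  Brackets with an eigenvalue of \<open>L\<^sub>j\<close> multiply the columns of \<open>G\<^sub>j\<close> by constants.  Such a scaling is a derivation
  of the quadratic brackets of the entries of \<open>G\<^sub>j\<close>, which is the Jacobi identity when eigenvalues are involved.
\<close>

lemma jacobi_coordinates:
  fixes p :: "('N::finite, 'n::finite) point"
  assumes p: "p \<in> A0"
  shows "poisson_entry_deriv i2 i3 p (coord_ham i1 p) + poisson_entry_deriv i3 i1 p (coord_ham i2 p) + poisson_entry_deriv i1 i2 p (coord_ham i3 p) = 0"
proof -
  have GG0: "poisson_entry_deriv (Inl (j, c, d)) (Inl (j', e, f)) p v = 0" if "j \<noteq> j'" for j j' c d e f v
    using that by (simp add: poisson_entry_deriv_def)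
  have h0: "Gmat j' (coord_ham (Inl (j, a, b)) p) = 0" "Lmat j' (coord_ham (Inl (j, a, b)) p) = 0" if "j \<noteq> j'" for j j' a b
    using that by (simp_all add: vec_eq_iff Gmat_nth Lmat_nth poisson_entry_def)
  have GGv0: "poisson_entry_deriv (Inl (j, c, d)) k p v = 0" if "Gmat j v = 0" "Lmat j v = 0" for j c d k v
    using that by (cases k rule: index_cases) (auto simp: poisson_entry_deriv_def)
  have GGG: "poisson_entry_deriv (Inl (j2, c, d)) (Inl (j3, e, f)) p (coord_ham (Inl (j1, a, b)) p)
    + poisson_entry_deriv (Inl (j3, e, f)) (Inl (j1, a, b)) p (coord_ham (Inl (j2, c, d)) p)
    + poisson_entry_deriv (Inl (j1, a, b)) (Inl (j2, c, d)) p (coord_ham (Inl (j3, e, f)) p) = 0" for j1 a b j2 c d j3 e f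
  proof (cases "j1 = j2 \<and> j2 = j3")
    case True
    then show ?thesis using jacobi_GGG[OF p] by simp
  next
    case False
    have z: "poisson_entry_deriv (Inl (j, c, d)) (Inl (j', e, f)) p (coord_ham (Inl (i, a, b)) p) = 0"
      if "\<not> (i = j \<and> j = j')" for i j j' a b c d e f
      using that GG0 GGv0[OF h0] by metis
    have F: "\<not> (j2 = j3 \<and> j3 = j1)" "\<not> (j3 = j1 \<and> j1 = j2)" using False by auto
    show ?thesis unfolding z[OF False] z[OF F(1)] z[OF F(2)] by simp
  qed
  have GGL: "poisson_entry_deriv (Inl (j2, c, d)) (Inl (j3, e, f)) p (coord_ham (Inr (j1, a, b)) p)
    + poisson_entry_deriv (Inl (j3, e, f)) (Inr (j1, a, b)) p (coord_ham (Inl (j2, c, d)) p)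
    + poisson_entry_deriv (Inr (j1, a, b)) (Inl (j2, c, d)) p (coord_ham (Inl (j3, e, f)) p) = 0" for j1 a b j2 c d j3 e f
  proof -
    define w where "w s = (if s = a then 1 else 0) - 1 / (of_nat CARD('n) :: complex)" for s :: 'n
    define m where "m = (if j1 = j2 \<and> a = b then 1 else 0 :: complex)"
    have vG: "Gmat j (coord_ham (Inr (j1, a, b)) p) $ r $ s = (if j1 = j \<and> a = b then Gmat j p $ r $ s * w s else 0)" for r s j
      by (simp add: Gmat_nth[of j "coord_ham _ _"] Gmat_nth[of j p] poisson_entry_def w_def)
    have vL: "Lmat j (coord_ham (Inr (j1, a, b)) p) = 0" for j
      by (simp add: vec_eq_iff Lmat_nth poisson_entry_def)
    have 2: "poisson_entry_deriv (Inl (j3, e, f)) (Inr (j1, a, b)) p v = (if j3 = j1 \<and> a = b then - (Gmat j3 v $ e $ f * w f) else 0)" for v j3 e f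
      by (simp add: poisson_entry_deriv_def w_def)
    have 3: "poisson_entry_deriv (Inr (j1, a, b)) (Inl (j2, c, d)) p v = (if j1 = j2 \<and> a = b then Gmat j1 v $ c $ d * w d else 0)" for v j2 c d
      by (simp add: poisson_entry_deriv_def w_def)
    have hG: "Gmat j (coord_ham (Inl (j2, c, d)) p) $ r $ s = poisson_entry (Inl (j2, c, d)) (Inl (j, r, s)) p" for j r s j2 c d
      by (simp add: Gmat_nth)
    show ?thesis
    proof (cases "j1 = j2 \<and> j2 = j3 \<and> a = b \<and> d \<noteq> f")
      case True
      define v where "v = coord_ham (Inr (j1, a, b)) p"
      have n: "Lmat j3 p $ d $ d - Lmat j3 p $ f $ f \<noteq> 0" using A0_distinct[OF p, of d f j3] True by simp
      have vG': "Gmat j3 v $ r $ s = Gmat j3 p $ r $ s * w s" and vL': "Lmat j3 v = 0" for r s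
        using True vG[of j3 r s] vL[of j3] by (simp_all add: v_def)
      have "poisson_entry_deriv (Inl (j3, c, d)) (Inl (j3, e, f)) p v
        = (Gmat j3 p $ e $ d * (Gmat j3 p $ c $ f * w f) + (Gmat j3 p $ e $ d * w d) * Gmat j3 p $ c $ f)
          / (Lmat j3 p $ d $ d - Lmat j3 p $ f $ f)"
        using True n by (simp add: poisson_entry_deriv_def vG' vL')
      also have "\<dots> = poisson_entry (Inl (j3, c, d)) (Inl (j3, e, f)) p * (w d + w f)"
        using True by (simp add: poisson_entry_def distrib_left distrib_right add_divide_distrib mult_ac)
      finally have "poisson_entry_deriv (Inl (j2, c, d)) (Inl (j3, e, f)) p (coord_ham (Inr (j1, a, b)) p)
        = poisson_entry (Inl (j2, c, d)) (Inl (j3, e, f)) p * (w d + w f)"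
        using True by (simp add: v_def)
      moreover have "poisson_entry (Inl (j3, e, f)) (Inl (j1, c, d)) p = - poisson_entry (Inl (j2, c, d)) (Inl (j3, e, f)) p"
        using True poisson_entry_skew[of "Inl (j3, e, f)" "Inl (j3, c, d)" p] by simp
      ultimately show ?thesis unfolding 2 3 hG using True by (simp add: algebra_simps)
    next
      case False
      then show ?thesis
        unfolding 2 3 hG
        by (auto simp: poisson_entry_deriv_def poisson_entry_def vG vL)
    qed
  qed
  have GLL: "poisson_entry_deriv (Inr (j2, c, d)) (Inr (j3, e, f)) p (coord_ham (Inl (j1, a, b)) p)
    + poisson_entry_deriv (Inr (j3, e, f)) (Inl (j1, a, b)) p (coord_ham (Inr (j2, c, d)) p)
    + poisson_entry_deriv (Inl (j1, a, b)) (Inr (j2, c, d)) p (coord_ham (Inr (j3, e, f)) p) = 0" for j1 a b j2 c d j3 e f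
    by (simp add: poisson_entry_deriv_def Gmat_nth[of _ "coord_ham _ _"] poisson_entry_def)
  have LLL: "poisson_entry_deriv (Inr q) (Inr q') p v = 0" for q q' v
    by (simp add: poisson_entry_deriv_def split: prod.splits)
  define J where "J i1 i2 i3 = poisson_entry_deriv i2 i3 p (coord_ham i1 p) + poisson_entry_deriv i3 i1 p (coord_ham i2 p) + poisson_entry_deriv i1 i2 p (coord_ham i3 p)" for i1 i2 i3
  have cyc: "J i1 i2 i3 = J i2 i3 i1" for i1 i2 i3 by (simp add: J_def)
  have G1: "J (Inl q1) (Inl q2) (Inl q3) = 0" for q1 q2 q3
    unfolding J_def using GGG by (metis prod_cases3)
  have G2: "J (Inr q1) (Inl q2) (Inl q3) = 0" for q1 q2 q3
    unfolding J_def using GGL by (metis prod_cases3)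
  have G3: "J (Inl q1) (Inr q2) (Inr q3) = 0" for q1 q2 q3
    unfolding J_def using GLL by (metis prod_cases3)
  have G4: "J (Inr q1) (Inr q2) (Inr q3) = 0" for q1 q2 q3
    unfolding J_def LLL by simp
  note G = G1 G2 G3 G4
  have "J i1 i2 i3 = 0"
  proof (cases i1)
    case 1: (Inl q1)
    show ?thesis
    proof (cases i2)
      case 2: (Inl q2)
      show ?thesis
      proof (cases i3)
        case 3: (Inr q3)
        show ?thesis unfolding 1 2 3 cyc[of "Inl q1"] cyc[of "Inl q2"] by (rule G)
      qed (simp add: 1 2 G)
    next
      case 2: (Inr q2)
      show ?thesis
      proof (cases i3)
        case 3: (Inl q3)
        show ?thesis unfolding 1 2 3 cyc[of "Inl q1"] by (rule G)
      qed (simp add: 1 2 G)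
    qed
  next
    case 1: (Inr q1)
    show ?thesis
    proof (cases i2)
      case 2: (Inl q2)
      show ?thesis
      proof (cases i3)
        case 3: (Inr q3)
        show ?thesis unfolding 1 2 3 cyc[of "Inr q1"] by (rule G)
      qed (simp add: 1 2 G)
    next
      case 2: (Inr q2)
      show ?thesis
      proof (cases i3)
        case 3: (Inl q3)
        show ?thesis unfolding 1 2 3 cyc[of "Inr q1"] cyc[of "Inr q2"] by (rule G)
      qed (simp add: 1 2 G)
    qed
  qed
  then show ?thesis by (simp add: J_def)
qed

lemma A0_poisson_structure_A0_bracket: "A0_poisson_structure A0_bracket"
  unfolding A0_poisson_structure_coordinates
proof (intro conjI ballI allI)
  show "poisson_bracket A0 (hol_at A0) A0_bracket"
    unfolding poisson_bracket_def
  proof (intro ballI allI impI)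
    fix p f g h c assume p: "p \<in> A0" and "hol_at A0 f p \<and> hol_at A0 g p \<and> hol_at A0 h p"
    then have f: "hol_at A0 f p" and g: "hol_at A0 g p" and h: "hol_at A0 h p" by auto
    note B = skew_biderivation_A0_bracket and d = bider_left[OF skew_biderivation_A0_bracket p]
    have "jacobiator A0_bracket p f g h = 0"
    proof (rule jacobiator_vanishes[OF B p _ f g h])
      show "jacobiator A0_bracket p (\<lambda>y. y $ i) (\<lambda>y. y $ j) (\<lambda>y. y $ k) = 0" for i j k
        unfolding jacobiator_def[OF B] A0_bracket_nested[OF p] by (rule jacobi_coordinates[OF p])
    qed
    then show "hol_at A0 (A0_bracket f g) p \<and> A0_bracket f g p = - A0_bracket g f p \<and> A0_bracket (\<lambda>q. c * f q) g p = c * A0_bracket f g p \<and>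
        A0_bracket (\<lambda>q. f q + g q) h p = A0_bracket f h p + A0_bracket g h p \<and>
        A0_bracket (\<lambda>q. f q * g q) h p = f p * A0_bracket g h p + g p * A0_bracket f h p \<and>
        A0_bracket f (A0_bracket g h) p + A0_bracket g (A0_bracket h f) p + A0_bracket h (A0_bracket f g) p = 0"
      unfolding jacobiator_def[OF B]
      by (intro conjI bider_hol[OF B p f g] bider_skew[OF B p f g] derivation_cmult[OF d[OF g] f]
          derivation_add[OF d[OF h] f g] derivation_mult[OF d[OF h] f g])
  qed
  show "A0_bracket (\<lambda>y. y $ i) (\<lambda>y. y $ k) x = poisson_entry i k x" if "x \<in> A0" for x i k
    by (rule A0_bracket_nth[OF that])
qed

section \<open>The action and its moment map\<close>

lemma act_act: "act S (act T x) = act (S ** T) x"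
  by (intro point_eqI) (simp_all add: matrix_mul_assoc)

lemma act_one [simp]: "act (mat 1) x = x"
  by (intro point_eqI) simp_all

lemma SL_det_nz: "S \<in> SL \<Longrightarrow> det S \<noteq> 0"
  by (auto simp: SL_def)

lemma SL_inv: "S \<in> SL \<Longrightarrow> matrix_inv S \<in> SL"
  by (simp add: SL_def det_matrix_inv)

lemma SL_mult: "S \<in> SL \<Longrightarrow> T \<in> SL \<Longrightarrow> S ** T \<in> SL"
  by (simp add: SL_def det_mul)

lemma SL_one: "mat 1 \<in> SL"
  by (simp add: SL_def)

lemma act_inv [simp]: "S \<in> SL \<Longrightarrow> act (matrix_inv S) (act S x) = x"
  and act_inv' [simp]: "S \<in> SL \<Longrightarrow> act S (act (matrix_inv S) x) = x"
  by (simp_all add: act_act matrix_inv SL_det_nz)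

lemma act_A0: "S \<in> SL \<Longrightarrow> x \<in> A0 \<Longrightarrow> act S x \<in> A0"
  by (simp add: A0_def SL_def det_mul)

lemma Gmat_A0_SL: "x \<in> A0 \<Longrightarrow> Gmat j x \<in> SL"
  by (simp add: A0_def)

lemma moment_map_act:
  assumes "S \<in> SL" "x \<in> A0"
  shows "moment_map (act S x) = S ** moment_map x ** matrix_inv S"
  unfolding moment_map_def matrix_mult_sum_left matrix_mult_sum_right
  by (intro sum.cong refl) (simp add: matrix_inv_mult SL_det_nz assms matrix_mul_assoc)

lemma act_level_set: "S \<in> SL \<Longrightarrow> x \<in> level_set \<Longrightarrow> act S x \<in> level_set"
  by (simp add: level_set_def act_A0 moment_map_act)

lemma left_triv_act:
  assumes "S \<in> SL" "x \<in> A0"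
  shows "left_triv j (act S x) (act S v) = left_triv j x v"
proof -
  have "left_triv j (act S x) (act S v) = matrix_inv (Gmat j x) ** (matrix_inv S ** (S ** Gmat j v))"
    using assms by (simp add: left_triv_def matrix_inv_mult SL_det_nz matrix_mul_assoc)
  then show ?thesis by (simp add: matrix_inv_cancel SL_det_nz assms left_triv_def)
qed

lemma omega_act: "S \<in> SL \<Longrightarrow> x \<in> A0 \<Longrightarrow> omega (act S x) (act S u) (act S w) = omega x u w"
  by (simp add: omega_def left_triv_act)

lemma TA0_act: "S \<in> SL \<Longrightarrow> x \<in> A0 \<Longrightarrow> u \<in> TA0 x \<Longrightarrow> act S u \<in> TA0 (act S x)"
  by (simp add: TA0_def left_triv_act[unfolded left_triv_def, simplified])

lemma bounded_linear_act: "bounded_linear (act S)"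
  by (rule linear_conv_bounded_linear[THEN iffD1], rule linearI; intro point_eqI)
    (simp_all add: Gmat_linear Lmat_linear matrix_add_ldistrib matrix_scalar_ac scalar_matrix_assoc)

text \<open>
  The velocity at \<open>x\<close> of the action of the one-parameter group generated by \<open>X\<close>.
\<close>

definition inf_action :: "'n cmat \<Rightarrow> ('N::finite, 'n::finite) point \<Rightarrow> ('N, 'n) point" where
  "inf_action X x = mk_point (\<lambda>j. X ** Gmat j x) (\<lambda>j. 0)"

lemma Gmat_inf_action [simp]: "Gmat j (inf_action X x) = X ** Gmat j x"
  and Lmat_infl [simp]: "Lmat j (inf_action X x) = 0"
  by (simp_all add: inf_action_def)

lemma trace_inv_conj: "det A \<noteq> 0 \<Longrightarrow> trace (matrix_inv A ** (X ** A)) = trace (X :: 'n::finite cmat)"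
  using trace_mul_sym[of "matrix_inv A" "X ** A"] by (simp add: matrix_inv_cancel)

lemma inf_action_TA0: "x \<in> A0 \<Longrightarrow> trace X = 0 \<Longrightarrow> inf_action X x \<in> TA0 x"
  by (simp add: TA0_def trace_inv_conj)

text \<open>
  The moment map equation \<open>\<omega>(X\<cdot>x, w) = - d tr (X \<mu>)(w)\<close>; it follows from the cyclicity of the trace.
\<close>

lemma omega_inf_action:
  fixes x :: "('N::finite, 'n::finite) point"
  assumes x: "x \<in> A0"
  shows "omega x (inf_action X x) w = - trace (X ** moment_deriv x w)"
proof -
  have "trace (Lmat j (inf_action X x) ** left_triv j x w) - trace (Lmat j w ** left_triv j x (inf_action X x))
     - trace (Lmat j x ** (left_triv j x (inf_action X x) ** left_triv j x w - left_triv j x w ** left_triv j x (inf_action X x)))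
    = - trace (X ** (Gmat j w ** Lmat j x ** matrix_inv (Gmat j x)
     + Gmat j x ** Lmat j w ** matrix_inv (Gmat j x)
     - Gmat j x ** Lmat j x ** (matrix_inv (Gmat j x) ** Gmat j w ** matrix_inv (Gmat j x))))" for j
  proof -
    define G where "G = Gmat j x"
    define H where "H = matrix_inv G"
    define L where "L = Lmat j x"
    define l where "l = Lmat j w"
    define W where "W = Gmat j w"
    have GH: "G ** (H ** A) = A" for A :: "'n cmat" using x by (simp add: G_def H_def matrix_inv_cancel)
    have 1: "trace (l ** (H ** (X ** G))) = trace (X ** (G ** (l ** H)))"
      using trace_mul_sym[of "l ** H" "X ** G"] by (simp add: matrix_mul_assoc)
    have 2: "trace (L ** (H ** (X ** (G ** (H ** W))))) = trace (X ** (W ** (L ** H)))"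
      unfolding GH using trace_mul_sym[of "L ** H" "X ** W"] by (simp add: matrix_mul_assoc)
    have 3: "trace (L ** (H ** (W ** (H ** (X ** G))))) = trace (X ** (G ** (L ** (H ** (W ** H)))))"
      using trace_mul_sym[of "L ** H ** W ** H" "X ** G"] by (simp add: matrix_mul_assoc)
    show ?thesis
      unfolding left_triv_def Gmat_inf_action Lmat_infl G_def[symmetric] H_def[symmetric] L_def[symmetric] l_def[symmetric] W_def[symmetric]
      using 1 2 3
      by (simp only: matrix_mult_zero trace_zero matrix_diff_distrib matrix_add_ldistrib trace_add trace_sub
          matrix_mul_assoc[symmetric]) simp
  qed
  then show ?thesis
    unfolding omega_def moment_deriv_def matrix_mult_sum_right trace_sum sum_negf[symmetric] by simp
qed

lemma trace_moment_deriv: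
  assumes x: "x \<in> A0" and w: "w \<in> TA0 x"
  shows "trace (moment_deriv x w) = 0"
proof -
  have "trace (Gmat j w ** Lmat j x ** matrix_inv (Gmat j x)
     + Gmat j x ** Lmat j w ** matrix_inv (Gmat j x)
     - Gmat j x ** Lmat j x ** (matrix_inv (Gmat j x) ** Gmat j w ** matrix_inv (Gmat j x))) = 0" for j
  proof -
    have "trace (Gmat j x ** Lmat j w ** matrix_inv (Gmat j x)) = 0"
      using w x by (simp add: trace_conj TA0_def)
    moreover have "trace (Gmat j x ** Lmat j x ** (matrix_inv (Gmat j x) ** Gmat j w ** matrix_inv (Gmat j x)))
       = trace (Gmat j w ** Lmat j x ** matrix_inv (Gmat j x))"
      using trace_mul_sym[of "Gmat j x ** Lmat j x ** matrix_inv (Gmat j x) ** Gmat j w" "matrix_inv (Gmat j x)"]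
        trace_mul_sym[of "Lmat j x ** matrix_inv (Gmat j x)" "Gmat j w"] x
      by (simp add: matrix_mul_assoc matrix_inv)
    ultimately show ?thesis by (simp add: trace_add trace_sub)
  qed
  then show ?thesis by (simp add: moment_deriv_def trace_sum)
qed

text \<open>
  The trace form on the traceless matrices is non-degenerate.
\<close>

lemma matrix_eq_zero_trace:
  fixes M :: "'n::finite cmat"
  assumes "\<And>X. trace X = 0 \<Longrightarrow> trace (X ** M) = 0" "trace M = 0"
  shows "M = 0"
proof -
  have all: "trace (X ** M) = 0" for X :: "'n cmat"
  proof -
    define c where "c = trace X / of_nat CARD('n)"
    have "trace (X - mat c) = 0" by (simp add: trace_sub c_def) (simp add: trace_def mat_def)
    from assms(1)[OF this] show ?thesis
      by (simp add: matrix_diff_distrib trace_sub trace_mat_mult assms(2))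
  qed
  have "M $ a $ b = 0" for a b
  proof -
    have "trace (elem_mat b a ** M) = (\<Sum>k\<in>UNIV. if k = b then M $ a $ b else 0)"
      unfolding trace_def matrix_matrix_mult_def
      by (intro sum.cong refl) (simp add: elem_mat_def if_distrib[of "\<lambda>x. x * _"] cong: if_cong)
    then show ?thesis using all[of "elem_mat b a"] by simp
  qed
  then show ?thesis by (simp add: vec_eq_iff)
qed

lemma curve_act:
  assumes S: "curve_at SL (mat 1) X S" and x: "x \<in> X0" and X0: "\<And>T. T \<in> SL \<Longrightarrow> act T x \<in> X0"
  shows "curve_at X0 x (inf_action X x) (\<lambda>t. act (S t) x)"
proof -
  have S': "(S has_vector_derivative X) (at 0)" "S 0 = mat 1" "\<And>t. S t \<in> SL"
    using S by (auto simp: curve_at_def)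
  have split: "act T x = inf_action T x + act 0 x" for T
    by (intro point_eqI) (simp_all add: Gmat_linear Lmat_linear)
  have "linear (\<lambda>T. inf_action T x)"
    by (rule linearI; intro point_eqI)
      (simp_all add: Gmat_linear Lmat_linear matrix_add_rdistrib scalar_matrix_assoc)
  then have "bounded_linear (\<lambda>T. inf_action T x)" by (simp add: linear_conv_bounded_linear)
  from bounded_linear.has_vector_derivative[OF this S'(1)]
  have "((\<lambda>t. inf_action (S t) x) has_vector_derivative inf_action X x) (at 0)" .
  from has_vector_derivative_add[OF this has_vector_derivative_const[of "act 0 x"]]
  have "((\<lambda>t. act (S t) x) has_vector_derivative inf_action X x) (at 0)" by (simp add: split[symmetric])
  then show ?thesis using S' X0 by (simp add: curve_at_def)
qed

lemma holo_moment_map: "x \<in> A0 \<Longrightarrow> holo (\<lambda>y. moment_map y $ a $ b) x"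
  unfolding moment_map_def sum_component by (intro holo_sum holo_matrix_mult holo_Gmat_nth holo_Lmat_nth holo_inv_Gmat_nth) simp

lemma holo_trace_moment_map: "x \<in> A0 \<Longrightarrow> holo (\<lambda>y. trace (X ** moment_map y)) x"
  unfolding trace_def by (intro holo_sum holo_matrix_mult holo_moment_map holo_const)

lemma differential_has_derivative:
  assumes f: "hol_at X f x" and v: "v \<in> tangent X x" and D: "(f has_derivative D) (at x)"
  shows "differential X f x v = D v"
proof -
  obtain \<gamma> where \<gamma>: "curve_at X x v \<gamma>" using v unfolding tangent_def by blast
  have \<gamma>': "(\<gamma> has_vector_derivative v) (at 0)" "\<gamma> 0 = x" using \<gamma> by (auto simp: curve_at_def)
  show ?thesis
    by (rule differential_unique[OF f \<gamma> has_vector_derivative_compose[OF \<gamma>'(1)]]) (simp add: \<gamma>' D)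
qed

lemma ham_vector_moment:
  assumes x: "x \<in> A0" and X: "trace X = 0"
  shows "ham_vector (\<lambda>y. trace (X ** moment_map y)) x = inf_action X x"
proof (rule ham_vector_eq[OF x])
  have D: "((\<lambda>y. trace (X ** moment_map y)) has_derivative (\<lambda>v. trace (X ** moment_deriv x v))) (at x)"
    by (intro has_derivative_trace
        bounded_linear.has_derivative[OF bounded_bilinear.bounded_linear_right[OF bounded_bilinear_matrix_mult]]
        has_derivative_moment_map A0_det_nz x)
  show "is_ham_vector (\<lambda>y. trace (X ** moment_map y)) x (inf_action X x)"
    unfolding is_ham_vector_def
    using inf_action_TA0[OF x X] omega_inf_action[OF x]
      differential_has_derivative[OF hol_at_holo[OF holo_trace_moment_map[OF x]] _ D] tangent_A0[OF x]
    by simp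
qed

lemma is_moment_map_moment_map:
  fixes B :: "('N::finite, 'n::{finite, linorder}) bracket"
  assumes B: "A0_poisson_structure B"
  shows "is_moment_map B moment_map"
  unfolding is_moment_map_def
proof (intro ballI conjI allI impI)
  fix x :: "('N, 'n) point" assume x: "x \<in> A0"
  show "trace (moment_map x) = 0" by (rule trace_moment_map[OF x])
  show "moment_map (act S x) = S ** moment_map x ** matrix_inv S" if "S \<in> SL" for S :: "'n cmat"
    by (rule moment_map_act[OF that x])
  show "hol_at A0 (\<lambda>y. trace (X ** moment_map y)) x" for X
    by (rule hol_at_holo[OF holo_trace_moment_map[OF x]])
  fix X :: "'n cmat" and S f assume "curve_at SL (mat 1) X S \<and> hol_at A0 f x"
  then have S: "curve_at SL (mat 1) X S" and f: "hol_at A0 f x" by auto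
  have "X \<in> tangent SL (mat 1)" using S unfolding tangent_def by blast
  then have X: "trace X = 0" by (simp add: tangent_SL)
  have "B (\<lambda>y. trace (X ** moment_map y)) f x = differential A0 f x (inf_action X x)"
    using bracket_ham_vector[OF B x hol_at_holo[OF holo_trace_moment_map[OF x]] f, of X] ham_vector_moment[OF x X] by simp
  then show "((\<lambda>t. f (act (S t) x)) has_vector_derivative B (\<lambda>y. trace (X ** moment_map y)) f x) (at 0)"
    using differential_curve[OF f curve_act[OF S x act_A0[OF _ x]]] by simp
qed

section \<open>Orbits\<close>

lemma proj_eq: "x \<in> level_set \<Longrightarrow> proj x = (\<lambda>S. act S x) ` SL"
  by (auto simp: proj_def orbit_rel_def act_level_set)

lemma proj_self: "x \<in> level_set \<Longrightarrow> x \<in> proj x"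
  unfolding proj_eq by (rule image_eqI[of _ _ "mat 1"]) (simp_all add: SL_one)

lemma proj_act:
  assumes S: "S \<in> SL" and x: "x \<in> level_set"
  shows "proj (act S x) = proj x"
proof -
  have "act T x \<in> (\<lambda>S'. act S' (act S x)) ` SL" if "T \<in> SL" for T
  proof (rule image_eqI)
    show "T ** matrix_inv S \<in> SL" by (intro SL_mult SL_inv S that)
    show "act T x = act (T ** matrix_inv S) (act S x)"
      by (simp add: act_act[of "T ** _"] matrix_inv_cancel SL_det_nz[OF S])
  qed
  then show ?thesis
    unfolding proj_eq[OF x] proj_eq[OF act_level_set[OF S x]] by (auto simp: act_act SL_mult S)
qed

lemma A_space_eq: "A_space = proj ` level_set"
  by (auto simp: A_space_def quotient_def proj_def)

lemma A_space_level_set: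
  assumes "a \<in> A_space" "x \<in> a"
  shows "x \<in> level_set" "a = proj x"
proof -
  obtain y where y: "y \<in> level_set" "a = proj y" using assms(1) unfolding A_space_eq by blast
  then obtain S where "S \<in> SL" "x = act S y" using assms(2) by (auto simp: proj_eq)
  then show "x \<in> level_set" "a = proj x" using y by (simp_all add: act_level_set proj_act)
qed

lemma A_space_nonempty: "a \<in> A_space \<Longrightarrow> \<exists>x. x \<in> a"
  unfolding A_space_eq using proj_self by blast

text \<open>
  Along a curve in the orbit, the group element can be read off from any single \<open>G\<^sub>j\<close>, because \<open>G\<^sub>j\<close> is
  invertible; hence it is differentiable at \<open>0\<close>.
\<close>

lemma tangent_orbit:
  fixes x :: "('N::finite, 'n::finite) point"
  assumes x: "x \<in> level_set"
  shows "tangent (proj x) x = {inf_action X x |X. trace X = 0}"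
proof (intro antisym subsetI)
  fix v assume "v \<in> tangent (proj x) x"
  then obtain \<gamma> where \<gamma>: "curve_at (proj x) x v \<gamma>" unfolding tangent_def by blast
  have xA: "x \<in> A0" by (rule level_set_A0[OF x])
  have der: "(\<gamma> has_vector_derivative v) (at 0)" using \<gamma> by (simp add: curve_at_def)
  define j0 :: 'N where "j0 = (SOME j. True)"
  define X where "X = Gmat j0 v ** matrix_inv (Gmat j0 x)"
  have G: "Gmat j y = Gmat j0 y ** matrix_inv (Gmat j0 x) ** Gmat j x" if y: "y \<in> proj x" for y j
  proof -
    obtain S where S: "y = act S x" using y by (auto simp: proj_eq[OF x])
    show ?thesis unfolding S Gmat_act using xA by (simp add: matrix_inv_cancel)
  qed
  have L: "Lmat j y = Lmat j x" if y: "y \<in> proj x" for y j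
    using y by (auto simp: proj_eq[OF x])
  have Gv: "Gmat j v = X ** Gmat j x" for j
  proof -
    have D: "((\<lambda>y. Gmat j y - Gmat j0 y ** (matrix_inv (Gmat j0 x) ** Gmat j x)) has_derivative
       (\<lambda>v. Gmat j v - Gmat j0 v ** (matrix_inv (Gmat j0 x) ** Gmat j x))) (at x)"
      by (intro has_derivative_diff has_derivative_Gmat
          bounded_linear.has_derivative[OF bounded_bilinear.bounded_linear_left[OF bounded_bilinear_matrix_mult]])
    have "Gmat j v - Gmat j0 v ** (matrix_inv (Gmat j0 x) ** Gmat j x) = 0"
      by (rule const_along_curve[OF \<gamma> D]) (use G[of _ j] in \<open>simp add: matrix_mul_assoc\<close>)
    then show ?thesis by (simp add: X_def matrix_mul_assoc)
  qed
  have Lv: "Lmat j v = 0" for j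
  proof -
    have "((\<lambda>y. Lmat j y - Lmat j x) has_derivative (\<lambda>v. Lmat j v - 0)) (at x)"
      by (intro has_derivative_diff has_derivative_Lmat has_derivative_const)
    from const_along_curve[OF \<gamma> this, of 0] show ?thesis by (simp add: L)
  qed
  have v: "v = inf_action X x" by (intro point_eqI) (simp_all add: Gv Lv)
  have "curve_at A0 x v \<gamma>"
  proof -
    have "proj x \<subseteq> A0" unfolding proj_eq[OF x] using act_A0[OF _ xA] by blast
    then show ?thesis using \<gamma> by (auto simp: curve_at_def)
  qed
  then have "v \<in> TA0 x" using tangent_A0[OF xA] unfolding tangent_def by blast
  then have "trace (matrix_inv (Gmat j0 x) ** (X ** Gmat j0 x)) = 0" by (simp add: TA0_def Gv)
  then have "trace X = 0" using xA by (simp add: trace_inv_conj)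
  with v show "v \<in> {inf_action X x |X. trace X = 0}" by blast
next
  fix v assume "v \<in> {inf_action X x |X. trace X = 0}"
  then obtain X where X: "v = inf_action X x" "trace X = 0" by blast
  then have "X \<in> tangent SL (mat 1)" by (simp add: tangent_SL)
  then obtain S where "curve_at SL (mat 1) X S" unfolding tangent_def by blast
  then have "curve_at (proj x) x v (\<lambda>t. act (S t) x)"
    unfolding X(1)
  proof (rule curve_act)
    show "x \<in> proj x" by (rule proj_self[OF x])
    show "act T x \<in> proj x" if "T \<in> SL" for T using that by (simp add: proj_eq[OF x])
  qed
  then show "v \<in> tangent (proj x) x" unfolding tangent_def by blast
qed

section \<open>The descended forms\<close>

lemma moment_section_smult: "moment_section x (mat c ** s) = c *s moment_section x s"
proof -
  have o: "ad_inverse L (mat c ** A) = mat c ** ad_inverse L A" for L A :: "'b cmat"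
    by (simp add: ad_inverse_def vec_eq_iff mat_mult_nth)
  have d: "traceless_diag (mat c ** A) = mat c ** traceless_diag A" for A :: "'b cmat"
    by (simp add: traceless_diag_def vec_eq_iff mat_mult_nth trace_mat_mult right_diff_distrib)
  show ?thesis
    by (intro point_eqI)
      (simp_all add: Gmat_linear Lmat_linear moment_section_def Let_def mat_mult_right matrix_mul_assoc[symmetric] o d)
qed

lemma elem_mat_expansion: "(s :: 'n::finite cmat) = (\<Sum>a\<in>UNIV. \<Sum>b\<in>UNIV. mat (s $ a $ b) ** elem_mat a b)"
  unfolding vec_eq_iff sum_component mat_mult_nth
proof (intro allI)
  fix i k
  have "(\<Sum>b\<in>UNIV. s $ a $ b * elem_mat a b $ i $ k) = (if a = i then s $ i $ k else 0)" for a
    by (cases "a = i") (simp_all add: elem_mat_def if_distrib[of "\<lambda>x. _ * x"] cong: if_cong)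
  then show "s $ i $ k = (\<Sum>a\<in>UNIV. \<Sum>b\<in>UNIV. s $ a $ b * elem_mat a b $ i $ k)" by simp
qed

lemma omega_linear_right: "omega x w (c *s u + v) = c * omega x w u + omega x w v"
  using omega_linear[of x c u v w] omega_skew[of x w] by (simp add: algebra_simps)

lemma linear_functional_trace:
  fixes h :: "'n::finite cmat \<Rightarrow> complex"
  assumes add: "\<And>s t. h (s + t) = h s + h t" and mult: "\<And>c s. h (mat c ** s) = c * h s"
  obtains X where "\<And>s. h s = trace (X ** s)"
proof -
  define X where "X = (\<chi> b a. h (elem_mat a b))"
  have zero: "h 0 = 0" using mult[of 0 0] by simp
  have sum: "h (\<Sum>i\<in>I. f i) = (\<Sum>i\<in>I. h (f i))" for f and I :: "'n set"
    by (induction I rule: infinite_finite_induct) (simp_all add: zero add)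
  have "h s = trace (X ** s)" for s
  proof -
    have "h s = h (\<Sum>a\<in>UNIV. \<Sum>b\<in>UNIV. mat (s $ a $ b) ** elem_mat a b)"
      by (simp only: elem_mat_expansion[symmetric])
    also have "\<dots> = (\<Sum>a\<in>UNIV. \<Sum>b\<in>UNIV. s $ a $ b * h (elem_mat a b))"
      by (simp only: sum mult)
    also have "\<dots> = trace (X ** s)"
      unfolding trace_def matrix_matrix_mult_def by (subst sum.swap) (simp add: X_def mult.commute)
    finally show ?thesis .
  qed
  from that[OF this] show ?thesis .
qed

lemma moment_deriv_add: "moment_deriv x (u + v) = moment_deriv x u + moment_deriv x v"
  unfolding moment_deriv_def sum.distrib[symmetric]
  by (intro sum.cong refl)
    (simp add: Gmat_linear Lmat_linear matrix_add_ldistrib matrix_add_rdistrib algebra_simps)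

lemma moment_deriv_diff: "moment_deriv x (u - v) = moment_deriv x u - moment_deriv x v"
  using moment_deriv_add[of x "u - v" v] by (simp add: algebra_simps)

lemma TA0_diff: "u \<in> TA0 x \<Longrightarrow> v \<in> TA0 x \<Longrightarrow> u - v \<in> TA0 x"
  using TA0_add[OF _ TA0_smult[of v x "-1"], of u] by simp

text \<open>
  On the tangent space, \<open>omega x u\<close> vanishes on the kernel of the surjection \<open>moment_deriv x\<close> and so factors
  through it.  A linear functional on matrices is \<open>- tr (X \<cdot>)\<close> for some \<open>X\<close>, and by the moment map equation
  this is also the form evaluated at the action of \<open>X\<close>.
\<close>

lemma omega_trace_factor:
  fixes x :: "('N::finite, 'n::finite) point"
  assumes x: "x \<in> A0" and u: "u \<in> TA0 x"
    and ker: "\<And>w. w \<in> TA0 x \<Longrightarrow> moment_deriv x w = 0 \<Longrightarrow> omega x u w = 0"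
  obtains X where "trace X = 0" "u = inf_action X x"
proof -
  have "\<exists>X. \<forall>s. - omega x u (moment_section x s) = trace (X ** s)"
  proof -
    have 1: "- omega x u (moment_section x (s + t)) = - omega x u (moment_section x s) + - omega x u (moment_section x t)" for s t
      using omega_linear_right[of x u 1 "moment_section x s" "moment_section x t"] by (simp add: linear_add[OF linear_moment_section])
    have 2: "- omega x u (moment_section x (mat c ** s)) = c * - omega x u (moment_section x s)" for c s
      using omega_linear_right[of x u c "moment_section x s" 0] omega_linear_right[of x u 1 0 0] by (simp add: moment_section_smult)
    show ?thesis using linear_functional_trace[of "\<lambda>s. - omega x u (moment_section x s)", OF 1 2] by blast
  qed
  then obtain X where X: "\<And>s. - omega x u (moment_section x s) = trace (X ** s)" by blast
  define X0 where "X0 = X - mat (trace X / of_nat CARD('n))"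
  have tr0: "trace X0 = 0" by (simp add: X0_def trace_sub) (simp add: trace_def mat_def)
  have "u = inf_action X0 x"
  proof (rule omega_nondegenerate[OF x u inf_action_TA0[OF x tr0]])
    fix w assume w: "w \<in> TA0 x"
    define s where "s = moment_deriv x w"
    have trs: "trace s = 0" unfolding s_def by (rule trace_moment_deriv[OF x w])
    have "mat 0 = (0 :: 'n cmat)" by (simp add: mat_def vec_eq_iff)
    then have "moment_deriv x (w - moment_section x s) = 0" by (simp add: moment_deriv_diff moment_deriv_moment_section[OF x] trs s_def[symmetric])
    then have "omega x u (w - moment_section x s) = 0" by (intro ker TA0_diff w moment_section_TA0 x)
    then have "omega x u w = omega x u (moment_section x s)"
      using omega_linear_right[of x u 1 "w - moment_section x s" "moment_section x s"] by simp
    also have "\<dots> = - trace (X ** s)" unfolding X[of s, symmetric] by simp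
    also have "\<dots> = - trace (X0 ** s)"
      by (simp add: X0_def matrix_diff_distrib trace_sub trace_mat_mult trs)
    also have "\<dots> = omega x (inf_action X0 x) w" by (simp add: omega_inf_action[OF x] s_def)
    finally show "omega x u w = omega x (inf_action X0 x) w" .
  qed
  from that[OF tr0 this] show ?thesis .
qed

lemma descends1_theta_A: "descends1 (theta_A :: ('N::finite, 'n::finite) point \<Rightarrow> _)"
  unfolding descends1_def
proof (intro ballI conjI)
  fix a and x :: "('N, 'n) point" assume "a \<in> A_space" "x \<in> a"
  note x = A_space_level_set[OF this]
  have xA: "x \<in> A0" by (rule level_set_A0[OF x(1)])
  show "theta_A x v = 0" if v: "v \<in> tangent a x" for v
  proof -
    obtain X where X: "v = inf_action X x" using v unfolding x(2) tangent_orbit[OF x(1)] by blast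
    have "theta_A x v = (\<Sum>j\<in>UNIV. trace (X ** (Gmat j x ** Lmat j x ** matrix_inv (Gmat j x))))"
      unfolding theta_A_def X
    proof (rule sum.cong)
      fix j
      show "trace (Lmat j x ** matrix_inv (Gmat j x) ** Gmat j (inf_action X x))
         = trace (X ** (Gmat j x ** Lmat j x ** matrix_inv (Gmat j x)))"
        using trace_mul_sym[of "Lmat j x ** matrix_inv (Gmat j x)" "X ** Gmat j x"]
        by (simp add: matrix_mul_assoc)
    qed simp
    also have "\<dots> = trace (X ** moment_map x)"
      by (simp only: moment_map_def matrix_mult_sum_right trace_sum)
    finally show ?thesis using x(1) by (simp add: level_set_def)
  qed
  show "theta_A (act S x) (act S v) = theta_A x v" if "S \<in> SL" for S v
    by (simp add: theta_A_left_triv left_triv_act[OF that xA])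
qed

lemma symplectic_form_A_ext_d1_theta_A:
  "symplectic_form_A (ext_d1 (theta_A :: ('N::finite, 'n::finite) point \<Rightarrow> ('N, 'n) point \<Rightarrow> complex))"
  unfolding symplectic_form_A_def descends2_def
proof (intro ballI conjI allI impI)
  fix a and x :: "('N, 'n) point" assume "a \<in> A_space" "x \<in> a"
  note x = A_space_level_set[OF this]
  have xA: "x \<in> A0" by (rule level_set_A0[OF x(1)])
  have e: "ext_d1 theta_A x = omega x" by (intro ext ext_d1_theta_A) (simp add: xA)
  note T = tangent_level_set[OF x(1)]
  show "ext_d1 theta_A x u v = 0" if "u \<in> tangent a x" "v \<in> tangent level_set x" for u v
    using that unfolding x(2) tangent_orbit[OF x(1)] T e by (auto simp: omega_inf_action[OF xA])
  show "ext_d1 theta_A (act S x) (act S u) (act S v) = ext_d1 theta_A x u v" if S: "S \<in> SL" for S u v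
  proof -
    have "ext_d1 theta_A (act S x) = omega (act S x)"
      by (intro ext ext_d1_theta_A) (simp add: act_A0[OF S xA] del: Gmat_act)
    then show ?thesis by (simp add: e omega_act[OF S xA])
  qed
  show "ext_d1 theta_A x u v = - ext_d1 theta_A x v u" for u v
    unfolding e by (rule omega_skew)
  show "ext_d1 theta_A x (c *s u + v) w = c * ext_d1 theta_A x u w + ext_d1 theta_A x v w" for c u v w
    unfolding e by (rule omega_linear)
  show "ext_d2 (ext_d1 theta_A) x u v w = 0" for u v w
    by (rule ext_d2_ext_d1_theta_A) (simp add: xA)
  show "u \<in> tangent a x" if u: "u \<in> tangent level_set x"
    and z: "\<forall>v\<in>tangent level_set x. ext_d1 theta_A x u v = 0" for u
  proof -
    obtain X where "trace X = 0" "u = inf_action X x"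
      by (rule omega_trace_factor[OF xA, of u]) (use u z in \<open>auto simp: T e\<close>)
    then show ?thesis unfolding x(2) tangent_orbit[OF x(1)] by blast
  qed
qed

section \<open>Invariant lifts\<close>

text \<open>
  The point of the orbit of \<open>y\<close> at which one chosen \<open>G\<^sub>j\<close> takes its value at \<open>x\<close>.  These points form a global
  slice of the action through \<open>x\<close>.
\<close>

definition slice :: "('N::finite, 'n::finite) point \<Rightarrow> ('N, 'n) point \<Rightarrow> ('N, 'n) point" where
  "slice x y = act (Gmat (SOME j. True) x ** matrix_inv (Gmat (SOME j. True) y)) y"

lemma slice_self: "x \<in> A0 \<Longrightarrow> slice x x = x"
  by (simp add: slice_def matrix_inv)

lemma slice_SL: "x \<in> A0 \<Longrightarrow> y \<in> A0 \<Longrightarrow> Gmat j x ** matrix_inv (Gmat j y) \<in> SL"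
  by (intro SL_mult SL_inv Gmat_A0_SL)

lemma slice_act: "S \<in> SL \<Longrightarrow> y \<in> A0 \<Longrightarrow> slice x (act S y) = slice x y"
  by (simp add: slice_def act_act matrix_inv_mult SL_det_nz matrix_mul_assoc[symmetric] matrix_inv)

lemma slice_level_set: "x \<in> A0 \<Longrightarrow> y \<in> level_set \<Longrightarrow> slice x y \<in> level_set"
  unfolding slice_def by (intro act_level_set slice_SL) (simp_all add: level_set_A0)

lemma proj_slice: "x \<in> A0 \<Longrightarrow> y \<in> level_set \<Longrightarrow> proj (slice x y) = proj y"
  unfolding slice_def by (intro proj_act slice_SL) (simp_all add: level_set_A0)

lemma holo_slice_nth:
  assumes y: "y \<in> A0"
  shows "holo (\<lambda>y. slice x y $ i) y"
proof (cases i rule: index_cases)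
  case (1 j a b)
  show ?thesis unfolding 1 Gmat_nth[symmetric] slice_def Gmat_act
    by (intro holo_matrix_mult holo_const holo_inv_Gmat_nth holo_Gmat_nth) (simp add: y)
next
  case (2 j a b)
  show ?thesis unfolding 2 Lmat_nth[symmetric] slice_def Lmat_act by (rule holo_Lmat_nth)
qed

lemma isCont_slice: "y \<in> A0 \<Longrightarrow> isCont (slice x) y"
  unfolding isCont_def
  by (rule vec_tendstoI) (use cdiff_isCont[OF holo_imp_cdiff[OF holo_slice_nth]] in \<open>simp add: isCont_def\<close>)

text \<open>
  Any local holomorphic extension becomes invariant when it is composed with \<open>slice x\<close>.
\<close>

lemma invariant_lift_exists:
  assumes x: "x \<in> level_set" and \<phi>: "hol_A \<phi> (proj x)"
  shows "\<exists>F. invariant_lift \<phi> x F"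
proof -
  have xA: "x \<in> A0" by (rule level_set_A0[OF x])
  have "hol_at level_set (\<lambda>y. \<phi> (proj y)) x"
    using \<phi> proj_self[OF x] unfolding hol_A_def by blast
  then obtain F0 where F0: "holo F0 x" "\<forall>\<^sub>F y in nhds x. y \<in> level_set \<longrightarrow> F0 y = \<phi> (proj y)"
    unfolding hol_at_iff by blast
  have "\<forall>\<^sub>F y in nhds x. holo F0 y \<and> (y \<in> level_set \<longrightarrow> F0 y = \<phi> (proj y))"
    using holo_eventually[OF F0(1)] F0(2) by (rule eventually_conj)
  then obtain U where U: "open U" "x \<in> U" "\<And>y. y \<in> U \<Longrightarrow> holo F0 y"
     "\<And>y. y \<in> U \<Longrightarrow> y \<in> level_set \<Longrightarrow> F0 y = \<phi> (proj y)"
    unfolding eventually_nhds by blast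
  define W where "W = A0 \<inter> slice x -` U"
  have "invariant_lift \<phi> x (\<lambda>y. F0 (slice x y))"
    unfolding invariant_lift_def
  proof (intro exI[of _ W] conjI ballI)
    have "continuous_on A0 (slice x)"
      by (intro continuous_at_imp_continuous_on ballI isCont_slice)
    then show "openin (top_of_set A0) W"
      unfolding W_def using U(1) by (rule continuous_openin_preimage_gen)
    show "x \<in> W" by (simp add: W_def xA slice_self U)
    show "hol_at A0 (\<lambda>y. F0 (slice x y)) y" if "y \<in> W" for y
      by (rule hol_at_holo, rule holo_compose) (use that in \<open>auto simp: W_def intro: holo_slice_nth U(3)\<close>)
    show "act S y \<in> W" "F0 (slice x (act S y)) = F0 (slice x y)" if "S \<in> SL" "y \<in> W" for S y
      using that by (simp_all add: W_def act_A0 slice_act)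
    show "F0 (slice x y) = \<phi> (proj y)" if "y \<in> W \<inter> level_set" for y
      using that U(4)[of "slice x y"] slice_level_set[OF xA] proj_slice[OF xA] by (simp add: W_def)
  qed
  then show ?thesis by blast
qed

lemma eventually_openin:
  assumes "openin (top_of_set X) W" "y \<in> W"
  shows "\<forall>\<^sub>F z in nhds y. z \<in> X \<longrightarrow> z \<in> W"
proof -
  obtain U where "open U" "W = X \<inter> U" using assms(1) by (auto simp: openin_open)
  then show ?thesis using eventually_nhds_in_open[of U y] assms(2) by (auto elim: eventually_mono)
qed

lemma openin_A0_subset: "openin (top_of_set A0) W \<Longrightarrow> y \<in> W \<Longrightarrow> y \<in> A0"
  using openin_imp_subset by blast

lemma invariant_lift_hol: "invariant_lift \<phi> x F \<Longrightarrow> hol_at A0 F x"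
  unfolding invariant_lift_def by blast

lemma invariant_lift_transport:
  assumes F: "invariant_lift \<phi> x F" and S: "S \<in> SL"
  shows "invariant_lift \<phi> (act S x) F"
  using F S unfolding invariant_lift_def by blast

text \<open>
  The domain of a lift is invariant, so that a single lift is an extension near every point of the orbit.
\<close>

lemma hol_A_of_lift:
  assumes x: "x \<in> level_set" and F: "invariant_lift \<phi> x F"
  shows "hol_A \<phi> (proj x)"
  unfolding hol_A_def
proof
  fix y assume "y \<in> proj x"
  then obtain S where S: "S \<in> SL" "y = act S x" unfolding proj_eq[OF x] by blast
  obtain W where W: "openin (top_of_set A0) W" "y \<in> W" "\<And>y. y \<in> W \<Longrightarrow> hol_at A0 F y"
    "\<And>y. y \<in> W \<inter> level_set \<Longrightarrow> F y = \<phi> (proj y)"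
    using invariant_lift_transport[OF F S(1)] unfolding S(2) invariant_lift_def by blast
  have "hol_at level_set F y"
    by (rule hol_at_subset[OF W(3)[OF W(2)]]) (use level_set_A0 in blast)
  moreover have "\<forall>\<^sub>F z in nhds y. z \<in> level_set \<longrightarrow> F z = \<phi> (proj z)"
    using eventually_openin[OF W(1,2)] by eventually_elim (auto intro: W(4) level_set_A0)
  ultimately show "hol_at level_set (\<lambda>y. \<phi> (proj y)) y" by (rule hol_at_cong)
qed

section \<open>The reduced bracket\<close>

text \<open>
  Move curves through \<open>x\<close> by \<open>S\<close>.
\<close>

lemma differential_act:
  assumes x: "x \<in> A0" and S: "S \<in> SL" and w: "w \<in> tangent A0 x"
    and f: "hol_at A0 f x" and f': "hol_at A0 f (act S x)"
    and inv: "\<forall>\<^sub>F y in nhds x. y \<in> A0 \<longrightarrow> f (act S y) = f y"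
  shows "differential A0 f (act S x) (act S w) = differential A0 f x w"
proof -
  obtain \<gamma> where \<gamma>: "curve_at A0 x w \<gamma>" using w unfolding tangent_def by blast
  have \<gamma>': "(\<gamma> has_vector_derivative w) (at 0)" "\<gamma> 0 = x" "\<And>t. \<gamma> t \<in> A0"
    using \<gamma> by (auto simp: curve_at_def)
  have S\<gamma>: "curve_at A0 (act S x) (act S w) (\<lambda>t. act S (\<gamma> t))"
    using \<gamma>' S by (simp add: curve_at_def act_A0 bounded_linear.has_vector_derivative[OF bounded_linear_act])
  have "isCont \<gamma> 0"
    by (rule has_derivative_continuous[OF \<gamma>'(1)[unfolded has_vector_derivative_def]])
  from eventually_compose_filterlim[OF inv isCont_filterlim_nhds[OF this, unfolded \<gamma>'(2)]]
  have "\<forall>\<^sub>F t in nhds 0. f (\<gamma> t) = f (act S (\<gamma> t))"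
    by (rule eventually_mono) (simp add: \<gamma>'(3))
  from has_derivative_transform_nhds[OF differential_curve[OF f \<gamma>, unfolded has_vector_derivative_def] this]
  have "((\<lambda>t. f (act S (\<gamma> t))) has_vector_derivative differential A0 f x w) (at 0)"
    unfolding has_vector_derivative_def .
  from differential_unique[OF f' S\<gamma> this] show ?thesis .
qed

lemma ham_vector_act:
  assumes x: "x \<in> A0" and S: "S \<in> SL"
    and f: "hol_at A0 f x" and f': "hol_at A0 f (act S x)"
    and inv: "\<forall>\<^sub>F y in nhds x. y \<in> A0 \<longrightarrow> f (act S y) = f y"
  shows "ham_vector f (act S x) = act S (ham_vector f x)"
proof (rule ham_vector_eq[OF act_A0[OF S x]])
  have h: "ham_vector f x \<in> TA0 x" using ham_vector_tangent[OF x f] tangent_A0[OF x] by simp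
  show "is_ham_vector f (act S x) (act S (ham_vector f x))"
    unfolding is_ham_vector_def
  proof (intro conjI ballI)
    show "act S (ham_vector f x) \<in> TA0 (act S x)" by (rule TA0_act[OF S x h])
    fix w assume w: "w \<in> TA0 (act S x)"
    define v where "v = act (matrix_inv S) w"
    have v: "v \<in> TA0 x" and wv: "w = act S v"
      using TA0_act[OF SL_inv[OF S] act_A0[OF S x] w] S by (simp_all add: v_def)
    show "omega (act S x) (act S (ham_vector f x)) w = - differential A0 f (act S x) w"
      using differential_act[OF x S _ f f' inv, of v] v tangent_A0[OF x] omega_ham_vector[OF x f v]
      unfolding wv by (simp add: omega_act[OF S x])
  qed
qed

text \<open>
  A representative and two lifts are chosen arbitrarily; \<open>reduced_bracket_lift\<close> shows that the value does
  not depend on them.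
\<close>

definition reduced_bracket :: "('N, 'n) bracket \<Rightarrow> ('N::finite, 'n::finite) red_bracket" where
  "reduced_bracket B \<phi> \<psi> a = (let x = SOME x. x \<in> a in
     B (SOME F. invariant_lift \<phi> x F) (SOME H. invariant_lift \<psi> x H) x)"

context
  fixes B :: "('N::finite, 'n::{finite, linorder}) bracket"
  assumes B: "A0_poisson_structure B"
begin

lemma B_bider: "skew_biderivation A0 B"
  using B poisson_bracket_imp_skew_biderivation unfolding A0_poisson_structure_def by blast

text \<open>
  An invariant function is constant in the directions of the action.  By the moment map equation this says
  that its Hamiltonian vector is in the kernel of the differential of the moment map.
\<close>

lemma ham_vector_lift_tangent:
  assumes x: "x \<in> level_set" and F: "invariant_lift \<phi> x F"
  shows "ham_vector F x \<in> tangent level_set x"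
proof -
  have xA: "x \<in> A0" by (rule level_set_A0[OF x])
  have hF: "hol_at A0 F x" by (rule invariant_lift_hol[OF F])
  have h: "ham_vector F x \<in> TA0 x" using ham_vector_tangent[OF xA hF] tangent_A0[OF xA] by simp
  have t: "trace (X ** moment_deriv x (ham_vector F x)) = 0" if X: "trace X = 0" for X
  proof -
    have "X \<in> tangent SL (mat 1)" by (simp add: tangent_SL X)
    then obtain S where S: "curve_at SL (mat 1) X S" unfolding tangent_def by blast
    have inv: "F (act T x) = F x" if "T \<in> SL" for T
      using F that unfolding invariant_lift_def by blast
    have c: "curve_at A0 x (inf_action X x) (\<lambda>t. act (S t) x)"
      by (rule curve_act[OF S xA]) (rule act_A0[OF _ xA])
    have "((\<lambda>t. F (act (S t) x)) has_vector_derivative 0) (at 0)"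
      using S inv by (simp add: curve_at_def)
    from differential_unique[OF hF c this] have "differential A0 F x (inf_action X x) = 0" .
    then have "omega x (ham_vector F x) (inf_action X x) = 0" using omega_ham_vector[OF xA hF inf_action_TA0[OF xA X]] by simp
    then show ?thesis using omega_skew[of x "ham_vector F x"] omega_inf_action[OF xA, of X "ham_vector F x"] by simp
  qed
  have "moment_deriv x (ham_vector F x) = 0"
    by (rule matrix_eq_zero_trace[OF t trace_moment_deriv[OF xA h]])
  then show ?thesis using h by (simp add: tangent_level_set[OF x])
qed

lemma differential_lift:
  assumes x: "x \<in> level_set" and H: "invariant_lift \<psi> x H" and v: "v \<in> tangent level_set x"
  shows "differential A0 H x v = diff_A \<psi> x v"
proof -
  have hH: "hol_at A0 H x" by (rule invariant_lift_hol[OF H])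
  have sub: "level_set \<subseteq> A0" using level_set_A0 by blast
  obtain W where W: "openin (top_of_set A0) W" "x \<in> W" "\<And>y. y \<in> W \<inter> level_set \<Longrightarrow> H y = \<psi> (proj y)"
    using H unfolding invariant_lift_def by blast
  have ev: "\<forall>\<^sub>F z in nhds x. z \<in> level_set \<longrightarrow> H z = \<psi> (proj z)"
    using eventually_openin[OF W(1,2)] by eventually_elim (auto intro: W(3) level_set_A0)
  have "differential A0 H x v = differential level_set H x v"
    by (rule differential_subset[OF sub hH v, symmetric])
  also have "\<dots> = diff_A \<psi> x v"
    unfolding diff_A_def by (rule differential_cong[OF hol_at_subset[OF hH sub] ev v])
  finally show ?thesis .
qed

lemma lift_bracket:
  assumes x: "x \<in> level_set" and F: "invariant_lift \<phi> x F" and H: "invariant_lift \<psi> x H"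
  shows "B F H x = diff_A \<psi> x (ham_vector F x)"
  using bracket_ham_vector[OF B level_set_A0[OF x] invariant_lift_hol[OF F] invariant_lift_hol[OF H]]
    differential_lift[OF x H ham_vector_lift_tangent[OF x F]] by simp

text \<open>
  The bracket depends on the second lift only through its restriction to the level set, to which the
  Hamiltonian vector of the first is tangent; by antisymmetry the same holds for the first lift.
\<close>

lemma lift_bracket_unique:
  assumes x: "x \<in> level_set" and F: "invariant_lift \<phi> x F" "invariant_lift \<phi> x F'"
    and H: "invariant_lift \<psi> x H" "invariant_lift \<psi> x H'"
  shows "B F H x = B F' H' x"
proof -
  note sk = bider_skew[OF B_bider level_set_A0[OF x]]
  have "B F H x = B F H' x" using lift_bracket[OF x F(1)] H by simp
  also have "\<dots> = - B H' F x" by (rule sk[OF invariant_lift_hol[OF F(1)] invariant_lift_hol[OF H(2)]])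
  also have "\<dots> = - B H' F' x" using lift_bracket[OF x H(2)] F by simp
  also have "\<dots> = B F' H' x" using sk[OF invariant_lift_hol[OF F(2)] invariant_lift_hol[OF H(2)]] by simp
  finally show ?thesis .
qed

lemma bracket_act:
  assumes x: "x \<in> A0" and S: "S \<in> SL" and F: "invariant_lift \<phi> x F" and H: "invariant_lift \<psi> x H"
  shows "B F H (act S x) = B F H x"
proof -
  have inv: "\<forall>\<^sub>F y in nhds x. y \<in> A0 \<longrightarrow> F (act S y) = F y" if F: "invariant_lift \<phi> x F" for \<phi> F
  proof -
    obtain W where W: "openin (top_of_set A0) W" "x \<in> W" "\<And>y. y \<in> W \<Longrightarrow> F (act S y) = F y"
      using F S unfolding invariant_lift_def by blast
    from eventually_openin[OF W(1,2)] show ?thesis by eventually_elim (auto intro: W(3))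
  qed
  note hF = invariant_lift_hol[OF F] and hH = invariant_lift_hol[OF H]
  note hF' = invariant_lift_hol[OF invariant_lift_transport[OF F S]]
    and hH' = invariant_lift_hol[OF invariant_lift_transport[OF H S]]
  have "B F H (act S x) = differential A0 H (act S x) (act S (ham_vector F x))"
    using bracket_ham_vector[OF B act_A0[OF S x] hF' hH'] ham_vector_act[OF x S hF hF' inv[OF F]] by simp
  also have "\<dots> = differential A0 H x (ham_vector F x)"
    by (rule differential_act[OF x S ham_vector_tangent[OF x hF] hH hH' inv[OF H]])
  also have "\<dots> = B F H x" using bracket_ham_vector[OF B x hF hH] by simp
  finally show ?thesis .
qed

lemma reduced_bracket_lift:
  assumes x: "x \<in> level_set" and F: "invariant_lift \<phi> x F" and H: "invariant_lift \<psi> x H"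
  shows "reduced_bracket B \<phi> \<psi> (proj x) = B F H x"
proof -
  define y where "y = (SOME y. y \<in> proj x)"
  have "y \<in> proj x" unfolding y_def using proj_self[OF x] by (rule someI)
  then obtain S where S: "S \<in> SL" "y = act S x" unfolding proj_eq[OF x] by blast
  have y: "y \<in> level_set" unfolding S(2) by (rule act_level_set[OF S(1) x])
  have Fy: "invariant_lift \<phi> y F" and Hy: "invariant_lift \<psi> y H"
    unfolding S(2) by (rule invariant_lift_transport[OF F S(1)], rule invariant_lift_transport[OF H S(1)])
  have "reduced_bracket B \<phi> \<psi> (proj x) = B (SOME F. invariant_lift \<phi> y F) (SOME H. invariant_lift \<psi> y H) y"
    by (simp add: reduced_bracket_def Let_def y_def)
  also have "\<dots> = B F H y"
    by (rule lift_bracket_unique[OF y someI[of "invariant_lift \<phi> y", OF Fy] Fy someI[of "invariant_lift \<psi> y", OF Hy] Hy])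
  also have "\<dots> = B F H x" unfolding S(2) by (rule bracket_act[OF level_set_A0[OF x] S(1) F H])
  finally show ?thesis .
qed

lemma is_reduced_bracket_reduced_bracket: "is_reduced_bracket B (reduced_bracket B)"
  unfolding is_reduced_bracket_def
proof (intro ballI allI impI)
  fix a :: "('N, 'n) point set" and \<phi> \<psi> :: "('N, 'n) point set \<Rightarrow> complex" and x
  assume a: "a \<in> A_space" and hol: "hol_A \<phi> a \<and> hol_A \<psi> a" and xa: "x \<in> a"
  note x = A_space_level_set[OF a xa]
  have "\<exists>F. invariant_lift \<phi> x F" "\<exists>H. invariant_lift \<psi> x H"
    using hol unfolding x(2) by (auto intro: invariant_lift_exists[OF x(1)])
  then show "(\<exists>F. invariant_lift \<phi> x F) \<and> (\<exists>H. invariant_lift \<psi> x H) \<and>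
      (\<forall>F H. invariant_lift \<phi> x F \<and> invariant_lift \<psi> x H \<longrightarrow> reduced_bracket B \<phi> \<psi> a = B F H x)"
    unfolding x(2) using reduced_bracket_lift[OF x(1)] by blast
qed

text \<open>
  Pointwise constructions with lifts give lifts on the intersection of the two invariant neighbourhoods.
\<close>

lemma lift_combine:
  assumes F: "invariant_lift \<phi> x F" and H: "invariant_lift \<psi> x H"
    and hol: "\<And>y. y \<in> A0 \<Longrightarrow> hol_at A0 F y \<Longrightarrow> hol_at A0 H y \<Longrightarrow> hol_at A0 K y"
    and inv: "\<And>S y. S \<in> SL \<Longrightarrow> y \<in> A0 \<Longrightarrow> invariant_lift \<phi> y F \<Longrightarrow> invariant_lift \<psi> y H \<Longrightarrow>
        F (act S y) = F y \<Longrightarrow> H (act S y) = H y \<Longrightarrow> K (act S y) = K y"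
    and val: "\<And>y. y \<in> level_set \<Longrightarrow> invariant_lift \<phi> y F \<Longrightarrow> invariant_lift \<psi> y H \<Longrightarrow>
        F y = \<phi> (proj y) \<Longrightarrow> H y = \<psi> (proj y) \<Longrightarrow> K y = \<eta> (proj y)"
  shows "invariant_lift \<eta> x K"
proof -
  obtain W where W: "openin (top_of_set A0) W" "x \<in> W" "\<And>y. y \<in> W \<Longrightarrow> hol_at A0 F y"
    "\<And>S y. S \<in> SL \<Longrightarrow> y \<in> W \<Longrightarrow> act S y \<in> W \<and> F (act S y) = F y"
    "\<And>y. y \<in> W \<inter> level_set \<Longrightarrow> F y = \<phi> (proj y)"
    using F unfolding invariant_lift_def by blast
  obtain V where V: "openin (top_of_set A0) V" "x \<in> V" "\<And>y. y \<in> V \<Longrightarrow> hol_at A0 H y"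
    "\<And>S y. S \<in> SL \<Longrightarrow> y \<in> V \<Longrightarrow> act S y \<in> V \<and> H (act S y) = H y"
    "\<And>y. y \<in> V \<inter> level_set \<Longrightarrow> H y = \<psi> (proj y)"
    using H unfolding invariant_lift_def by blast
  have lF: "invariant_lift \<phi> y F" if "y \<in> W" for y
    unfolding invariant_lift_def using W that by (intro exI[of _ W]) simp
  have lH: "invariant_lift \<psi> y H" if "y \<in> V" for y
    unfolding invariant_lift_def using V that by (intro exI[of _ V]) simp
  show ?thesis
    unfolding invariant_lift_def
  proof (intro exI[of _ "W \<inter> V"] conjI ballI)
    show "openin (top_of_set A0) (W \<inter> V)" by (rule openin_Int[OF W(1) V(1)])
    show "x \<in> W \<inter> V" using W V by simp
    show "hol_at A0 K y" if "y \<in> W \<inter> V" for y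
      by (rule hol) (use that W(3) V(3) openin_A0_subset[OF W(1)] in auto)
    show "act S y \<in> W \<inter> V" "K (act S y) = K y" if "S \<in> SL" "y \<in> W \<inter> V" for S y
      using that W(4) V(4) by (auto intro!: inv lF lH intro: openin_A0_subset[OF W(1)])
    show "K y = \<eta> (proj y)" if "y \<in> W \<inter> V \<inter> level_set" for y
      using that by (auto intro!: val lF lH W(5) V(5))
  qed
qed

lemma lift_reduced_bracket:
  assumes "invariant_lift \<phi> x F" "invariant_lift \<psi> x H"
  shows "invariant_lift (reduced_bracket B \<phi> \<psi>) x (B F H)"
  by (rule lift_combine[OF assms]) (simp_all add: bider_hol[OF B_bider] bracket_act reduced_bracket_lift)

lemma poisson_bracket_reduced_bracket: "poisson_bracket A_space hol_A (reduced_bracket B)"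
  unfolding poisson_bracket_def
proof (intro ballI allI impI)
  fix a :: "('N, 'n) point set" and \<phi> \<psi> \<eta> :: "('N, 'n) point set \<Rightarrow> complex" and c
  assume a: "a \<in> A_space" and hol: "hol_A \<phi> a \<and> hol_A \<psi> a \<and> hol_A \<eta> a"
  obtain x where "x \<in> a" using A_space_nonempty[OF a] by blast
  note x = A_space_level_set[OF a this]
  have xA: "x \<in> A0" by (rule level_set_A0[OF x(1)])
  obtain F where F: "invariant_lift \<phi> x F" using invariant_lift_exists[OF x(1)] hol x(2) by blast
  obtain H where H: "invariant_lift \<psi> x H" using invariant_lift_exists[OF x(1)] hol x(2) by blast
  obtain K where K: "invariant_lift \<eta> x K" using invariant_lift_exists[OF x(1)] hol x(2) by blast
  note hF = invariant_lift_hol[OF F] and hH = invariant_lift_hol[OF H] and hK = invariant_lift_hol[OF K]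
  have A0_bracket: "poisson_bracket A0 (hol_at A0) B" using B unfolding A0_poisson_structure_def by blast
  have ax: "B F H x = - B H F x" "B (\<lambda>q. c * F q) H x = c * B F H x"
     "B (\<lambda>q. F q + H q) K x = B F K x + B H K x"
     "B (\<lambda>q. F q * H q) K x = F x * B H K x + H x * B F K x"
     "B F (B H K) x + B H (B K F) x + B K (B F H) x = 0"
    using A0_bracket xA hF hH hK unfolding poisson_bracket_def by blast+
  have cF: "invariant_lift (\<lambda>q. c * \<phi> q) x (\<lambda>q. c * F q)"
    by (rule lift_combine[OF F F]) auto
  have FH: "invariant_lift (\<lambda>q. \<phi> q + \<psi> q) x (\<lambda>q. F q + H q)"
    by (rule lift_combine[OF F H]) auto
  have FmH: "invariant_lift (\<lambda>q. \<phi> q * \<psi> q) x (\<lambda>q. F q * H q)"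
    by (rule lift_combine[OF F H]) auto
  have val: "F x = \<phi> (proj x)" "H x = \<psi> (proj x)"
    using F H x(1) unfolding invariant_lift_def by blast+
  note r = reduced_bracket_lift[OF x(1)]
  show "hol_A (reduced_bracket B \<phi> \<psi>) a \<and> reduced_bracket B \<phi> \<psi> a = - reduced_bracket B \<psi> \<phi> a \<and>
        reduced_bracket B (\<lambda>q. c * \<phi> q) \<psi> a = c * reduced_bracket B \<phi> \<psi> a \<and>
        reduced_bracket B (\<lambda>q. \<phi> q + \<psi> q) \<eta> a = reduced_bracket B \<phi> \<eta> a + reduced_bracket B \<psi> \<eta> a \<and>
        reduced_bracket B (\<lambda>q. \<phi> q * \<psi> q) \<eta> a = \<phi> a * reduced_bracket B \<psi> \<eta> a + \<psi> a * reduced_bracket B \<phi> \<eta> a \<and>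
        reduced_bracket B \<phi> (reduced_bracket B \<psi> \<eta>) a + reduced_bracket B \<psi> (reduced_bracket B \<eta> \<phi>) a + reduced_bracket B \<eta> (reduced_bracket B \<phi> \<psi>) a = 0"
    unfolding x(2) r[OF F H] r[OF H F] r[OF cF H] r[OF FH K] r[OF FmH K] r[OF F K] r[OF H K]
      r[OF F lift_reduced_bracket[OF H K]] r[OF H lift_reduced_bracket[OF K F]] r[OF K lift_reduced_bracket[OF F H]]
    using ax hol_A_of_lift[OF x(1) lift_reduced_bracket[OF F H]] val by simp
qed

text \<open>
  The entries of \<open>slice x\<close> are invariant functions.  If all of them are annihilated by the Hamiltonian vector of
  a lift of \<open>\<phi>\<close>, then this vector is tangent to the orbit, and the form vanishes on it and any tangent vector of the level set.
\<close>

lemma nondegenerate_reduced_bracket: "nondegenerate_bracket (reduced_bracket B)"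
  unfolding nondegenerate_bracket_def
proof (intro ballI allI impI)
  fix a :: "('N, 'n) point set" and \<phi> :: "('N, 'n) point set \<Rightarrow> complex" and x v
  assume a: "a \<in> A_space" and A: "hol_A \<phi> a \<and> (\<forall>\<psi>. hol_A \<psi> a \<longrightarrow> reduced_bracket B \<phi> \<psi> a = 0)"
    and xa: "x \<in> a" and v: "v \<in> tangent level_set x"
  note x = A_space_level_set[OF a xa]
  have xA: "x \<in> A0" by (rule level_set_A0[OF x(1)])
  obtain F where F: "invariant_lift \<phi> x F" using invariant_lift_exists[OF x(1)] A x(2) by blast
  define u where "u = ham_vector F x"
  have u: "u \<in> tangent level_set x" unfolding u_def by (rule ham_vector_lift_tangent[OF x(1) F])
  define j0 :: 'N where "j0 = (SOME j. True)"
  define Ds where "Ds = mk_point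
     (\<lambda>j. Gmat j u - Gmat j0 u ** matrix_inv (Gmat j0 x) ** Gmat j x) (\<lambda>j. Lmat j u)"
  have der: "(slice x has_derivative (\<lambda>w. mk_point
     (\<lambda>j. Gmat j w - Gmat j0 w ** matrix_inv (Gmat j0 x) ** Gmat j x) (\<lambda>j. Lmat j w))) (at x)"
  proof -
    have "((\<lambda>y. Gmat j0 x ** matrix_inv (Gmat j0 y) ** Gmat j y) has_derivative
       (\<lambda>w. Gmat j w - Gmat j0 w ** matrix_inv (Gmat j0 x) ** Gmat j x)) (at x)" for j
    proof -
      have "((\<lambda>y. matrix_inv (Gmat j0 y) ** Gmat j y) has_derivative
         (\<lambda>w. matrix_inv (Gmat j0 x) ** Gmat j w
           + - (matrix_inv (Gmat j0 x) ** Gmat j0 w ** matrix_inv (Gmat j0 x)) ** Gmat j x)) (at x)"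
        by (intro has_derivative_matrix_mult has_derivative_inv_Gmat has_derivative_Gmat) (simp add: xA)
      from bounded_linear.has_derivative[OF bounded_bilinear.bounded_linear_right[OF bounded_bilinear_matrix_mult,
          of "Gmat j0 x"] this]
      show ?thesis
        using xA by (simp add: matrix_add_ldistrib matrix_diff_distrib matrix_mul_assoc[symmetric] matrix_inv_cancel)
    qed
    from has_derivative_mk_point[OF this has_derivative_Lmat]
    show ?thesis unfolding slice_def[abs_def] act_def j0_def .
  qed
  have "Ds $ i = 0" for i
  proof -
    \<comment> \<open>well defined on orbits since \<open>slice x\<close> is invariant\<close>
    define \<psi> :: "('N, 'n) point set \<Rightarrow> complex" where "\<psi> b = slice x (SOME y. y \<in> b) $ i" for b
    have \<psi>: "\<psi> (proj y) = slice x y $ i" if y: "y \<in> level_set" for y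
    proof -
      have "(SOME z. z \<in> proj y) \<in> proj y" using proj_self[OF y] by (rule someI)
      then obtain S where "S \<in> SL" "(SOME z. z \<in> proj y) = act S y" unfolding proj_eq[OF y] by blast
      then show ?thesis by (simp add: \<psi>_def slice_act level_set_A0[OF y])
    qed
    have hs: "hol_at level_set (\<lambda>y. slice x y $ i) y" if "y \<in> level_set" for y
      by (rule hol_at_holo[OF holo_slice_nth[OF level_set_A0[OF that]]])
    have "hol_A \<psi> a"
      unfolding hol_A_def
    proof
      fix y assume "y \<in> a"
      then have y: "y \<in> level_set" by (rule A_space_level_set(1)[OF a])
      show "hol_at level_set (\<lambda>y. \<psi> (proj y)) y"
        by (rule hol_at_cong[OF hs[OF y]]) (simp add: \<psi>)
    qed
    then have 0: "reduced_bracket B \<phi> \<psi> a = 0" using A by blast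
    obtain H where H: "invariant_lift \<psi> x H"
      using invariant_lift_exists[OF x(1)] \<open>hol_A \<psi> a\<close> x(2) by blast
    have "diff_A \<psi> x u = 0"
      using 0 reduced_bracket_lift[OF x(1) F H] lift_bracket[OF x(1) F H] x(2) by (simp add: u_def)
    moreover have "diff_A \<psi> x u = differential level_set (\<lambda>y. slice x y $ i) x u"
      unfolding diff_A_def by (rule differential_cong[OF hs[OF x(1)] _ u, symmetric]) (simp add: \<psi>)
    moreover have "\<dots> = Ds $ i"
      unfolding Ds_def
      by (rule differential_has_derivative[OF hs[OF x(1)] u])
        (rule bounded_linear.has_derivative[OF bounded_linear_vec_nth der])
    ultimately show ?thesis by simp
  qed
  then have D0: "Ds = 0" by (simp add: vec_eq_iff)
  define X where "X = Gmat j0 u ** matrix_inv (Gmat j0 x)"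
  have "u = inf_action X x"
  proof (rule point_eqI)
    show "Gmat j u = Gmat j (inf_action X x)" for j
      using arg_cong[OF D0, of "Gmat j"] by (simp add: Ds_def X_def Gmat_linear)
    show "Lmat j u = Lmat j (inf_action X x)" for j
      using arg_cong[OF D0, of "Lmat j"] by (simp add: Ds_def Lmat_linear)
  qed
  then have "omega x u v = 0"
    using v by (simp add: omega_inf_action[OF xA] tangent_level_set[OF x(1)])
  moreover have "omega x u v = - differential A0 F x v"
    unfolding u_def by (rule omega_ham_vector[OF xA invariant_lift_hol[OF F]]) (use v in \<open>simp add: tangent_level_set[OF x(1)]\<close>)
  ultimately show "diff_A \<phi> x v = 0" using differential_lift[OF x(1) F v] by simp
qed

lemma corresponds_reduced_bracket: "corresponds (reduced_bracket B) (ext_d1 theta_A)"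
  unfolding corresponds_def
proof (intro ballI allI impI)
  fix a :: "('N, 'n) point set" and \<phi> :: "('N, 'n) point set \<Rightarrow> complex" and x
  assume a: "a \<in> A_space" and xa: "x \<in> a" and hol: "hol_A \<phi> a"
  note x = A_space_level_set[OF a xa]
  have xA: "x \<in> A0" by (rule level_set_A0[OF x(1)])
  have e: "ext_d1 theta_A x = omega x" by (intro ext ext_d1_theta_A) (simp add: xA)
  obtain F where F: "invariant_lift \<phi> x F" using invariant_lift_exists[OF x(1)] hol x(2) by blast
  show "\<exists>u\<in>tangent level_set x. (\<forall>w\<in>tangent level_set x. ext_d1 theta_A x u w = - diff_A \<phi> x w) \<and>
      (\<forall>\<psi>. hol_A \<psi> a \<longrightarrow> reduced_bracket B \<phi> \<psi> a = diff_A \<psi> x u)"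
  proof (intro bexI[of _ "ham_vector F x"] conjI ballI allI impI)
    show "ham_vector F x \<in> tangent level_set x" by (rule ham_vector_lift_tangent[OF x(1) F])
    show "ext_d1 theta_A x (ham_vector F x) w = - diff_A \<phi> x w" if w: "w \<in> tangent level_set x" for w
      using omega_ham_vector[OF xA invariant_lift_hol[OF F], of w] w differential_lift[OF x(1) F w]
      by (simp add: e tangent_level_set[OF x(1)])
    fix \<psi> assume "hol_A \<psi> a"
    then obtain H where H: "invariant_lift \<psi> x H" using invariant_lift_exists[OF x(1)] x(2) by blast
    show "reduced_bracket B \<phi> \<psi> a = diff_A \<psi> x (ham_vector F x)"
      unfolding x(2) reduced_bracket_lift[OF x(1) F H] by (rule lift_bracket[OF x(1) F H])
  qed
qed

end

theorem theorem1:
  shows "(\<exists>B0 :: ('N::finite, 'n::{finite, linorder}) bracket. A0_poisson_structure B0) \<and>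
    (\<forall>B0 :: ('N, 'n) bracket. A0_poisson_structure B0 \<longrightarrow>
       is_moment_map B0 moment_map \<and>
       (\<exists>B :: ('N, 'n) red_bracket.
          is_reduced_bracket B0 B \<and>
          poisson_bracket A_space hol_A B \<and>
          nondegenerate_bracket B \<and>
          descends1 (theta_A :: ('N, 'n) point \<Rightarrow> ('N, 'n) point \<Rightarrow> complex) \<and>
          symplectic_form_A (ext_d1 (theta_A :: ('N, 'n) point \<Rightarrow> ('N, 'n) point \<Rightarrow> complex)) \<and>
          corresponds B (ext_d1 theta_A)))"
proof (intro conjI allI impI)
  show "\<exists>B0 :: ('N, 'n) bracket. A0_poisson_structure B0"
    using A0_poisson_structure_A0_bracket by blast
  fix B0 :: "('N, 'n) bracket" assume B0: "A0_poisson_structure B0"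
  show "is_moment_map B0 moment_map" by (rule is_moment_map_moment_map[OF B0])
  show "\<exists>B :: ('N, 'n) red_bracket. is_reduced_bracket B0 B \<and> poisson_bracket A_space hol_A B \<and>
          nondegenerate_bracket B \<and>
          descends1 (theta_A :: ('N, 'n) point \<Rightarrow> ('N, 'n) point \<Rightarrow> complex) \<and>
          symplectic_form_A (ext_d1 (theta_A :: ('N, 'n) point \<Rightarrow> ('N, 'n) point \<Rightarrow> complex)) \<and>
          corresponds B (ext_d1 theta_A)"
    by (intro exI[of _ "reduced_bracket B0"] conjI is_reduced_bracket_reduced_bracket[OF B0] poisson_bracket_reduced_bracket[OF B0]
        nondegenerate_reduced_bracket[OF B0] descends1_theta_A symplectic_form_A_ext_d1_theta_A corresponds_reduced_bracket[OF B0])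
qed

end
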